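(* Let $\{Y_n\}_{n\ge 1}$ be a time series that is $I(1)$ in the sense that, for some constant $0<\sigma<\infty$, $N^{-1/2}Y_{\lfloor Ns\rfloor}\Rightarrow \sigma B(s)$, $s\in[0,1]$, in $D[0,1]$ as $N\to\infty$. Let $\kappa\in(0,1)$. Then $$U_N(s)\Rightarrow \mathcal{U}_1(s)=\frac{\zeta s^{-1}\int_0^s K(\zeta(r-s))\left[\int_0^r B(t)\,dt\right]^2 dr}{\int_0^s B(r)^2\,dr}$$ in $D[\kappa,1]$, as $N\to\infty$ with $N/h\to\zeta$. Moreover, the process $\mathcal{U}_1$ has continuous sample paths with probability $1$.
   Context: $B$ denotes standard Brownian motion on $[0,1]$; $\Rightarrow$ denotes weak convergence in the space of right-continuous functions with left-hand limits on the indicated interval ($D[0,1]$ or $D[\kappa,1]$), equipped with the Skorohod topology; $\lfloor x\rfloor$ is the floor function. Kernel and bandwidth: $K:\mathbb{R}\to[0,\infty)$ is a Lipschitz continuous probability density, symmetric around $0$, with mean $0$ and finite variance; $h=h_N>0$ is a sequence of bandwidths with $N/h_N\to\zeta\in[1,\infty)$ as $N\to\infty$; $K_h(x)=K(x/h)/h$. The sequential kernel-weighted variance-ratio process is $U_N(s)=0$ for $s\in[0,1/N)$ and $$U_N(s)=\frac{\lfloor Ns\rfloor^{-3}\sum_{i=1}^{\lfloor Ns\rfloor}\left(\sum_{j=1}^i Y_j\right)^2K_h(i-\lfloor Ns\rfloor)}{\lfloor Ns\rfloor^{-2}\sum_{j=1}^{\lfloor Ns\rfloor}Y_j^2},\qquad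 s\in[1/N,1].$$ *)

theory Defs
  imports "HOL-Probability.Probability"
begin

section \<open>The Skorohod space $D[a,b]$\<close>

text \<open>Paths are real functions that are extensional outside the interval, so that two
  elements of the space are equal iff they agree on the interval.\<close>

definition cadlag_space :: "real \<Rightarrow> real \<Rightarrow> (real \<Rightarrow> real) set" where
  "cadlag_space a b = {x \<in> extensional {a..b}.
     (\<forall>t\<in>{a..<b}. (x \<longlongrightarrow> x t) (at_right t)) \<and>
     (\<forall>t\<in>{a<..b}. \<exists>l. (x \<longlongrightarrow> l) (at_left t))}"

definition time_changes :: "real \<Rightarrow> real \<Rightarrow> (real \<Rightarrow> real) set" where
  "time_changes a b = {l. strict_mono_on {a..b} l \<and> continuous_on {a..b} l \<and> l ` {a..b} = {a..b}}"

text \<open>The value outside the Skorohod space is irrelevant; it is set to 0 because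
  \<^locale>\<open>Metric_space\<close> asks for nonnegativity and symmetry on the whole type.\<close>

definition skorohod_dist :: "real \<Rightarrow> real \<Rightarrow> (real \<Rightarrow> real) \<Rightarrow> (real \<Rightarrow> real) \<Rightarrow> real" where
  "skorohod_dist a b x y =
     (if x \<in> cadlag_space a b \<and> y \<in> cadlag_space a b
      then Inf {e. 0 < e \<and> (\<exists>l\<in>time_changes a b.
                 \<forall>t\<in>{a..b}. \<bar>l t - t\<bar> \<le> e \<and> \<bar>x t - y (l t)\<bar> \<le> e)}
      else 0)"

definition skorohod_topology :: "real \<Rightarrow> real \<Rightarrow> (real \<Rightarrow> real) topology" where
  "skorohod_topology a b = Metric_space.mtopology (cadlag_space a b) (skorohod_dist a b)"

definition skorohod_borel :: "real \<Rightarrow> real \<Rightarrow> (real \<Rightarrow> real) measure" where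
  "skorohod_borel a b = sigma (cadlag_space a b) {U. openin (skorohod_topology a b) U}"

subsection \<open>The Skorohod distance is a metric\<close>

lemma cadlag_space_bounded:
  assumes x: "x \<in> cadlag_space a b"
  shows "\<exists>C. \<forall>t\<in>{a..b}. \<bar>x t\<bar> \<le> C"
proof (cases "a \<le> b")
  case True
  define P where "P u v \<longleftrightarrow> (\<exists>C. \<forall>t\<in>{u..v} \<inter> {a..b}. \<bar>x t\<bar> \<le> C)" for u v
  have "P a b" using True
  proof (induction rule: Bolzano)
    case (trans u v w)
    then obtain C D where "\<forall>t\<in>{u..v} \<inter> {a..b}. \<bar>x t\<bar> \<le> C" "\<forall>t\<in>{v..w} \<inter> {a..b}. \<bar>x t\<bar> \<le> D"
      unfolding P_def by blast
    then have "\<forall>t\<in>{u..w} \<inter> {a..b}. \<bar>x t\<bar> \<le> max C D"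
      by (metis IntE IntI atLeastAtMost_iff le_max_iff_disj linear)
    then show ?case unfolding P_def by blast
  next
    case (local s)
    have R: "\<exists>d>0. \<exists>C. \<forall>t\<in>{s<..<s+d} \<inter> {a..b}. \<bar>x t\<bar> \<le> C"
    proof (cases "s < b")
      case True
      then have "(x \<longlongrightarrow> x s) (at_right s)"
        using x local by (auto simp: cadlag_space_def)
      then have "eventually (\<lambda>t. dist (x t) (x s) < 1) (at_right s)"
        by (rule tendstoD) simp
      then obtain c where "c > s" "\<forall>t. s < t \<longrightarrow> t < c \<longrightarrow> dist (x t) (x s) < 1"
        by (auto simp: eventually_at_right_field)
      then show ?thesis
        by (intro exI[of _ "c - s"] conjI exI[of _ "\<bar>x s\<bar> + 1"]) (auto simp: dist_real_def)
    qed (use local in \<open>intro exI[of _ 1], auto\<close>)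
    have L: "\<exists>d>0. \<exists>C. \<forall>t\<in>{s-d<..<s} \<inter> {a..b}. \<bar>x t\<bar> \<le> C"
    proof (cases "a < s")
      case True
      then have "s \<in> {a<..b}" using local by simp
      then obtain m where "(x \<longlongrightarrow> m) (at_left s)"
        using x unfolding cadlag_space_def by blast
      then have "eventually (\<lambda>t. dist (x t) m < 1) (at_left s)"
        by (rule tendstoD) simp
      then obtain c where "c < s" "\<forall>t. c < t \<longrightarrow> t < s \<longrightarrow> dist (x t) m < 1"
        by (auto simp: eventually_at_left_field)
      then show ?thesis
        by (intro exI[of _ "s - c"] conjI exI[of _ "\<bar>m\<bar> + 1"]) (auto simp: dist_real_def)
    qed (use local in \<open>intro exI[of _ 1], auto\<close>)
    obtain d1 C1 where 1: "d1 > 0" "\<forall>t\<in>{s<..<s+d1} \<inter> {a..b}. \<bar>x t\<bar> \<le> C1" using R by blast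
    obtain d2 C2 where 2: "d2 > 0" "\<forall>t\<in>{s-d2<..<s} \<inter> {a..b}. \<bar>x t\<bar> \<le> C2" using L by blast
    show ?case
    proof (intro exI[of _ "min d1 d2"] conjI allI impI)
      fix u v assume uv: "u \<le> s \<and> s \<le> v \<and> v - u < min d1 d2"
      have "\<bar>x t\<bar> \<le> \<bar>C1\<bar> + \<bar>C2\<bar> + \<bar>x s\<bar>" if t: "t \<in> {u..v} \<inter> {a..b}" for t
      proof -
        consider "t < s" | "t = s" | "t > s" by linarith
        then show ?thesis
        proof cases
          case 1 with t uv 2 have "\<bar>x t\<bar> \<le> C2" by auto
          then show ?thesis by linarith
        next
          case 3 with t uv 1 \<open>\<forall>t\<in>{s<..<s+d1} \<inter> {a..b}. \<bar>x t\<bar> \<le> C1\<close> have "\<bar>x t\<bar> \<le> C1" by auto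
          then show ?thesis by linarith
        qed auto
      qed
      then show "P u v" unfolding P_def by blast
    qed (use 1 2 in auto)
  qed
  then show ?thesis unfolding P_def by auto
qed auto

lemma time_changes_id: "(\<lambda>t. t) \<in> time_changes a b"
  by (auto simp: time_changes_def strict_mono_on_def)

lemma time_changes_comp:
  assumes "l \<in> time_changes a b" "m \<in> time_changes a b"
  shows "(\<lambda>t. m (l t)) \<in> time_changes a b"
proof -
  have l: "strict_mono_on {a..b} l" "continuous_on {a..b} l" "l ` {a..b} = {a..b}"
    using assms(1) by (simp_all add: time_changes_def)
  have m: "strict_mono_on {a..b} m" "continuous_on {a..b} m" "m ` {a..b} = {a..b}"
    using assms(2) by (simp_all add: time_changes_def)
  have mem: "l t \<in> {a..b}" if "t \<in> {a..b}" for t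
    using imageI[OF that, of l] unfolding l(3) .
  have "strict_mono_on {a..b} (\<lambda>t. m (l t))"
    by (rule strict_mono_onI) (use strict_mono_onD[OF l(1)] strict_mono_onD[OF m(1)] mem in blast)
  moreover have "continuous_on {a..b} (\<lambda>t. m (l t))"
    by (rule continuous_on_compose2[OF m(2) l(2)]) (simp add: l(3))
  moreover have "(\<lambda>t. m (l t)) ` {a..b} = {a..b}"
    using image_image[of m l "{a..b}"] unfolding l(3) m(3) by simp
  ultimately show ?thesis by (simp add: time_changes_def)
qed

lemma time_changes_inverse:
  assumes "l \<in> time_changes a b"
  obtains m where "m \<in> time_changes a b"
    "\<And>t. t \<in> {a..b} \<Longrightarrow> l (m t) = t" "\<And>t. t \<in> {a..b} \<Longrightarrow> m (l t) = t"
proof -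
  have l: "strict_mono_on {a..b} l" "continuous_on {a..b} l" "l ` {a..b} = {a..b}"
    using assms by (auto simp: time_changes_def)
  have inj: "inj_on l {a..b}" using l(1) strict_mono_on_imp_inj_on by blast
  define m where "m = the_inv_into {a..b} l"
  have lm: "l (m t) = t" if "t \<in> {a..b}" for t
    using f_the_inv_into_f[OF inj] that l(3) by (simp add: m_def)
  have ml: "m (l t) = t" if "t \<in> {a..b}" for t
    using the_inv_into_f_f[OF inj that] by (simp add: m_def)
  have im: "m ` {a..b} = {a..b}"
  proof -
    have "m ` {a..b} = m ` (l ` {a..b})" by (simp only: l(3))
    also have "\<dots> = (\<lambda>t. t) ` {a..b}" unfolding image_image by (rule image_cong) (auto simp: ml)
    finally show ?thesis by simp
  qed
  have "continuous_on (l ` {a..b}) m"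
    by (rule continuous_on_inv[OF l(2)]) (auto simp: ml)
  moreover have "strict_mono_on {a..b} m"
  proof (rule strict_mono_onI)
    fix r s assume rs: "r \<in> {a..b}" "s \<in> {a..b}" "r < s"
    have mrs: "m r \<in> {a..b}" "m s \<in> {a..b}" using im rs by blast+
    show "m r < m s"
    proof (rule ccontr)
      assume "\<not> m r < m s"
      then have "l (m s) \<le> l (m r)"
        using strict_mono_onD[OF l(1) mrs(2,1)] by (cases "m s = m r") auto
      then show False using lm rs by auto
    qed
  qed
  ultimately have "m \<in> time_changes a b" using im l(3) by (simp add: time_changes_def)
  then show thesis using that lm ml by blast
qed

definition close_paths ::
  "real \<Rightarrow> real \<Rightarrow> real \<Rightarrow> (real \<Rightarrow> real) \<Rightarrow> (real \<Rightarrow> real) \<Rightarrow> bool" where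
  "close_paths a b e x y \<longleftrightarrow> 0 < e \<and> (\<exists>l\<in>time_changes a b.
     \<forall>t\<in>{a..b}. \<bar>l t - t\<bar> \<le> e \<and> \<bar>x t - y (l t)\<bar> \<le> e)"

lemma close_pathsI:
  assumes "0 < e" "l \<in> time_changes a b"
    "\<And>t. t \<in> {a..b} \<Longrightarrow> \<bar>l t - t\<bar> \<le> e \<and> \<bar>x t - y (l t)\<bar> \<le> e"
  shows "close_paths a b e x y"
  using assms unfolding close_paths_def by blast

lemma close_pathsE:
  assumes "close_paths a b e x y"
  obtains l where "0 < e" "l \<in> time_changes a b"
    "\<And>t. t \<in> {a..b} \<Longrightarrow> \<bar>l t - t\<bar> \<le> e \<and> \<bar>x t - y (l t)\<bar> \<le> e"
  using assms unfolding close_paths_def by blast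

lemma time_changes_mem: "l \<in> time_changes a b \<Longrightarrow> t \<in> {a..b} \<Longrightarrow> l t \<in> {a..b}"
  unfolding time_changes_def by blast

lemma close_paths_sym: assumes "close_paths a b e x y" shows "close_paths a b e y x"
proof -
  obtain l where l: "0 < e" "l \<in> time_changes a b"
    "\<And>t. t \<in> {a..b} \<Longrightarrow> \<bar>l t - t\<bar> \<le> e \<and> \<bar>x t - y (l t)\<bar> \<le> e"
    using close_pathsE[OF assms] by metis
  obtain m where m: "m \<in> time_changes a b" "\<And>t. t \<in> {a..b} \<Longrightarrow> l (m t) = t"
    using time_changes_inverse[OF l(2)] by metis
  have "\<bar>m t - t\<bar> \<le> e \<and> \<bar>y t - x (m t)\<bar> \<le> e" if t: "t \<in> {a..b}" for t
    using l(3)[OF time_changes_mem[OF m(1) t]] m(2)[OF t] by (simp add: abs_minus_commute)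
  then show ?thesis by (rule close_pathsI[OF l(1) m(1)])
qed

lemma close_paths_trans:
  assumes "close_paths a b e x y" "close_paths a b f y z"
  shows "close_paths a b (e + f) x z"
proof -
  obtain l where l: "0 < e" "l \<in> time_changes a b"
    "\<And>t. t \<in> {a..b} \<Longrightarrow> \<bar>l t - t\<bar> \<le> e \<and> \<bar>x t - y (l t)\<bar> \<le> e"
    using close_pathsE[OF assms(1)] by metis
  obtain m where m: "0 < f" "m \<in> time_changes a b"
    "\<And>t. t \<in> {a..b} \<Longrightarrow> \<bar>m t - t\<bar> \<le> f \<and> \<bar>y t - z (m t)\<bar> \<le> f"
    using close_pathsE[OF assms(2)] by metis
  have "\<bar>m (l t) - t\<bar> \<le> e + f \<and> \<bar>x t - z (m (l t))\<bar> \<le> e + f" if t: "t \<in> {a..b}" for t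
    using l(3)[OF t] m(3)[OF time_changes_mem[OF l(2) t]] by linarith
  then show ?thesis
    using l(1) m(1) by (intro close_pathsI[OF _ time_changes_comp[OF l(2) m(2)]]) auto
qed

lemma close_paths_exists:
  assumes "x \<in> cadlag_space a b" "y \<in> cadlag_space a b"
  shows "\<exists>e. close_paths a b e x y"
proof -
  obtain C where C: "\<forall>t\<in>{a..b}. \<bar>x t\<bar> \<le> C" using cadlag_space_bounded[OF assms(1)] by blast
  obtain D where D: "\<forall>t\<in>{a..b}. \<bar>y t\<bar> \<le> D" using cadlag_space_bounded[OF assms(2)] by blast
  define e where "e = \<bar>C\<bar> + \<bar>D\<bar> + 1"
  have e: "0 < e" by (simp add: e_def)
  have "\<bar>t - t\<bar> \<le> e \<and> \<bar>x t - y t\<bar> \<le> e" if "t \<in> {a..b}" for t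
    using C[rule_format, OF that] D[rule_format, OF that] e unfolding e_def by linarith
  then show ?thesis using close_pathsI[OF e time_changes_id] by blast
qed

lemma close_paths_all_imp_eq:
  assumes x: "x \<in> cadlag_space a b" and y: "y \<in> cadlag_space a b"
    and close: "\<And>e. 0 < e \<Longrightarrow> close_paths a b e x y"
  shows "x = y"
proof (rule extensionalityI)
  show "x \<in> extensional {a..b}" "y \<in> extensional {a..b}"
    using x y by (auto simp: cadlag_space_def)
  fix t assume t: "t \<in> {a..b}"
  show "x t = y t"
  proof (cases "t = b")
    case True
    have lb: "l b = b" if "l \<in> time_changes a b" for l
    proof -
      have l: "strict_mono_on {a..b} l" "l ` {a..b} = {a..b}"
        using that by (auto simp: time_changes_def)
      have b: "b \<in> {a..b}" using t by auto
      then obtain s where s: "s \<in> {a..b}" "l s = b" using l(2) by (metis imageE)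
      have "l b \<in> {a..b}" using l(2) b by blast
      then show ?thesis using strict_mono_onD[OF l(1) s(1) b] s by force
    qed
    have "\<bar>x b - y b\<bar> \<le> e" if "0 < e" for e
      using close_pathsE[OF close[OF that]] t True lb by metis
    then have "\<bar>x b - y b\<bar> \<le> 0" by (meson dense not_le)
    then show ?thesis using True by simp
  next
    case False
    then have tb: "t \<in> {a..<b}" using t by auto
    have "\<bar>x t - y t\<bar> \<le> e" if e: "0 < e" for e
    proof -
      have lim: "(x \<longlongrightarrow> x t) (at_right t)" "(y \<longlongrightarrow> y t) (at_right t)"
        using x y tb by (auto simp: cadlag_space_def)
      have "eventually (\<lambda>u. dist (x u) (x t) < e/3 \<and> dist (y u) (y t) < e/3) (at_right t)"
        using lim e by (intro eventually_conj tendstoD) auto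
      then obtain c where c: "c > t"
        "\<And>u. t < u \<Longrightarrow> u < c \<Longrightarrow> dist (x u) (x t) < e/3 \<and> dist (y u) (y t) < e/3"
        by (auto simp: eventually_at_right_field)
      define d where "d = min (b - t) (c - t)"
      have d: "d > 0" "d \<le> b - t" "d \<le> c - t" using tb c by (auto simp: d_def)
      have "0 < min (e/3) (d/4)" using e d by simp
      from close[OF this] obtain l where l: "\<And>u. u \<in> {a..b} \<Longrightarrow>
          \<bar>l u - u\<bar> \<le> min (e/3) (d/4) \<and> \<bar>x u - y (l u)\<bar> \<le> min (e/3) (d/4)"
        by (elim close_pathsE) blast
      define u where "u = t + d/2"
      have u: "u \<in> {a..b}" "t < u" "u < c" using tb d by (auto simp: u_def)
      have lu: "\<bar>l u - u\<bar> \<le> d/4" "\<bar>x u - y (l u)\<bar> \<le> e/3" using l[OF u(1)] by auto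
      have "t < l u" "l u < c" using lu(1) d unfolding u_def by linarith+
      from c(2)[OF this] c(2)[OF u(2,3)] lu(2) show ?thesis
        unfolding dist_real_def by linarith
    qed
    then have "\<bar>x t - y t\<bar> \<le> 0" by (meson dense not_le)
    then show ?thesis by simp
  qed
qed

lemma Metric_space_skorohod: "Metric_space (cadlag_space a b) (skorohod_dist a b)"
proof -
  let ?D = "cadlag_space a b"
  define S where "S x y = {e. close_paths a b e x y}" for x y
  have d_eq: "skorohod_dist a b x y = (if x \<in> ?D \<and> y \<in> ?D then Inf (S x y) else 0)" for x y
    unfolding skorohod_dist_def S_def close_paths_def ..
  have ne: "S x y \<noteq> {}" if "x \<in> ?D" "y \<in> ?D" for x y
    using close_paths_exists[OF that] by (simp add: S_def)
  have pos: "0 < e" if "e \<in> S x y" for e x y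
    using that by (simp add: S_def close_paths_def)
  have bdd: "bdd_below (S x y)" for x y
    using pos by (intro bdd_belowI[of _ 0]) (simp add: less_imp_le)
  have sym: "S x y = S y x" for x y
    unfolding S_def using close_paths_sym by blast
  have mono: "f \<in> S x y" if "e \<in> S x y" "e \<le> f" for e f x y
  proof -
    have "close_paths a b e x y" using that(1) by (simp add: S_def)
    from close_pathsE[OF this] obtain l where l: "0 < e" "l \<in> time_changes a b"
      "\<And>t. t \<in> {a..b} \<Longrightarrow> \<bar>l t - t\<bar> \<le> e \<and> \<bar>x t - y (l t)\<bar> \<le> e"
      by metis
    have "\<bar>l t - t\<bar> \<le> f \<and> \<bar>x t - y (l t)\<bar> \<le> f" if "t \<in> {a..b}" for t
      using l(3)[OF that] \<open>e \<le> f\<close> by linarith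
    then show ?thesis unfolding S_def mem_Collect_eq
      using l(1) that(2) by (intro close_pathsI[OF _ l(2)]) auto
  qed
  show ?thesis
  proof
    fix x y
    show "0 \<le> skorohod_dist a b x y"
    proof (cases "x \<in> ?D \<and> y \<in> ?D")
      case True
      have "0 \<le> Inf (S x y)"
        by (rule cInf_greatest) (use True ne pos in \<open>auto simp: less_imp_le\<close>)
      then show ?thesis using True by (simp add: d_eq)
    qed (auto simp: d_eq)
    show "skorohod_dist a b x y = skorohod_dist a b y x"
      using sym[of x y] by (auto simp: d_eq)
  next
    fix x y assume xy: "x \<in> ?D" "y \<in> ?D"
    show "skorohod_dist a b x y = 0 \<longleftrightarrow> x = y"
    proof
      assume 0: "skorohod_dist a b x y = 0"
      have "close_paths a b e x y" if "0 < e" for e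
      proof -
        have "Inf (S x y) < e" using 0 xy that by (simp add: d_eq)
        then obtain f where f: "f \<in> S x y" "f < e"
          using cInf_less_iff[OF ne[OF xy] bdd] by blast
        have "e \<in> S x y" by (rule mono[OF f(1)]) (use f(2) in simp)
        then show ?thesis by (simp add: S_def)
      qed
      then show "x = y" using close_paths_all_imp_eq[OF xy] by blast
    next
      assume "x = y"
      then have "e \<in> S x y" if "0 < e" for e
        using that unfolding S_def mem_Collect_eq
        by (intro close_pathsI[OF _ time_changes_id]) auto
      then have "S x y = {0<..}" using pos by auto
      then show "skorohod_dist a b x y = 0" using xy by (simp add: d_eq)
    qed
  next
    fix x y z assume xyz: "x \<in> ?D" "y \<in> ?D" "z \<in> ?D"
    have *: "Inf (S x z) \<le> e + f" if "e \<in> S x y" "f \<in> S y z" for e f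
      using that close_paths_trans[of a b e x y f z]
      by (intro cInf_lower[OF _ bdd]) (simp add: S_def)
    have "Inf (S x z) - e \<le> Inf (S y z)" if "e \<in> S x y" for e
    proof (rule cInf_greatest[OF ne[OF xyz(2,3)]])
      fix f assume "f \<in> S y z"
      from *[OF that this] show "Inf (S x z) - e \<le> f" by linarith
    qed
    then have "Inf (S x z) - Inf (S y z) \<le> e" if "e \<in> S x y" for e
      using that by (smt (verit))
    then have "Inf (S x z) - Inf (S y z) \<le> Inf (S x y)"
      by (rule cInf_greatest[OF ne[OF xyz(1,2)]])
    then show "skorohod_dist a b x z \<le> skorohod_dist a b x y + skorohod_dist a b y z"
      using xyz by (simp add: d_eq)
  qed
qed

section \<open>Weak convergence of processes in $D[a,b]$\<close>

definition sample_path :: "real \<Rightarrow> real \<Rightarrow> (real \<Rightarrow> 'w \<Rightarrow> real) \<Rightarrow> 'w \<Rightarrow> real \<Rightarrow> real" where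
  "sample_path a b X \<omega> = (\<lambda>t\<in>{a..b}. X t \<omega>)"

text \<open>Convergence of the expectations of all bounded Skorohod-continuous functionals. All
  processes involved are required to be random elements of the space, and the limit may live
  on a different probability space.\<close>

definition weak_conv_cadlag ::
  "real \<Rightarrow> real \<Rightarrow> 'w measure \<Rightarrow> (nat \<Rightarrow> real \<Rightarrow> 'w \<Rightarrow> real) \<Rightarrow>
   'v measure \<Rightarrow> (real \<Rightarrow> 'v \<Rightarrow> real) \<Rightarrow> bool" where
  "weak_conv_cadlag a b M X P Z \<longleftrightarrow>
     (\<forall>N. sample_path a b (X N) \<in> measurable M (skorohod_borel a b)) \<and>
     sample_path a b Z \<in> measurable P (skorohod_borel a b) \<and>
     (\<forall>f. continuous_map (skorohod_topology a b) euclideanreal f \<and>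
          bounded (f ` cadlag_space a b) \<longrightarrow>
       (\<lambda>N. \<integral>\<omega>. f (sample_path a b (X N) \<omega>) \<partial>M) \<longlonglongrightarrow> (\<integral>\<omega>. f (sample_path a b Z \<omega>) \<partial>P))"

section \<open>Standard Brownian motion on the unit interval\<close>

definition standard_brownian_motion :: "'v measure \<Rightarrow> (real \<Rightarrow> 'v \<Rightarrow> real) \<Rightarrow> bool" where
  "standard_brownian_motion P B \<longleftrightarrow>
     prob_space P \<and>
     (\<forall>t\<in>{0..1}. B t \<in> borel_measurable P) \<and>
     (AE \<omega> in P. B 0 \<omega> = 0) \<and>
     (\<forall>n. \<forall>t :: nat \<Rightarrow> real.
        0 \<le> t 0 \<and> t n \<le> 1 \<and> (\<forall>i<n. t i < t (Suc i)) \<longrightarrow>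
        prob_space.indep_vars P (\<lambda>_. borel) (\<lambda>i \<omega>. B (t (Suc i)) \<omega> - B (t i) \<omega>) {..<n}) \<and>
     (\<forall>s t. 0 \<le> s \<and> s < t \<and> t \<le> 1 \<longrightarrow>
        distributed P lborel (\<lambda>\<omega>. B t \<omega> - B s \<omega>) (normal_density 0 (sqrt (t - s)))) \<and>
     (AE \<omega> in P. continuous_on {0..1} (\<lambda>t. B t \<omega>))"

section \<open>The kernel and the variance-ratio process\<close>

definition vr_kernel :: "(real \<Rightarrow> real) \<Rightarrow> bool" where
  "vr_kernel K \<longleftrightarrow>
     (\<forall>x. 0 \<le> K x) \<and>
     (\<exists>L. L-lipschitz_on UNIV K) \<and>
     has_bochner_integral lborel K 1 \<and>
     (\<forall>x. K (- x) = K x) \<and>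
     has_bochner_integral lborel (\<lambda>x. x * K x) 0 \<and>
     integrable lborel (\<lambda>x. x\<^sup>2 * K x)"

definition scaled_kernel :: "(real \<Rightarrow> real) \<Rightarrow> real \<Rightarrow> real \<Rightarrow> real" where
  "scaled_kernel K h x = K (x / h) / h"

text \<open>If the sum of squares in the denominator vanishes, then so does the numerator, and the
  ratio is read as 0.\<close>

definition vr_process ::
  "(real \<Rightarrow> real) \<Rightarrow> (nat \<Rightarrow> real) \<Rightarrow> (nat \<Rightarrow> 'w \<Rightarrow> real) \<Rightarrow> nat \<Rightarrow> real \<Rightarrow> 'w \<Rightarrow> real" where
  "vr_process K h Y N s \<omega> =
     (if s < 1 / real N then 0
      else let n = nat \<lfloor>real N * s\<rfloor> in
        (1 / real n ^ 3 * (\<Sum>i=1..n. (\<Sum>j=1..i. Y j \<omega>)\<^sup>2 * scaled_kernel K (h N) (real i - real n)))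
        / (1 / real n ^ 2 * (\<Sum>j=1..n. (Y j \<omega>)\<^sup>2)))"

definition vr_limit ::
  "(real \<Rightarrow> real) \<Rightarrow> real \<Rightarrow> (real \<Rightarrow> 'v \<Rightarrow> real) \<Rightarrow> real \<Rightarrow> 'v \<Rightarrow> real" where
  "vr_limit K \<zeta> B s \<omega> =
     (\<zeta> / s * (LINT r:{0..s}|lborel. K (\<zeta> * (r - s)) * (LINT t:{0..r}|lborel. B t \<omega>)\<^sup>2))
     / (LINT r:{0..s}|lborel. (B r \<omega>)\<^sup>2)"

end

theory Submission
  imports Defs
begin

text \<open>The ratio is scale free, so $Y$ may be divided by $\sqrt N$. In terms of the rescaled path
  $X_N(s) = Y_{\lfloor Ns \rfloor} / \sqrt N$ the sums in $U_N(s)$ are Riemann sums of the integrals that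
  make up the functional
  \[ \Phi(x)(s) = \frac{\zeta}{s} \int_0^s K(\zeta(r-s)) \Big(\int_0^r x\Big)^2 dr \Big/ \int_0^s x^2 , \]
  and $\Phi(\sigma B)$ is the limit process because $\sigma$ cancels. For a step path these Riemann
  sums err only in the boundary entries and in a small shift of the argument of $K$, so $U_N$ and $\Phi(X_N)$ are uniformly close on $[\kappa,1]$ as long
  as $X_N$ is bounded by a constant and its energy $\int_0^\kappa X_N^2$ stays away from zero
  (\<open>discrete_ratio_close\<close>).

  The functional $\Phi$ is in general not Skorohod continuous at paths that vanish on $[0,\kappa)$. With
  $\max(\delta, \int_0^s x^2)$ in the denominator it becomes a continuous map from $D[0,1]$ to
  $D[\kappa,1]$ (\<open>truncated_path_tendsto\<close>): Skorohod convergence implies convergence in mean, because a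
  path has only countably many discontinuities (\<open>skorohod_convergence_imp_L1\<close>), and all integrals
  involved are Lipschitz functions of the path in mean, on bounded sets. The paths for which the
  truncation or the discretization matters are detected by a continuous functional
  (\<open>degeneracy\<close>). Its expectation therefore converges along $X_N$ to its expectation under $\sigma B$,
  and the latter is small because Brownian motion almost surely has positive energy.

  This comparison of $U_N$ with the truncated functional of $X_N$ is quantitative only under a
  Lipschitz test function. Such test functions suffice: a bounded continuous $f$ is the increasing
  limit of its Lipschitz inf-convolutions, which gives a lower bound for the expectations of $f$,
  and the same argument for $-f$ gives the upper bound (\<open>weak_convergence_of_lipschitz\<close>).

  Weak convergence also demands that every sample path, not just almost every one, lies in the
  Skorohod space and depends measurably on the sample point. For the limit process this rests on
  the continuity of $\Phi(x)$ for every path $x$, including those whose energy vanishes for a while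
  (\<open>ratio_continuous\<close>).\<close>

section \<open>Lipschitz test functions on a metric space\<close>

lemma (in Metric_space) continuous_map_real_eps_delta:
  "continuous_map mtopology euclideanreal f \<longleftrightarrow>
    (\<forall>a\<in>M. \<forall>e>0. \<exists>r>0. \<forall>x. x \<in> M \<and> d a x < r \<longrightarrow> \<bar>f a - f x\<bar> < e)"
  using metric_continuous_map[OF Met_TC.Metric_space_axioms, of f]
  by (simp add: dist_real_def)

lemma (in Metric_space) continuous_map_real_seqI:
  assumes "\<And>a x. a \<in> M \<Longrightarrow> (\<And>n. x n \<in> M) \<Longrightarrow> (\<lambda>n. d a (x n)) \<longlonglongrightarrow> 0 \<Longrightarrow> (\<lambda>n. f (x n)) \<longlonglongrightarrow> f a"
  shows "continuous_map mtopology euclideanreal f"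
  unfolding continuous_map_real_eps_delta
proof (intro ballI allI impI)
  fix a and e :: real assume a: "a \<in> M" and e: "0 < e"
  show "\<exists>r>0. \<forall>x. x \<in> M \<and> d a x < r \<longrightarrow> \<bar>f a - f x\<bar> < e"
  proof (rule ccontr)
    assume "\<not> ?thesis"
    then have "\<exists>x. x \<in> M \<and> d a x < inverse (real (Suc n)) \<and> \<not> \<bar>f a - f x\<bar> < e" for n
      by (meson inverse_positive_iff_positive of_nat_0_less_iff zero_less_Suc)
    then obtain x where x: "\<And>n. x n \<in> M" "\<And>n. d a (x n) < inverse (real (Suc n))"
        "\<And>n. \<not> \<bar>f a - f (x n)\<bar> < e"
      by metis
    have "(\<lambda>n. d a (x n)) \<longlonglongrightarrow> 0"
      by (rule tendsto_sandwich[OF _ _ tendsto_const LIMSEQ_inverse_real_of_nat])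
        (use less_imp_le[OF x(2)] in simp_all)
    from assms[OF a x(1) this] have "eventually (\<lambda>n. dist (f (x n)) (f a) < e) sequentially"
      using e by (rule tendstoD)
    then show False
      using x(3) by (auto simp: eventually_sequentially dist_real_def abs_minus_commute)
  qed
qed

lemma (in Metric_space) continuous_map_real_seqD:
  assumes f: "continuous_map mtopology euclideanreal f"
    and "a \<in> M" "\<And>n. x n \<in> M" "(\<lambda>n. d a (x n)) \<longlonglongrightarrow> 0"
  shows "(\<lambda>n. f (x n)) \<longlonglongrightarrow> f a"
proof (rule tendstoI)
  fix e :: real assume "0 < e"
  then obtain r where r: "r > 0" "\<And>x. x \<in> M \<and> d a x < r \<Longrightarrow> \<bar>f a - f x\<bar> < e"
    using f \<open>a \<in> M\<close> unfolding continuous_map_real_eps_delta by blast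
  have "eventually (\<lambda>n. d a (x n) < r) sequentially"
    using assms(4) r(1) by (auto dest: order_tendstoD)
  then show "eventually (\<lambda>n. dist (f (x n)) (f a) < e) sequentially"
    by (rule eventually_mono) (metis r(2) assms(3) dist_real_def abs_minus_commute)
qed

lemma (in Metric_space) continuous_map_real_lipschitz:
  assumes "\<And>x y. x \<in> M \<Longrightarrow> y \<in> M \<Longrightarrow> \<bar>f x - f y\<bar> \<le> k * d x y"
  shows "continuous_map mtopology euclideanreal f"
proof (rule continuous_map_real_seqI)
  fix a x assume a: "a \<in> M" "\<And>n. x n \<in> M" "(\<lambda>n. d a (x n)) \<longlonglongrightarrow> 0"
  have "(\<lambda>n. f a - f (x n)) \<longlonglongrightarrow> 0"
    by (rule Lim_null_comparison[OF _ tendsto_mult_right_zero[OF a(3), of k]])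
      (use a assms in \<open>auto intro!: eventuallyI\<close>)
  from tendsto_diff[OF tendsto_const[of "f a"] this] show "(\<lambda>n. f (x n)) \<longlonglongrightarrow> f a" by simp
qed

text \<open>The Pasch-Hausdorff envelope: the largest $k$-Lipschitz function below $f$, for $f$ bounded below.\<close>

definition inf_convolution ::
  "'a set \<Rightarrow> ('a \<Rightarrow> 'a \<Rightarrow> real) \<Rightarrow> real \<Rightarrow> ('a \<Rightarrow> real) \<Rightarrow> 'a \<Rightarrow> real" where
  "inf_convolution S d k f x = (INF y\<in>S. f y + k * d x y)"

context Metric_space
begin

lemma inf_convolution_bounds:
  assumes x: "x \<in> M" and k: "0 \<le> k" and f: "\<And>y. y \<in> M \<Longrightarrow> -C \<le> f y"
  shows "-C \<le> inf_convolution M d k f x" "y \<in> M \<Longrightarrow> inf_convolution M d k f x \<le> f y + k * d x y"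
proof -
  have lb: "-C \<le> f y + k * d x y" if "y \<in> M" for y
    using f[OF that] mult_nonneg_nonneg[OF k nonneg[of x y]] by linarith
  show "-C \<le> inf_convolution M d k f x"
    unfolding inf_convolution_def using x lb by (intro cINF_greatest) auto
  show "inf_convolution M d k f x \<le> f y + k * d x y" if "y \<in> M"
    unfolding inf_convolution_def
    by (rule cINF_lower[OF bdd_belowI2[of _ "-C"] that]) (use lb in auto)
qed

lemma inf_convolution_le:
  assumes "x \<in> M" "0 \<le> k" "\<And>y. y \<in> M \<Longrightarrow> -C \<le> f y"
  shows "inf_convolution M d k f x \<le> f x"
  using inf_convolution_bounds(2)[OF assms assms(1)] assms(1) by simp

lemma inf_convolution_lipschitz:
  assumes k: "0 \<le> k" and f: "\<And>y. y \<in> M \<Longrightarrow> -C \<le> f y" and xz: "x \<in> M" "z \<in> M"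
  shows "\<bar>inf_convolution M d k f x - inf_convolution M d k f z\<bar> \<le> k * d x z"
proof -
  have "inf_convolution M d k f u - k * d u v \<le> inf_convolution M d k f v" if uv: "u \<in> M" "v \<in> M" for u v
    unfolding inf_convolution_def[of M d k f v]
  proof (rule cINF_greatest)
    fix y assume y: "y \<in> M"
    have "d u y \<le> d u v + d v y" using uv y by (rule triangle)
    then have "k * d u y \<le> k * d u v + k * d v y"
      using mult_left_mono[OF _ k] by (simp add: distrib_left[symmetric])
    then show "inf_convolution M d k f u - k * d u v \<le> f y + k * d v y"
      using inf_convolution_bounds(2)[where C=C and f=f and k=k, OF uv(1) k f y] by linarith
  qed (use xz in auto)
  from this[of x z] this[of z x] xz show ?thesis by (simp add: commute abs_le_iff)
qed

text \<open>In the infimum a point near $x$ costs at least $c$, and a point at distance $r$ or more costs at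
  least $kr - C$, which exceeds any given $c$ once $k$ is large.\<close>

lemma inf_convolution_ge:
  assumes x: "x \<in> M" and k: "0 \<le> k" and f: "\<And>y. y \<in> M \<Longrightarrow> -C \<le> f y"
    and near: "\<And>y. y \<in> M \<Longrightarrow> d x y < r \<Longrightarrow> c \<le> f y" and far: "c \<le> k * r - C"
  shows "c \<le> inf_convolution M d k f x"
  unfolding inf_convolution_def
proof (rule cINF_greatest)
  fix y assume y: "y \<in> M"
  show "c \<le> f y + k * d x y"
  proof (cases "d x y < r")
    case True then show ?thesis using near[OF y True] mult_nonneg_nonneg[OF k nonneg[of x y]] by linarith
  next
    case False
    then have "k * r \<le> k * d x y" using k by (simp add: mult_left_mono)
    then show ?thesis using far f[OF y] by linarith
  qed
qed (use x in auto)

lemma inf_convolution_tendsto: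
  assumes x: "x \<in> M" and f: "\<And>y. y \<in> M \<Longrightarrow> -C \<le> f y"
    and cont: "continuous_map mtopology euclideanreal f"
  shows "(\<lambda>k. inf_convolution M d (real k) f x) \<longlonglongrightarrow> f x"
proof (rule tendstoI)
  fix e :: real assume e: "0 < e"
  then obtain r where r: "r > 0" "\<And>y. y \<in> M \<Longrightarrow> d x y < r \<Longrightarrow> \<bar>f x - f y\<bar> < e/2"
    using cont x unfolding continuous_map_real_eps_delta by (meson half_gt_zero)
  obtain k0 :: nat where k0: "real k0 > (f x + C) / r" using reals_Archimedean2 by blast
  have "dist (inf_convolution M d (real k) f x) (f x) < e" if k: "k \<ge> k0" for k
  proof -
    have "(f x + C) / r < real k" using k0 k by linarith
    then have "f x - e/2 \<le> real k * r - C" using r(1) e by (simp add: field_simps)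
    then have "f x - e/2 \<le> inf_convolution M d (real k) f x"
      by (intro inf_convolution_ge[where C=C and r=r] x f) (use r(2) in \<open>auto simp: abs_less_iff less_imp_le\<close>,
        smt (verit) r(2))
    moreover have "inf_convolution M d (real k) f x \<le> f x"
      using f by (intro inf_convolution_le[where C=C] x) auto
    ultimately show ?thesis using e by (simp add: dist_real_def)
  qed
  then show "eventually (\<lambda>k. dist (inf_convolution M d (real k) f x) (f x) < e) sequentially"
    by (auto simp: eventually_sequentially)
qed

text \<open>An open set $U$ is the set where the 1-Lipschitz inf-convolution of its indicator is positive.\<close>

lemma measurable_of_lipschitz_functionals:
  assumes X: "X \<in> space Q \<rightarrow> M"
    and meas: "\<And>f. (\<And>x y. x \<in> M \<Longrightarrow> y \<in> M \<Longrightarrow> \<bar>f x - f y\<bar> \<le> d x y) \<Longrightarrow> (\<lambda>\<omega>. f (X \<omega>) :: real) \<in> borel_measurable Q"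
  shows "X \<in> measurable Q (sigma M {U. openin mtopology U})"
proof (rule measurable_measure_of)
  show "{U. openin mtopology U} \<subseteq> Pow M"
    using openin_subset by force
  show "X \<in> space Q \<rightarrow> M" by (rule X)
  fix U assume "U \<in> {U. openin mtopology U}"
  then have U: "openin mtopology U" by simp
  define \<phi> where "\<phi> = inf_convolution M d 1 (indicator U)"
  have lb: "- 0 \<le> (indicator U y :: real)" for y by simp
  have pos: "0 < \<phi> x \<longleftrightarrow> x \<in> U" if x: "x \<in> M" for x
  proof
    assume "0 < \<phi> x"
    then show "x \<in> U"
      using inf_convolution_le[where C=0 and k=1 and f="indicator U", OF x _ lb]
      by (cases "x \<in> U") (auto simp: \<phi>_def)
  next
    assume "x \<in> U"
    then obtain r where r: "r > 0" "mball x r \<subseteq> U" using U by (auto simp: openin_mtopology)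
    have "min 1 r \<le> \<phi> x" unfolding \<phi>_def
      using r x by (intro inf_convolution_ge[where C=0 and r=r]) (auto simp: indicator_def subset_iff)
    then show "0 < \<phi> x" using r(1) by linarith
  qed
  have "(\<lambda>\<omega>. \<phi> (X \<omega>)) \<in> borel_measurable Q"
    by (rule meas) (use inf_convolution_lipschitz[where k=1 and C=0 and f="indicator U"] lb in \<open>auto simp: \<phi>_def\<close>)
  then have "{\<omega> \<in> space Q. 0 < \<phi> (X \<omega>)} \<in> sets Q" by measurable
  also have "{\<omega> \<in> space Q. 0 < \<phi> (X \<omega>)} = X -` U \<inter> space Q"
    using X pos by auto
  finally show "X -` U \<inter> space Q \<in> sets Q" .
qed

lemma measurable_of_continuous_map:
  assumes "continuous_map mtopology euclideanreal f"
  shows "f \<in> borel_measurable (sigma M {U. openin mtopology U})"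
proof (rule borel_measurableI)
  fix S :: "real set" assume "open S"
  then have "openin mtopology {x \<in> topspace mtopology. f x \<in> S}"
    by (intro openin_continuous_map_preimage[OF assms]) simp
  moreover have "f -` S \<inter> M = {x \<in> topspace mtopology. f x \<in> S}" by auto
  moreover have "{U. openin mtopology U} \<subseteq> Pow M" using openin_subset by force
  ultimately show "f -` S \<inter> space (sigma M {U. openin mtopology U}) \<in> sets (sigma M {U. openin mtopology U})"
    by (simp add: space_measure_of_conv sigma_sets.Basic)
qed

text \<open>Lipschitz functionals detect measurability and pass to the limit.\<close>

lemma measurable_limit:
  assumes X: "\<And>n. X n \<in> measurable Q (sigma M {U. openin mtopology U})"
    and Z: "Z \<in> space Q \<rightarrow> M"
    and lim: "\<And>\<omega>. \<omega> \<in> space Q \<Longrightarrow> (\<lambda>n. d (Z \<omega>) (X n \<omega>)) \<longlonglongrightarrow> 0"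
  shows "Z \<in> measurable Q (sigma M {U. openin mtopology U})"
proof (rule measurable_of_lipschitz_functionals[OF Z])
  fix f :: "'a \<Rightarrow> real" assume f: "\<And>x y. x \<in> M \<Longrightarrow> y \<in> M \<Longrightarrow> \<bar>f x - f y\<bar> \<le> d x y"
  have cont: "continuous_map mtopology euclideanreal f"
    by (rule continuous_map_real_lipschitz[where k=1]) (use f in auto)
  show "(\<lambda>\<omega>. f (Z \<omega>)) \<in> borel_measurable Q"
  proof (rule borel_measurable_LIMSEQ_real)
    fix n
    show "(\<lambda>\<omega>. f (X n \<omega>)) \<in> borel_measurable Q"
      by (rule measurable_compose[OF X measurable_of_continuous_map[OF cont]])
  next
    fix \<omega> assume w: "\<omega> \<in> space Q"
    have "X n \<omega> \<in> M" for n
      using measurable_space[OF X w] by (simp add: space_measure_of_conv)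
    then show "(\<lambda>n. f (X n \<omega>)) \<longlonglongrightarrow> f (Z \<omega>)"
      using Z w by (intro continuous_map_real_seqD[OF cont _ _ lim]) auto
  qed
qed

lemma integrable_bounded_functional:
  assumes "prob_space Q" and X: "X \<in> measurable Q (sigma M {U. openin mtopology U})"
    and f: "continuous_map mtopology euclideanreal f" and C: "\<And>x. x \<in> M \<Longrightarrow> \<bar>f x\<bar> \<le> C"
  shows "integrable Q (\<lambda>\<omega>. f (X \<omega>))"
proof -
  interpret prob_space Q by fact
  have "X \<omega> \<in> M" if "\<omega> \<in> space Q" for \<omega>
    using measurable_space[OF X that] by (simp add: space_measure_of_conv)
  then show ?thesis
    by (intro integrable_const_bound[of _ C] measurable_compose[OF X measurable_of_continuous_map[OF f]] AE_I2)
      (simp add: C)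
qed

text \<open>Under $Z$ the expectations of the inf-convolutions increase to that of $f$, so one of them is within
  $e/2$ of it. That inf-convolution is an admissible test function and lies below $f$ along $X_n$.\<close>

lemma weak_convergence_lower_bound:
  assumes Q: "prob_space Q" and P: "prob_space P"
    and X: "\<And>n. X n \<in> measurable Q (sigma M {U. openin mtopology U})"
    and Z: "Z \<in> measurable P (sigma M {U. openin mtopology U})"
    and lip: "\<And>f k C. 0 \<le> k \<Longrightarrow> (\<And>x y. x \<in> M \<Longrightarrow> y \<in> M \<Longrightarrow> \<bar>f x - f y\<bar> \<le> k * d x y)
        \<Longrightarrow> (\<And>x. x \<in> M \<Longrightarrow> \<bar>f x\<bar> \<le> C)
        \<Longrightarrow> (\<lambda>n. \<integral>\<omega>. f (X n \<omega>) \<partial>Q) \<longlonglongrightarrow> (\<integral>\<omega>. f (Z \<omega>) \<partial>P)"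
    and f: "continuous_map mtopology euclideanreal f" and C: "\<And>x. x \<in> M \<Longrightarrow> \<bar>f x\<bar> \<le> C" and e: "0 < e"
  shows "eventually (\<lambda>n. (\<integral>\<omega>. f (Z \<omega>) \<partial>P) - e < (\<integral>\<omega>. f (X n \<omega>) \<partial>Q)) sequentially"
proof -
  interpret P: prob_space P by (rule P)
  define g where "g k = inf_convolution M d (real k) f" for k
  have lb: "- C \<le> f x" if "x \<in> M" for x using C[OF that] by linarith
  have g_le: "g k x \<le> f x" if "x \<in> M" for k x
    unfolding g_def by (rule inf_convolution_le[where C=C, OF that]) (simp_all add: lb)
  have g_abs: "\<bar>g k x\<bar> \<le> C" if x: "x \<in> M" for k x
  proof -
    have "- C \<le> g k x" unfolding g_def by (rule inf_convolution_bounds(1)[OF x]) (simp_all add: lb)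
    then show ?thesis using g_le[OF x, of k] C[OF x] by linarith
  qed
  have g_lip: "\<bar>g k x - g k y\<bar> \<le> real k * d x y" if "x \<in> M" "y \<in> M" for k x y
    unfolding g_def by (rule inf_convolution_lipschitz[where C=C]) (simp_all add: lb that)
  have g_cont: "continuous_map mtopology euclideanreal (g k)" for k
    by (rule continuous_map_real_lipschitz[OF g_lip])
  have ZM: "Z \<omega> \<in> M" if "\<omega> \<in> space P" for \<omega>
    using measurable_space[OF Z that] by (simp add: space_measure_of_conv)
  have XM: "X n \<omega> \<in> M" if "\<omega> \<in> space Q" for n \<omega>
    using measurable_space[OF X that] by (simp add: space_measure_of_conv)
  have "(\<lambda>k. \<integral>\<omega>. g k (Z \<omega>) \<partial>P) \<longlonglongrightarrow> (\<integral>\<omega>. f (Z \<omega>) \<partial>P)"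
  proof (rule integral_dominated_convergence[where w="\<lambda>_. C"])
    show "(\<lambda>\<omega>. f (Z \<omega>)) \<in> borel_measurable P" "\<And>k. (\<lambda>\<omega>. g k (Z \<omega>)) \<in> borel_measurable P"
      by (intro measurable_compose[OF Z measurable_of_continuous_map] f g_cont)+
    show "AE \<omega> in P. (\<lambda>k. g k (Z \<omega>)) \<longlonglongrightarrow> f (Z \<omega>)"
      unfolding g_def by (intro AE_I2 inf_convolution_tendsto[where C=C] ZM lb f)
    show "AE \<omega> in P. norm (g k (Z \<omega>)) \<le> C" for k using g_abs ZM by (intro AE_I2) simp
  qed simp
  then have "eventually (\<lambda>k. (\<integral>\<omega>. f (Z \<omega>) \<partial>P) - e/2 < (\<integral>\<omega>. g k (Z \<omega>) \<partial>P)) sequentially"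
    using e by (intro order_tendstoD(1)) auto
  then obtain k where k: "(\<integral>\<omega>. f (Z \<omega>) \<partial>P) - e/2 < (\<integral>\<omega>. g k (Z \<omega>) \<partial>P)"
    unfolding eventually_sequentially by blast
  have "(\<lambda>n. \<integral>\<omega>. g k (X n \<omega>) \<partial>Q) \<longlonglongrightarrow> (\<integral>\<omega>. g k (Z \<omega>) \<partial>P)"
    by (rule lip[OF _ g_lip g_abs]) simp
  then have "eventually (\<lambda>n. (\<integral>\<omega>. g k (Z \<omega>) \<partial>P) - e/2 < (\<integral>\<omega>. g k (X n \<omega>) \<partial>Q)) sequentially"
    using e by (intro order_tendstoD(1)) auto
  then show ?thesis
  proof (rule eventually_mono)
    fix n assume n: "(\<integral>\<omega>. g k (Z \<omega>) \<partial>P) - e/2 < (\<integral>\<omega>. g k (X n \<omega>) \<partial>Q)"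
    have "(\<integral>\<omega>. g k (X n \<omega>) \<partial>Q) \<le> (\<integral>\<omega>. f (X n \<omega>) \<partial>Q)"
      by (intro integral_mono integrable_bounded_functional[OF Q X] g_cont f g_le XM) (auto intro: g_abs C)
    then show "(\<integral>\<omega>. f (Z \<omega>) \<partial>P) - e < (\<integral>\<omega>. f (X n \<omega>) \<partial>Q)" using n k by linarith
  qed
qed

lemma weak_convergence_of_lipschitz:
  assumes Q: "prob_space Q" and P: "prob_space P"
    and X: "\<And>n. X n \<in> measurable Q (sigma M {U. openin mtopology U})"
    and Z: "Z \<in> measurable P (sigma M {U. openin mtopology U})"
    and lip: "\<And>f k C. 0 \<le> k \<Longrightarrow> (\<And>x y. x \<in> M \<Longrightarrow> y \<in> M \<Longrightarrow> \<bar>f x - f y\<bar> \<le> k * d x y)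
        \<Longrightarrow> (\<And>x. x \<in> M \<Longrightarrow> \<bar>f x\<bar> \<le> C)
        \<Longrightarrow> (\<lambda>n. \<integral>\<omega>. f (X n \<omega>) \<partial>Q) \<longlonglongrightarrow> (\<integral>\<omega>. f (Z \<omega>) \<partial>P)"
    and f: "continuous_map mtopology euclideanreal f" and bdd: "bounded (f ` M)"
  shows "(\<lambda>n. \<integral>\<omega>. f (X n \<omega>) \<partial>Q) \<longlonglongrightarrow> (\<integral>\<omega>. f (Z \<omega>) \<partial>P)"
proof (rule tendstoI)
  fix e :: real assume e: "0 < e"
  obtain C where C: "\<And>x. x \<in> M \<Longrightarrow> \<bar>f x\<bar> \<le> C" using bdd by (auto simp: bounded_iff)
  have f': "continuous_map mtopology euclideanreal (\<lambda>x. - f x)"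
    using f by (rule continuous_map_minus)
  have "eventually (\<lambda>n. (\<integral>\<omega>. f (Z \<omega>) \<partial>P) - e < (\<integral>\<omega>. f (X n \<omega>) \<partial>Q)) sequentially"
    by (rule weak_convergence_lower_bound[OF Q P X Z lip f C e])
  moreover have "eventually (\<lambda>n. (\<integral>\<omega>. - f (Z \<omega>) \<partial>P) - e < (\<integral>\<omega>. - f (X n \<omega>) \<partial>Q)) sequentially"
    by (rule weak_convergence_lower_bound[OF Q P X Z lip f' _ e, where C=C]) (simp_all add: C)
  ultimately show "eventually (\<lambda>n. dist (\<integral>\<omega>. f (X n \<omega>) \<partial>Q) (\<integral>\<omega>. f (Z \<omega>) \<partial>P) < e) sequentially"
    by eventually_elim (simp add: dist_real_def abs_less_iff)
qed

end

section \<open>Regularity of right-continuous paths with left limits\<close>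

text \<open>The identity is a time change, so the uniform distance dominates the Skorohod distance.\<close>

lemma skorohod_dist_le:
  assumes xy: "x \<in> cadlag_space a b" "y \<in> cadlag_space a b" and e: "0 \<le> e"
    and le: "\<And>t. t \<in> {a..b} \<Longrightarrow> \<bar>x t - y t\<bar> \<le> e"
  shows "skorohod_dist a b x y \<le> e"
proof (rule field_le_epsilon)
  fix \<delta> :: real assume "0 < \<delta>"
  let ?S = "{e. 0 < e \<and> (\<exists>l\<in>time_changes a b. \<forall>t\<in>{a..b}. \<bar>l t - t\<bar> \<le> e \<and> \<bar>x t - y (l t)\<bar> \<le> e)}"
  have "\<exists>l\<in>time_changes a b. \<forall>t\<in>{a..b}. \<bar>l t - t\<bar> \<le> e + \<delta> \<and> \<bar>x t - y (l t)\<bar> \<le> e + \<delta>"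
    using le e \<open>0 < \<delta>\<close> by (intro bexI[OF _ time_changes_id]) fastforce
  then have "e + \<delta> \<in> ?S" using e \<open>0 < \<delta>\<close> by auto
  moreover have "bdd_below ?S" by (rule bdd_belowI[of _ 0]) auto
  ultimately show "skorohod_dist a b x y \<le> e + \<delta>"
    using xy unfolding skorohod_dist_def by (auto intro: cInf_lower)
qed

lemma skorohod_dist_less_imp_close:
  assumes xy: "x \<in> cadlag_space a b" "y \<in> cadlag_space a b" and "skorohod_dist a b x y < e"
  shows "\<exists>l\<in>time_changes a b. \<forall>t\<in>{a..b}. \<bar>l t - t\<bar> \<le> e \<and> \<bar>x t - y (l t)\<bar> \<le> e"
proof -
  let ?S = "{e. 0 < e \<and> (\<exists>l\<in>time_changes a b. \<forall>t\<in>{a..b}. \<bar>l t - t\<bar> \<le> e \<and> \<bar>x t - y (l t)\<bar> \<le> e)}"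
  have ne: "?S \<noteq> {}" using close_paths_exists[OF xy] unfolding close_paths_def by auto
  have "Inf ?S < e" using assms unfolding skorohod_dist_def by simp
  moreover have "bdd_below ?S" by (rule bdd_belowI[of _ 0]) auto
  ultimately obtain f where f: "f \<in> ?S" "f < e"
    using cInf_less_iff[OF ne] by blast
  then obtain l where l: "l \<in> time_changes a b" "\<forall>t\<in>{a..b}. \<bar>l t - t\<bar> \<le> f \<and> \<bar>x t - y (l t)\<bar> \<le> f"
    by auto
  show ?thesis
  proof (intro bexI[OF _ l(1)] ballI)
    fix t assume "t \<in> {a..b}"
    then show "\<bar>l t - t\<bar> \<le> e \<and> \<bar>x t - y (l t)\<bar> \<le> e" using l(2) f(2) by force
  qed
qed

lemma restrict_const_cadlag: "(\<lambda>t\<in>{a..b}. c) \<in> cadlag_space a b"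
proof -
  have "((\<lambda>t\<in>{a..b}. c) \<longlongrightarrow> c) (at_right t)" if "t \<in> {a..<b}" for t
    by (rule tendsto_eventually, rule eventually_at_rightI[of t b]) (use that in auto)
  moreover have "((\<lambda>t\<in>{a..b}. c) \<longlongrightarrow> c) (at_left t)" if "t \<in> {a<..b}" for t
    by (rule tendsto_eventually, rule eventually_at_leftI[of a t]) (use that in auto)
  ultimately show ?thesis unfolding cadlag_space_def by force
qed

text \<open>Time changes leave the zero path fixed.\<close>

lemma abs_le_skorohod_dist_zero:
  assumes x: "x \<in> cadlag_space a b" and t: "t \<in> {a..b}"
  shows "\<bar>x t\<bar> \<le> skorohod_dist a b x (\<lambda>t\<in>{a..b}. 0)"
proof (rule field_le_epsilon)
  fix e :: real assume "0 < e"
  then obtain l where l: "l \<in> time_changes a b"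
      "\<bar>x t - (\<lambda>t\<in>{a..b}. 0) (l t)\<bar> \<le> skorohod_dist a b x (\<lambda>t\<in>{a..b}. 0) + e"
    using skorohod_dist_less_imp_close[OF x restrict_const_cadlag, of 0 "skorohod_dist a b x (\<lambda>t\<in>{a..b}. 0) + e"] t
    by auto
  then show "\<bar>x t\<bar> \<le> skorohod_dist a b x (\<lambda>t\<in>{a..b}. 0) + e"
    using time_changes_mem[OF l(1) t] by simp
qed

text \<open>Sampling the path at the next point of a grid of mesh $1/k$ converges pointwise by
  right-continuity, and the sampled path is a function of an integer.\<close>

lemma cadlag_borel_measurable:
  assumes x: "x \<in> cadlag_space a b"
  shows "set_borel_measurable borel {a..b} x"
  unfolding set_borel_measurable_def
proof (rule borel_measurable_LIMSEQ_real)
  define g where "g n t = (of_int \<lfloor>real (Suc n) * t\<rfloor> + 1) / real (Suc n)" for n t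
  have g: "t < g n t" "g n t \<le> t + inverse (real (Suc n))" for n t
  proof -
    have k: "0 < real (Suc n)" by simp
    have "real (Suc n) * t < of_int \<lfloor>real (Suc n) * t\<rfloor> + 1" "of_int \<lfloor>real (Suc n) * t\<rfloor> \<le> real (Suc n) * t"
      by linarith+
    then show "t < g n t" "g n t \<le> t + inverse (real (Suc n))"
      unfolding g_def pos_less_divide_eq[OF k] pos_divide_le_eq[OF k]
      by (simp_all add: distrib_left mult.commute del: of_nat_Suc)
  qed
  show "(\<lambda>t. indicator {a..b} t *\<^sub>R x (min b (g n t))) \<in> borel_measurable borel" for n
  proof -
    have "(\<lambda>k :: int. x (min b ((of_int k + 1) / real (Suc n)))) \<circ> (\<lambda>t. \<lfloor>real (Suc n) * t\<rfloor>) \<in> borel_measurable borel"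
      by (rule measurable_comp[of _ _ "count_space UNIV"]) auto
    then have "(\<lambda>t. x (min b (g n t))) \<in> borel_measurable borel" by (simp add: g_def comp_def)
    then show ?thesis by measurable
  qed
  fix t :: real
  show "(\<lambda>n. indicator {a..b} t *\<^sub>R x (min b (g n t))) \<longlonglongrightarrow> indicator {a..b} t *\<^sub>R x t"
  proof (cases "t \<in> {a..<b}")
    case True
    then have lim: "(x \<longlongrightarrow> x t) (at_right t)" using x by (auto simp: cadlag_space_def)
    have "(\<lambda>n. min b (g n t)) \<longlonglongrightarrow> min b t"
    proof (intro tendsto_min tendsto_const)
      show "(\<lambda>n. g n t) \<longlonglongrightarrow> t"
        by (rule tendsto_sandwich[of "\<lambda>_. t" _ _ "\<lambda>n. t + inverse (real (Suc n))"])
          (use g in \<open>auto intro!: eventuallyI less_imp_le simp del: of_nat_Suc\<close>,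
           use tendsto_add[OF tendsto_const LIMSEQ_inverse_real_of_nat, of t] in simp)
    qed
    moreover have "min b (g n t) \<noteq> t \<and> min b (g n t) > t" for n using True g(1)[of t n] by auto
    ultimately have "filterlim (\<lambda>n. min b (g n t)) (at_right t) sequentially"
      using True by (auto simp: filterlim_at)
    from filterlim_compose[OF lim this] show ?thesis by (intro tendsto_scaleR tendsto_const)
  next
    case False
    then show ?thesis using g(1)[of b] less_imp_le[of t "g _ t"]
      by (cases "t = b") (auto simp: min_def not_le[symmetric] less_imp_le)
  qed
qed

text \<open>By right-continuity, a jump larger than $e$ has an interval to its right that contains no
  other such jump. These intervals are disjoint, so each of them claims its own rational number.\<close>

lemma cadlag_countable_large_jumps:
  assumes x: "x \<in> cadlag_space a b" and e: "0 < e"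
  shows "countable {t \<in> {a<..<b}. \<exists>l. (x \<longlongrightarrow> l) (at_left t) \<and> e < \<bar>x t - l\<bar>}"
proof -
  define J where "J = {t \<in> {a<..<b}. \<exists>l. (x \<longlongrightarrow> l) (at_left t) \<and> e < \<bar>x t - l\<bar>}"
  have "\<exists>q::rat. t < of_rat q \<and> (\<forall>u\<in>J. t < u \<longrightarrow> of_rat q < u)" if t: "t \<in> J" for t
  proof -
    have "t \<in> {a..<b}" using t by (simp add: J_def)
    then have "(x \<longlongrightarrow> x t) (at_right t)" using x unfolding cadlag_space_def by blast
    then have "eventually (\<lambda>u. dist (x u) (x t) < e/2) (at_right t)" by (rule tendstoD) (use e in simp)
    then obtain c where c: "c > t" "\<And>u. t < u \<Longrightarrow> u < c \<Longrightarrow> \<bar>x u - x t\<bar> < e/2"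
      unfolding eventually_at_right_field dist_real_def by blast
    have cu: "c \<le> u" if u: "u \<in> J" "t < u" for u
    proof (rule ccontr)
      assume "\<not> c \<le> u"
      then have uc: "u < c" by simp
      obtain l where l: "(x \<longlongrightarrow> l) (at_left u)" "e < \<bar>x u - l\<bar>" using u unfolding J_def by blast
      have "\<bar>x v - x t\<bar> \<le> e/2" if "v \<in> {t<..<u}" for v
        using c(2)[of v] that uc by simp
      then have "eventually (\<lambda>v. \<bar>x v - x t\<bar> \<le> e/2) (at_left u)"
        using u(2) by (intro eventually_at_leftI[of t u])
      moreover have "((\<lambda>v. \<bar>x v - x t\<bar>) \<longlongrightarrow> \<bar>l - x t\<bar>) (at_left u)" by (intro tendsto_intros l)
      ultimately have "\<bar>l - x t\<bar> \<le> e/2"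
        by (intro tendsto_upperbound[where F="at_left u"]) (auto simp: trivial_limit_at_left_real)
      then show False using l(2) c(2)[OF u(2) uc] by linarith
    qed
    obtain q where q: "t < of_rat q" "of_rat q < c" using of_rat_dense[OF c(1)] by blast
    have "of_rat q < u" if "u \<in> J" "t < u" for u
      using q(2) cu[OF that] by simp
    then show ?thesis using q(1) by blast
  qed
  then have "\<exists>q::real \<Rightarrow> rat. \<forall>t\<in>J. t < of_rat (q t) \<and> (\<forall>u\<in>J. t < u \<longrightarrow> of_rat (q t) < u)"
    by (intro bchoice) blast
  then obtain q :: "real \<Rightarrow> rat" where q: "\<And>t. t \<in> J \<Longrightarrow> t < of_rat (q t)"
      "\<And>t u. t \<in> J \<Longrightarrow> u \<in> J \<Longrightarrow> t < u \<Longrightarrow> of_rat (q t) < u"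
    by blast
  have "inj_on q J"
  proof (rule linorder_inj_onI')
    fix t u assume tu: "t \<in> J" "u \<in> J" "t < u"
    have "real_of_rat (q t) < real_of_rat (q u)"
      using q(2)[OF tu] q(1)[OF tu(2)] by (rule less_trans)
    then show "q t \<noteq> q u" by auto
  qed
  then have "countable J" by (rule countableI')
  then show ?thesis by (simp add: J_def)
qed

lemma cadlag_countable_discontinuities:
  assumes x: "x \<in> cadlag_space a b"
  shows "countable {t \<in> {a<..<b}. \<not> isCont x t}"
proof -
  define J where "J n = {t \<in> {a<..<b}. \<exists>l. (x \<longlongrightarrow> l) (at_left t) \<and> inverse (real (Suc n)) < \<bar>x t - l\<bar>}" for n
  have "\<exists>n. t \<in> J n" if t: "a < t" "t < b" "\<not> isCont x t" for t
  proof -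
    have "t \<in> {a..<b}" "t \<in> {a<..b}" using t by auto
    then obtain l where l: "(x \<longlongrightarrow> l) (at_left t)" and r: "(x \<longlongrightarrow> x t) (at_right t)"
      using x unfolding cadlag_space_def by blast
    have "l \<noteq> x t"
    proof
      assume "l = x t"
      then have "filterlim x (nhds (x t)) (at t)" using l r by (intro filterlim_split_at) simp_all
      then show False using t(3) by (simp add: isCont_def)
    qed
    then have "0 < \<bar>x t - l\<bar>" by simp
    from reals_Archimedean[OF this] obtain n where "inverse (real (Suc n)) < \<bar>x t - l\<bar>" ..
    then show ?thesis unfolding J_def using t(1,2) l by (intro exI[of _ n]) (simp del: of_nat_Suc, blast)
  qed
  then have "{t \<in> {a<..<b}. \<not> isCont x t} \<subseteq> (\<Union>n. J n)" by (simp add: subset_iff)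
  moreover have "countable (\<Union>n. J n)"
  proof (rule countable_UN[OF countableI_type])
    show "countable (J n)" for n
      unfolding J_def by (rule cadlag_countable_large_jumps[OF x]) (simp del: of_nat_Suc)
  qed
  ultimately show ?thesis by (rule countable_subset)
qed

section \<open>Skorohod convergence implies convergence in mean\<close>

text \<open>Measurability is required on the unit interval only, since elements of the Skorohod space have an
  unspecified value elsewhere.\<close>

definition bounded_path :: "real \<Rightarrow> (real \<Rightarrow> real) \<Rightarrow> bool" where
  "bounded_path R x \<longleftrightarrow> set_borel_measurable borel {0..1} x \<and> (\<forall>t\<in>{0..1}. \<bar>x t\<bar> \<le> R)"

lemma bounded_pathD: "bounded_path R x \<Longrightarrow> t \<in> {0..1} \<Longrightarrow> \<bar>x t\<bar> \<le> R"
  by (auto simp: bounded_path_def)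

lemma bounded_path_nonneg: "bounded_path R x \<Longrightarrow> 0 \<le> R"
  using bounded_pathD[of R x 0] by force

lemma cadlag_bounded_path:
  assumes "x \<in> cadlag_space 0 1" "\<And>t. t \<in> {0..1} \<Longrightarrow> \<bar>x t\<bar> \<le> R"
  shows "bounded_path R x"
  using assms cadlag_borel_measurable by (auto simp: bounded_path_def)

lemma cadlag_imp_bounded_path:
  assumes "x \<in> cadlag_space 0 1"
  obtains R where "bounded_path R x"
  using cadlag_space_bounded[OF assms] cadlag_bounded_path[OF assms] by blast

lemma bounded_path_continuous:
  assumes "continuous_on {0..1} x" "\<And>t. t \<in> {0..1} \<Longrightarrow> \<bar>x t\<bar> \<le> R"
  shows "bounded_path R x"
  using assms borel_measurable_continuous_on_indicator[of "{0..1}" x]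
  by (simp add: bounded_path_def set_borel_measurable_def)

lemma bounded_path_mult:
  assumes "bounded_path R x" "bounded_path S y"
  shows "bounded_path (R * S) (\<lambda>t. x t * y t)"
proof -
  have "(\<lambda>t. (indicator {0..1} t *\<^sub>R x t) * (indicator {0..1} t *\<^sub>R y t)) \<in> borel_measurable borel"
    using assms unfolding bounded_path_def set_borel_measurable_def by (intro borel_measurable_times) auto
  moreover have "(\<lambda>t. (indicator {0..1} t *\<^sub>R x t) * (indicator {0..1} t *\<^sub>R y t)) = (\<lambda>t. indicator {0..1} t *\<^sub>R (x t * y t))"
    by (auto simp: indicator_def)
  moreover have "\<bar>x t * y t\<bar> \<le> R * S" if "t \<in> {0..1}" for t
    using bounded_pathD[OF assms(1) that] bounded_pathD[OF assms(2) that] bounded_path_nonneg[OF assms(1)]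
    unfolding abs_mult by (intro mult_mono) auto
  ultimately show ?thesis unfolding bounded_path_def set_borel_measurable_def by simp
qed

lemma bounded_path_diff:
  assumes "bounded_path R x" "bounded_path S y"
  shows "bounded_path (R + S) (\<lambda>t. x t - y t)"
proof -
  have "(\<lambda>t. (indicator {0..1} t *\<^sub>R x t) - (indicator {0..1} t *\<^sub>R y t)) \<in> borel_measurable borel"
    using assms unfolding bounded_path_def set_borel_measurable_def by (intro borel_measurable_diff) auto
  moreover have "(\<lambda>t. (indicator {0..1} t *\<^sub>R x t) - (indicator {0..1} t *\<^sub>R y t)) = (\<lambda>t. indicator {0..1} t *\<^sub>R (x t - y t))"
    by (auto simp: indicator_def)
  moreover have "\<bar>x t - y t\<bar> \<le> R + S" if "t \<in> {0..1}" for t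
    using bounded_pathD[OF assms(1) that] bounded_pathD[OF assms(2) that] by linarith
  ultimately show ?thesis unfolding bounded_path_def set_borel_measurable_def by simp
qed

lemma bounded_path_abs:
  assumes "bounded_path R x" shows "bounded_path R (\<lambda>t. \<bar>x t\<bar>)"
proof -
  have "(\<lambda>t. \<bar>indicator {0..1} t *\<^sub>R x t\<bar>) \<in> borel_measurable borel"
    using assms unfolding bounded_path_def set_borel_measurable_def by (intro borel_measurable_abs) auto
  then show ?thesis using assms by (simp add: bounded_path_def set_borel_measurable_def abs_mult)
qed

lemma bounded_path_power2: "bounded_path R x \<Longrightarrow> bounded_path (R\<^sup>2) (\<lambda>t. (x t)\<^sup>2)"
  using bounded_path_mult[of R x R x] by (simp add: power2_eq_square)

lemma bounded_path_set_integrable: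
  assumes x: "bounded_path R x" and "0 \<le> u" "v \<le> 1"
  shows "set_integrable lborel {u..v} x"
proof -
  have m: "set_borel_measurable lborel {u..v} x"
    using x assms(2,3) unfolding bounded_path_def
    by (intro set_borel_measurable_subset[of lborel "{0..1}" x "{u..v}"]) (auto simp: set_borel_measurable_def)
  have i: "set_integrable lborel {u..v} (\<lambda>_. R)"
    unfolding set_integrable_def by (cases "u \<le> v") auto
  show ?thesis
    by (rule set_integrable_bound[OF i m]) (use x assms(2,3) bounded_pathD bounded_path_nonneg in \<open>force intro!: AE_I2\<close>)
qed

lemma bounded_path_integrable:
  assumes "bounded_path R x" "0 \<le> u" "v \<le> 1"
  shows "x integrable_on {u..v}" "(LINT t:{u..v}|lborel. x t) = integral {u..v} x"
  using set_borel_integral_eq_integral[OF bounded_path_set_integrable[OF assms]] by auto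

lemma bounded_path_integral_le:
  assumes "bounded_path R x" "bounded_path S y" "0 \<le> u" "u \<le> v" "v \<le> 1"
    and "\<And>t. t \<in> {u..v} \<Longrightarrow> \<bar>x t\<bar> \<le> y t"
  shows "\<bar>integral {u..v} x\<bar> \<le> integral {u..v} y"
  using integral_norm_bound_integral[of x "{u..v}" y] assms bounded_path_integrable(1) by simp

lemma bounded_path_integral_bound:
  assumes "bounded_path R x" "0 \<le> u" "u \<le> v" "v \<le> 1" "\<And>t. t \<in> {u..v} \<Longrightarrow> \<bar>x t\<bar> \<le> c"
  shows "\<bar>integral {u..v} x\<bar> \<le> c * (v - u)"
  using integral_norm_bound_integral[of x "{u..v}" "\<lambda>_. c"] assms bounded_path_integrable(1)[OF assms(1,2,4)]
  by (simp add: mult.commute integrable_const_ivl)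

lemma skorohod_convergent_imp_bounded_path:
  assumes x: "x \<in> cadlag_space 0 1" and X: "\<And>n. X n \<in> cadlag_space 0 1"
    and lim: "(\<lambda>n. skorohod_dist 0 1 x (X n)) \<longlonglongrightarrow> 0"
  obtains R where "bounded_path R x" "\<And>n. bounded_path R (X n)"
proof -
  interpret Metric_space "cadlag_space 0 1" "skorohod_dist 0 1" by (rule Metric_space_skorohod)
  define C where "C = skorohod_dist 0 1 x (\<lambda>t\<in>{0..1}. 0)"
  obtain D where D: "\<And>n. skorohod_dist 0 1 x (X n) \<le> D"
    using convergent_imp_bounded[OF lim] nonneg by (auto simp: bounded_iff)
  have "0 \<le> D" using order_trans[OF nonneg D] .
  then have "\<bar>x t\<bar> \<le> C + D" if "t \<in> {0..1}" for t
    using abs_le_skorohod_dist_zero[OF x that] by (simp add: C_def)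
  moreover have "\<bar>X n t\<bar> \<le> C + D" if "t \<in> {0..1}" for n t
    using abs_le_skorohod_dist_zero[OF X that, of n] triangle[OF X x restrict_const_cadlag, of n 0]
      D[of n] commute[of x "X n"] by (simp add: C_def)
  ultimately show ?thesis by (intro that[of "C + D"] cadlag_bounded_path x X) auto
qed

text \<open>At every continuity point of the limit the time changes disappear in the limit, and these
  points are almost all points; dominated convergence does the rest.\<close>

lemma skorohod_convergence_imp_L1:
  assumes x: "x \<in> cadlag_space 0 1" and X: "\<And>n. X n \<in> cadlag_space 0 1"
    and lim: "(\<lambda>n. skorohod_dist 0 1 x (X n)) \<longlonglongrightarrow> 0"
  shows "(\<lambda>n. integral {0..1} (\<lambda>t. \<bar>X n t - x t\<bar>)) \<longlonglongrightarrow> 0"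
proof -
  interpret Metric_space "cadlag_space 0 1" "skorohod_dist 0 1" by (rule Metric_space_skorohod)
  obtain R where bp: "bounded_path R x" "\<And>n. bounded_path R (X n)"
    using skorohod_convergent_imp_bounded_path[OF assms] by blast
  then have bpd: "bounded_path (R + R) (\<lambda>t. \<bar>X n t - x t\<bar>)" for n
    by (intro bounded_path_abs bounded_path_diff)
  have "AE t in lborel. t \<notin> {t \<in> {0<..<1}. \<not> isCont x t} \<and> t \<noteq> 0 \<and> t \<noteq> 1"
    using cadlag_countable_discontinuities[OF x] by (intro AE_conjI AE_lborel_singleton AE_not_in countable_imp_null_set_lborel)
  then have ae: "AE t in lborel. (\<lambda>n. indicator {0..1} t *\<^sub>R \<bar>X n t - x t\<bar>) \<longlonglongrightarrow> 0"
  proof (rule AE_mp, intro AE_I2 impI)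
    fix t assume t: "t \<notin> {t \<in> {0<..<1}. \<not> isCont x t} \<and> t \<noteq> 0 \<and> t \<noteq> (1::real)"
    show "(\<lambda>n. indicator {0..1} t *\<^sub>R \<bar>X n t - x t\<bar>) \<longlonglongrightarrow> 0"
    proof (cases "t \<in> {0<..<1}")
      case True
      then have cont: "isCont x t" and t01: "t \<in> {0..1}" using t by auto
      define e where "e n = skorohod_dist 0 1 x (X n) + inverse (real (Suc n))" for n
      have e: "e \<longlonglongrightarrow> 0" unfolding e_def
        using tendsto_add[OF lim LIMSEQ_inverse_real_of_nat] by simp
      have "\<exists>l\<in>time_changes 0 1. \<forall>t\<in>{0..1}. \<bar>l t - t\<bar> \<le> e n \<and> \<bar>X n t - x (l t)\<bar> \<le> e n" for n
        by (rule skorohod_dist_less_imp_close[OF X x]) (simp add: e_def commute)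
      then have "\<exists>u. \<bar>u - t\<bar> \<le> e n \<and> \<bar>X n t - x u\<bar> \<le> e n" for n
        using t01 by blast
      then obtain l where l: "\<And>n. \<bar>l n - t\<bar> \<le> e n \<and> \<bar>X n t - x (l n)\<bar> \<le> e n"
        by metis
      have "(\<lambda>n. l n - t) \<longlonglongrightarrow> 0" by (rule Lim_null_comparison[OF _ e]) (use l in auto)
      then have "l \<longlonglongrightarrow> t" by (simp add: LIM_zero_iff)
      then have "(\<lambda>n. x (l n)) \<longlonglongrightarrow> x t" using cont isCont_tendsto_compose by blast
      moreover have "(\<lambda>n. X n t - x (l n)) \<longlonglongrightarrow> 0" by (rule Lim_null_comparison[OF _ e]) (use l in auto)
      ultimately have "(\<lambda>n. X n t - x (l n) + x (l n)) \<longlonglongrightarrow> 0 + x t" by (intro tendsto_add)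
      then have "(\<lambda>n. X n t) \<longlonglongrightarrow> x t" by simp
      then have "(\<lambda>n. \<bar>X n t - x t\<bar>) \<longlonglongrightarrow> 0" by (simp add: LIM_zero_iff tendsto_rabs_zero_iff)
      then show ?thesis using t01 by simp
    qed (use t in auto)
  qed
  have "(\<lambda>n. LINT t:{0..1}|lborel. \<bar>X n t - x t\<bar>) \<longlonglongrightarrow> (LINT (t::real)|lborel. 0 :: real)"
    unfolding set_lebesgue_integral_def
  proof (rule integral_dominated_convergence[where w="\<lambda>t. indicator {0..1::real} t *\<^sub>R (R + R)"])
    show "integrable lborel (\<lambda>t. indicator {0..1::real} t *\<^sub>R (R + R))" by simp
    show "(\<lambda>t. indicator {0..1} t *\<^sub>R \<bar>X n t - x t\<bar>) \<in> borel_measurable lborel" for n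
      using bpd[of n] by (simp add: bounded_path_def set_borel_measurable_def)
    show "AE t in lborel. norm (indicator {0..1} t *\<^sub>R \<bar>X n t - x t\<bar>) \<le> indicator {0..1} t *\<^sub>R (R + R)" for n
      using bounded_pathD[OF bpd[of n]] by (intro AE_I2) (auto simp: indicator_def)
  qed (use ae in auto)
  then show ?thesis using bounded_path_integrable(2)[OF bpd, of 0 1] by simp
qed

section \<open>Random elements of the Skorohod space\<close>

text \<open>Step paths with jumps on a grid of mesh $1/k$. They describe the variance-ratio process itself and
  approximate the limit process.\<close>

definition grid_path :: "real \<Rightarrow> real \<Rightarrow> real \<Rightarrow> (nat \<Rightarrow> real) \<Rightarrow> real \<Rightarrow> real" where
  "grid_path a b k v = (\<lambda>t\<in>{a..b}. v (nat \<lfloor>k * t\<rfloor>))"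

lemma grid_path_cadlag:
  assumes k: "0 < k"
  shows "grid_path a b k v \<in> cadlag_space a b"
proof -
  have "(grid_path a b k v \<longlongrightarrow> grid_path a b k v t) (at_right t)" if t: "t \<in> {a..<b}" for t
  proof (rule tendsto_eventually, rule eventually_at_rightI)
    have "k * t < of_int \<lfloor>k * t\<rfloor> + 1" by linarith
    then have "t < (of_int \<lfloor>k * t\<rfloor> + 1) / k" using k by (simp add: field_simps)
    then show "t < min b ((of_int \<lfloor>k * t\<rfloor> + 1) / k)" using t by simp
    fix u assume u: "u \<in> {t<..<min b ((of_int \<lfloor>k * t\<rfloor> + 1) / k)}"
    then have "k * t \<le> k * u" "k * u < of_int \<lfloor>k * t\<rfloor> + 1" using k by (simp_all add: field_simps)
    then have "\<lfloor>k * u\<rfloor> = \<lfloor>k * t\<rfloor>" by (intro floor_unique) linarith+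
    then show "grid_path a b k v u = grid_path a b k v t" using t u by (simp add: grid_path_def)
  qed
  moreover have "(grid_path a b k v \<longlongrightarrow> v (nat (\<lceil>k * t\<rceil> - 1))) (at_left t)" if t: "t \<in> {a<..b}" for t
  proof (rule tendsto_eventually, rule eventually_at_leftI)
    have "of_int \<lceil>k * t\<rceil> - 1 < k * t" by linarith
    then have "(of_int \<lceil>k * t\<rceil> - 1) / k < t" using k by (simp add: field_simps)
    then show "max a ((of_int \<lceil>k * t\<rceil> - 1) / k) < t" using t by simp
    fix u assume u: "u \<in> {max a ((of_int \<lceil>k * t\<rceil> - 1) / k)<..<t}"
    then have "k * u < k * t" "of_int \<lceil>k * t\<rceil> - 1 < k * u" using k by (simp_all add: field_simps)
    then have "\<lfloor>k * u\<rfloor> = \<lceil>k * t\<rceil> - 1" by (intro floor_unique) (simp_all, linarith+)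
    then show "grid_path a b k v u = v (nat (\<lceil>k * t\<rceil> - 1))" using t u by (simp add: grid_path_def)
  qed
  ultimately show ?thesis unfolding cadlag_space_def by (force simp: grid_path_def)
qed

lemma continuous_restrict_cadlag:
  assumes f: "continuous_on {a..b} f"
  shows "(\<lambda>t\<in>{a..b}. f t) \<in> cadlag_space a b"
proof -
  have eq: "(restrict f {a..b} \<longlongrightarrow> f t) F" if "(f \<longlongrightarrow> f t) F" "eventually (\<lambda>u. u \<in> {a..b}) F" for t F
    using that(1) by (rule Lim_transform_eventually) (use that(2) in \<open>auto elim: eventually_mono\<close>)
  have "(restrict f {a..b} \<longlongrightarrow> f t) (at_right t)" if t: "t \<in> {a..<b}" for t
  proof (rule eq)
    have "(f \<longlongrightarrow> f t) (at t within {a..b})" using f t by (simp add: continuous_on)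
    then have "(f \<longlongrightarrow> f t) (at t within {t..b})" by (rule tendsto_within_subset) (use t in auto)
    then show "(f \<longlongrightarrow> f t) (at_right t)" using t by (simp add: at_within_Icc_at_right)
    show "eventually (\<lambda>u. u \<in> {a..b}) (at_right t)"
      using t by (intro eventually_at_rightI[of t b]) auto
  qed
  moreover have "(restrict f {a..b} \<longlongrightarrow> f t) (at_left t)" if t: "t \<in> {a<..b}" for t
  proof (rule eq)
    have "(f \<longlongrightarrow> f t) (at t within {a..b})" using f t by (simp add: continuous_on)
    then have "(f \<longlongrightarrow> f t) (at t within {a..t})" by (rule tendsto_within_subset) (use t in auto)
    then show "(f \<longlongrightarrow> f t) (at_left t)" using t by (simp add: at_within_Icc_at_left)
    show "eventually (\<lambda>u. u \<in> {a..b}) (at_left t)"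
      using t by (intro eventually_at_leftI[of a t]) auto
  qed
  ultimately show ?thesis unfolding cadlag_space_def by force
qed

lemma space_skorohod_borel: "space (skorohod_borel a b) = cadlag_space a b"
  by (simp add: skorohod_borel_def space_measure_of_conv)

text \<open>A Lipschitz functional of the grid path is a continuous function of the sequence $v$ in the product
  topology, because a path on $[a,b]$ uses only finitely many entries.\<close>

lemma grid_path_measurable:
  assumes k: "0 < k" and v: "\<And>i. v i \<in> borel_measurable Q"
  shows "(\<lambda>\<omega>. grid_path a b k (\<lambda>i. v i \<omega>)) \<in> measurable Q (skorohod_borel a b)"
proof -
  interpret Metric_space "cadlag_space a b" "skorohod_dist a b" by (rule Metric_space_skorohod)
  show ?thesis unfolding skorohod_borel_def skorohod_topology_def
  proof (rule measurable_of_lipschitz_functionals)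
    show "(\<lambda>\<omega>. grid_path a b k (\<lambda>i. v i \<omega>)) \<in> space Q \<rightarrow> cadlag_space a b"
      using grid_path_cadlag[OF k] by auto
    fix f :: "(real \<Rightarrow> real) \<Rightarrow> real"
    assume f: "\<And>x y. x \<in> cadlag_space a b \<Longrightarrow> y \<in> cadlag_space a b \<Longrightarrow> \<bar>f x - f y\<bar> \<le> skorohod_dist a b x y"
    define p where "p = nat \<lfloor>k * b\<rfloor>"
    have lip: "\<bar>f (grid_path a b k u) - f (grid_path a b k w)\<bar> \<le> (\<Sum>i\<le>p. \<bar>u i - w i\<bar>)" for u w
    proof -
      have "skorohod_dist a b (grid_path a b k u) (grid_path a b k w) \<le> (\<Sum>i\<le>p. \<bar>u i - w i\<bar>)"
      proof (rule skorohod_dist_le[OF grid_path_cadlag[OF k] grid_path_cadlag[OF k]])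
        fix t assume t: "t \<in> {a..b}"
        have "nat \<lfloor>k * t\<rfloor> \<le> p" unfolding p_def using t k by (intro nat_mono floor_mono) auto
        then have "\<bar>u (nat \<lfloor>k * t\<rfloor>) - w (nat \<lfloor>k * t\<rfloor>)\<bar> \<le> (\<Sum>i\<le>p. \<bar>u i - w i\<bar>)"
          by (intro member_le_sum) auto
        then show "\<bar>grid_path a b k u t - grid_path a b k w t\<bar> \<le> (\<Sum>i\<le>p. \<bar>u i - w i\<bar>)"
          using t by (simp add: grid_path_def)
      qed (simp add: sum_nonneg)
      then show ?thesis using f[OF grid_path_cadlag[OF k] grid_path_cadlag[OF k], of u w] by linarith
    qed
    have "continuous_on UNIV (\<lambda>u. f (grid_path a b k u))"
      unfolding continuous_on_def
    proof
      fix u :: "nat \<Rightarrow> real"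
      have coord: "((\<lambda>w. w i) \<longlongrightarrow> u i) (at u)" for i
        using continuous_on_product_coordinates[of i] by (auto simp: continuous_on_def)
      have "((\<lambda>w. \<Sum>i\<le>p. \<bar>w i - u i\<bar>) \<longlongrightarrow> (\<Sum>i\<le>p. \<bar>u i - u i\<bar>)) (at u)"
        by (intro tendsto_intros coord)
      then have "((\<lambda>w. \<Sum>i\<le>p. \<bar>w i - u i\<bar>) \<longlongrightarrow> 0) (at u)" by simp
      then have "((\<lambda>w. f (grid_path a b k w) - f (grid_path a b k u)) \<longlongrightarrow> 0) (at u)"
        by (rule Lim_null_comparison[rotated]) (use lip in auto)
      then show "((\<lambda>w. f (grid_path a b k w)) \<longlongrightarrow> f (grid_path a b k u)) (at u)"
        by (simp add: LIM_zero_iff)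
    qed
    then have "(\<lambda>u. f (grid_path a b k u)) \<in> borel_measurable borel"
      by (rule borel_measurable_continuous_onI)
    moreover have "(\<lambda>\<omega> i. v i \<omega>) \<in> borel_measurable Q"
      by (rule measurable_coordinatewise_then_product) (rule v)
    ultimately show "(\<lambda>\<omega>. f (grid_path a b k (\<lambda>i. v i \<omega>))) \<in> borel_measurable Q"
      by (rule measurable_compose[rotated])
  qed
qed

text \<open>Sampling on finer and finer grids converges uniformly by uniform continuity, so the process is a
  limit of random grid paths.\<close>

lemma continuous_process_measurable:
  assumes ab: "a \<le> b" "0 \<le> a" and meas: "\<And>t. t \<in> {a..b} \<Longrightarrow> Z t \<in> borel_measurable Q"
    and cont: "\<And>\<omega>. \<omega> \<in> space Q \<Longrightarrow> continuous_on {a..b} (\<lambda>t. Z t \<omega>)"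
  shows "sample_path a b Z \<in> measurable Q (skorohod_borel a b)"
proof -
  interpret Metric_space "cadlag_space a b" "skorohod_dist a b" by (rule Metric_space_skorohod)
  define V where "V n i = Z (min b (max a (real i / real (Suc n))))" for n i
  define X where "X n \<omega> = grid_path a b (real (Suc n)) (\<lambda>i. V n i \<omega>)" for n \<omega>
  have Zc: "sample_path a b Z \<omega> \<in> cadlag_space a b" if "\<omega> \<in> space Q" for \<omega>
    unfolding sample_path_def by (rule continuous_restrict_cadlag[OF cont[OF that]])
  have Xc: "X n \<omega> \<in> cadlag_space a b" for n \<omega>
    unfolding X_def by (rule grid_path_cadlag) simp
  show ?thesis unfolding skorohod_borel_def skorohod_topology_def
  proof (rule measurable_limit)
    have "V n i \<in> borel_measurable Q" for n i unfolding V_def using ab by (intro meas) auto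
    then show "X n \<in> measurable Q (sigma (cadlag_space a b) {U. openin mtopology U})" for n
      unfolding X_def skorohod_borel_def[symmetric, unfolded skorohod_topology_def] by (intro grid_path_measurable) auto
    show "sample_path a b Z \<in> space Q \<rightarrow> cadlag_space a b" using Zc by auto
    fix \<omega> assume w: "\<omega> \<in> space Q"
    have uc: "uniformly_continuous_on {a..b} (\<lambda>t. Z t \<omega>)"
      using cont[OF w] by (intro compact_uniformly_continuous) auto
    show "(\<lambda>n. skorohod_dist a b (sample_path a b Z \<omega>) (X n \<omega>)) \<longlonglongrightarrow> 0"
    proof (rule tendstoI)
      fix e :: real assume e: "0 < e"
      then obtain \<delta> where \<delta>: "\<delta> > 0" "\<And>s t. s \<in> {a..b} \<Longrightarrow> t \<in> {a..b} \<Longrightarrow> dist t s < \<delta> \<Longrightarrow> dist (Z t \<omega>) (Z s \<omega>) < e/2"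
        using uc unfolding uniformly_continuous_on_def by (meson half_gt_zero)
      from LIMSEQ_inverse_real_of_nat have "eventually (\<lambda>n. inverse (real (Suc n)) < \<delta>) sequentially"
        using \<delta>(1) by (auto dest: order_tendstoD)
      then show "eventually (\<lambda>n. dist (skorohod_dist a b (sample_path a b Z \<omega>) (X n \<omega>)) 0 < e) sequentially"
      proof (rule eventually_mono)
        fix n assume n: "inverse (real (Suc n)) < \<delta>"
        have "skorohod_dist a b (sample_path a b Z \<omega>) (X n \<omega>) \<le> e/2"
        proof (rule skorohod_dist_le[OF Zc[OF w] Xc])
          fix t assume t: "t \<in> {a..b}"
          define u where "u = min b (max a (real (nat \<lfloor>real (Suc n) * t\<rfloor>) / real (Suc n)))"
          have "0 \<le> real (Suc n) * t" using t ab by simp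
          then have "real (nat \<lfloor>real (Suc n) * t\<rfloor>) \<le> real (Suc n) * t" "real (Suc n) * t < real (nat \<lfloor>real (Suc n) * t\<rfloor>) + 1"
            by linarith+
          then have "real (nat \<lfloor>real (Suc n) * t\<rfloor>) / real (Suc n) \<le> t" "t < real (nat \<lfloor>real (Suc n) * t\<rfloor>) / real (Suc n) + inverse (real (Suc n))"
            by (simp_all add: field_simps del: of_nat_Suc)
          then have "dist u t < \<delta>" using t n unfolding u_def dist_real_def atLeastAtMost_iff by linarith
          moreover have "u \<in> {a..b}" using ab by (simp add: u_def)
          ultimately have "dist (Z u \<omega>) (Z t \<omega>) < e/2" using t by (intro \<delta>(2)) auto
          then show "\<bar>sample_path a b Z \<omega> t - X n \<omega> t\<bar> \<le> e/2"
            using t by (simp add: sample_path_def X_def grid_path_def V_def u_def dist_real_def abs_minus_commute)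
        qed (use e in simp)
        then show "dist (skorohod_dist a b (sample_path a b Z \<omega>) (X n \<omega>)) 0 < e" using e by simp
      qed
    qed
  qed
qed

lemma skorohod_measurable_functional:
  assumes "X \<in> measurable Q (skorohod_borel a b)" "continuous_map (skorohod_topology a b) euclideanreal f"
  shows "(\<lambda>\<omega>. f (X \<omega>)) \<in> borel_measurable Q"
  using assms unfolding skorohod_borel_def skorohod_topology_def
  by (intro measurable_compose[OF _ Metric_space.measurable_of_continuous_map[OF Metric_space_skorohod]])

lemma skorohod_measurable_cadlag:
  "X \<in> measurable Q (skorohod_borel a b) \<Longrightarrow> \<omega> \<in> space Q \<Longrightarrow> X \<omega> \<in> cadlag_space a b"
  using measurable_space[of X Q "skorohod_borel a b" \<omega>] by (simp add: space_skorohod_borel)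

section \<open>Integrals along a path\<close>

definition primitive :: "(real \<Rightarrow> real) \<Rightarrow> real \<Rightarrow> real" where
  "primitive x r = integral {0..r} x"

definition energy :: "(real \<Rightarrow> real) \<Rightarrow> real \<Rightarrow> real" where
  "energy x s = integral {0..s} (\<lambda>r. (x r)\<^sup>2)"

definition L1_dist :: "(real \<Rightarrow> real) \<Rightarrow> (real \<Rightarrow> real) \<Rightarrow> real" where
  "L1_dist x y = integral {0..1} (\<lambda>t. \<bar>x t - y t\<bar>)"

lemma bounded_path_integral_split:
  assumes "bounded_path R x" "0 \<le> u" "u \<le> v" "v \<le> 1"
  shows "integral {0..v} x = integral {0..u} x + integral {u..v} x"
  using Henstock_Kurzweil_Integration.integral_combine[of 0 u v x] bounded_path_integrable(1)[OF assms(1), of 0 v] assms by simp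

lemma bounded_path_integral_diff:
  assumes "bounded_path R x" "bounded_path S y" "0 \<le> u" "v \<le> 1"
  shows "integral {u..v} (\<lambda>t. x t - y t) = integral {u..v} x - integral {u..v} y"
  using assms by (intro integral_diff bounded_path_integrable(1))

text \<open>The common source of all estimates of the form: the integrals of two paths differ by at most a
  constant times their distance in mean.\<close>

lemma integral_le_L1_dist:
  assumes x: "bounded_path R x" and y: "bounded_path S y" and s: "0 \<le> s" "s \<le> 1"
    and z: "bounded_path T z" and le: "\<And>t. t \<in> {0..1} \<Longrightarrow> \<bar>z t\<bar> \<le> c * \<bar>x t - y t\<bar>"
  shows "\<bar>integral {0..s} z\<bar> \<le> c * L1_dist x y"
proof -
  have d: "bounded_path (R + S) (\<lambda>t. \<bar>x t - y t\<bar>)" by (intro bounded_path_abs bounded_path_diff x y)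
  have za: "bounded_path T (\<lambda>t. \<bar>z t\<bar>)" by (rule bounded_path_abs[OF z])
  have "\<bar>integral {0..s} z\<bar> \<le> integral {0..s} (\<lambda>t. \<bar>z t\<bar>)"
    using s by (intro bounded_path_integral_le[OF z za]) auto
  also have "\<dots> \<le> integral {0..1} (\<lambda>t. \<bar>z t\<bar>)"
    using s by (intro integral_subset_le) (simp_all add: bounded_path_integrable(1)[OF za])
  also have "\<dots> \<le> integral {0..1} (\<lambda>t. c * \<bar>x t - y t\<bar>)"
  proof (rule integral_le)
    show "(\<lambda>t. \<bar>z t\<bar>) integrable_on {0..1}" by (rule bounded_path_integrable(1)[OF za]) simp_all
    show "(\<lambda>t. c * \<bar>x t - y t\<bar>) integrable_on {0..1}"
      by (intro integrable_on_mult_right bounded_path_integrable(1)[OF d]) simp_all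
  qed (rule le)
  also have "\<dots> = c * L1_dist x y" unfolding L1_dist_def by simp
  finally show ?thesis .
qed

lemma primitive_zero: "primitive x 0 = 0" by (simp add: primitive_def)

lemma primitive_lipschitz:
  assumes "bounded_path R x" "0 \<le> u" "u \<le> v" "v \<le> 1"
  shows "\<bar>primitive x v - primitive x u\<bar> \<le> R * (v - u)"
proof -
  have "\<bar>integral {u..v} x\<bar> \<le> R * (v - u)"
    using assms by (intro bounded_path_integral_bound[OF assms(1)] bounded_pathD[OF assms(1)]) auto
  then show ?thesis unfolding primitive_def using bounded_path_integral_split[OF assms] by simp
qed

lemma primitive_bound:
  assumes x: "bounded_path R x" and r: "0 \<le> r" "r \<le> 1"
  shows "\<bar>primitive x r\<bar> \<le> R"
proof -
  have "\<bar>primitive x r\<bar> \<le> R * r" using primitive_lipschitz[OF x, of 0 r] r by (simp add: primitive_zero)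
  also have "\<dots> \<le> R" using bounded_path_nonneg[OF x] r by (simp add: mult_left_le)
  finally show ?thesis .
qed

lemma lipschitz_imp_continuous_on_real:
  fixes f :: "real \<Rightarrow> real"
  assumes "\<And>u v. a \<le> u \<Longrightarrow> u \<le> v \<Longrightarrow> v \<le> b \<Longrightarrow> \<bar>f v - f u\<bar> \<le> c * (v - u)" "0 \<le> c"
  shows "continuous_on {a..b} f"
proof (rule lipschitz_on_continuous_on)
  have "dist (f u) (f v) \<le> c * dist u v" if "u \<in> {a..b}" "v \<in> {a..b}" for u v
    using assms(1)[of u v] assms(1)[of v u] that
    by (cases "u \<le> v") (simp_all add: dist_real_def abs_minus_commute)
  then show "c-lipschitz_on {a..b} f" using assms(2) by (rule lipschitz_onI)
qed

lemma primitive_bounded_path: "bounded_path R x \<Longrightarrow> bounded_path R (primitive x)"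
  by (rule bounded_path_continuous[OF lipschitz_imp_continuous_on_real[OF primitive_lipschitz bounded_path_nonneg]])
    (auto intro: primitive_bound)

lemma primitive_diff:
  assumes "bounded_path R x" "bounded_path S y" "0 \<le> r" "r \<le> 1"
  shows "\<bar>primitive x r - primitive y r\<bar> \<le> L1_dist x y"
  using integral_le_L1_dist[OF assms(1,2,3,4) bounded_path_diff[OF assms(1,2)], of 1]
    bounded_path_integral_diff[OF assms(1,2), of 0 r] assms(3,4) by (simp add: primitive_def)

lemma L1_dist_nonneg: "bounded_path R x \<Longrightarrow> bounded_path S y \<Longrightarrow> 0 \<le> L1_dist x y"
  using primitive_diff[of R x S y 0] by (simp add: primitive_zero)

lemma energy_lipschitz:
  assumes "bounded_path R x" "0 \<le> u" "u \<le> v" "v \<le> 1"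
  shows "\<bar>energy x v - energy x u\<bar> \<le> R\<^sup>2 * (v - u)"
  using primitive_lipschitz[OF bounded_path_power2[OF assms(1)] assms(2-4)] by (simp add: energy_def primitive_def)

lemma energy_mono:
  assumes "bounded_path R x" "0 \<le> u" "u \<le> v" "v \<le> 1"
  shows "energy x u \<le> energy x v"
  unfolding energy_def using assms
  by (intro integral_subset_le) (simp_all add: bounded_path_integrable(1)[OF bounded_path_power2[OF assms(1)]])

lemma energy_nonneg: "0 \<le> energy x s"
  unfolding energy_def
  by (cases "(\<lambda>r. (x r)\<^sup>2) integrable_on {0..s}") (auto intro: integral_nonneg simp: not_integrable_integral)

lemma energy_continuous: "bounded_path R x \<Longrightarrow> continuous_on {0..1} (energy x)"
  by (rule lipschitz_imp_continuous_on_real[OF energy_lipschitz]) auto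

lemma abs_diff_power2_le:
  fixes p q R :: real
  assumes "\<bar>p\<bar> \<le> R" "\<bar>q\<bar> \<le> R"
  shows "\<bar>p\<^sup>2 - q\<^sup>2\<bar> \<le> 2 * R * \<bar>p - q\<bar>"
proof -
  have "\<bar>p\<^sup>2 - q\<^sup>2\<bar> = \<bar>p + q\<bar> * \<bar>p - q\<bar>" by (simp add: power2_eq_square square_diff_square_factored abs_mult)
  also have "\<dots> \<le> 2 * R * \<bar>p - q\<bar>" by (rule mult_right_mono) (use assms in linarith)+
  finally show ?thesis .
qed

lemma energy_diff:
  assumes x: "bounded_path R x" and y: "bounded_path R y" and s: "0 \<le> s" "s \<le> 1"
  shows "\<bar>energy x s - energy y s\<bar> \<le> 2 * R * L1_dist x y"
proof -
  note xy = bounded_path_power2[OF x] bounded_path_power2[OF y]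
  have "\<bar>integral {0..s} (\<lambda>t. (x t)\<^sup>2 - (y t)\<^sup>2)\<bar> \<le> 2 * R * L1_dist x y"
    by (rule integral_le_L1_dist[OF x y s bounded_path_diff[OF xy]])
      (use bounded_pathD[OF x] bounded_pathD[OF y] in \<open>auto intro!: abs_diff_power2_le\<close>)
  then show ?thesis unfolding energy_def using bounded_path_integral_diff[OF xy, of 0 s] s by simp
qed

text \<open>The Cauchy-Schwarz inequality on $[u, v]$, from expanding $0 \leq \int_u^v (x - c)^2$ with $c$ the mean
  value of $x$.\<close>

lemma primitive_increment_power2_le:
  assumes x: "bounded_path R x" and uv: "0 \<le> u" "u \<le> v" "v \<le> 1"
  shows "(primitive x v - primitive x u)\<^sup>2 \<le> (v - u) * (energy x v - energy x u)"
proof (cases "u = v")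
  case False
  define I where "I = integral {u..v} x"
  define c where "c = I / (v - u)"
  have eqs: "primitive x v - primitive x u = I"
      "energy x v - energy x u = integral {u..v} (\<lambda>t. (x t)\<^sup>2)"
    using bounded_path_integral_split[OF x uv] bounded_path_integral_split[OF bounded_path_power2[OF x] uv]
    by (simp_all add: primitive_def energy_def I_def)
  have i: "x integrable_on {u..v}" "(\<lambda>t. (x t)\<^sup>2) integrable_on {u..v}"
    using bounded_path_integrable(1)[OF x] bounded_path_integrable(1)[OF bounded_path_power2[OF x]] uv by auto
  have const: "((\<lambda>t. c\<^sup>2) has_integral (v - u) * c\<^sup>2) {u..v}"
    using has_integral_const_real[of "c\<^sup>2" u v] uv by simp
  have "((\<lambda>t. (x t)\<^sup>2 - 2 * c * x t + c\<^sup>2) has_integral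
      (integral {u..v} (\<lambda>t. (x t)\<^sup>2) - 2 * c * I + (v - u) * c\<^sup>2)) {u..v}"
    unfolding I_def
    by (intro has_integral_add has_integral_diff has_integral_mult_right const integrable_integral i)
  then have "0 \<le> integral {u..v} (\<lambda>t. (x t)\<^sup>2) - 2 * c * I + (v - u) * c\<^sup>2"
  proof (rule has_integral_nonneg)
    fix t show "0 \<le> (x t)\<^sup>2 - 2 * c * x t + c\<^sup>2"
      using zero_le_power2[of "x t - c"] by (simp add: power2_diff algebra_simps)
  qed
  then have "2 * c * I - (v - u) * c\<^sup>2 \<le> integral {u..v} (\<lambda>t. (x t)\<^sup>2)" using uv by simp
  also have "2 * c * I - (v - u) * c\<^sup>2 = I\<^sup>2 / (v - u)"
  proof -
    have "c * (v - u) = I" using False by (simp add: c_def)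
    then have "(v - u) * c\<^sup>2 = c * I" by (simp add: power2_eq_square algebra_simps)
    then show ?thesis by (simp add: c_def power2_eq_square)
  qed
  finally show ?thesis using False uv unfolding eqs by (simp add: field_simps)
qed simp

text \<open>The difference is split by replacing prefactor, numerator and denominator one at a time.\<close>

lemma ratio_diff_le:
  fixes a b c :: real
  assumes \<delta>: "0 < \<delta>" "\<delta> \<le> c" "\<delta> \<le> c'" and "\<bar>a'\<bar> \<le> A" "\<bar>b\<bar> \<le> D" "\<bar>b'\<bar> \<le> D"
  shows "\<bar>a * b / c - a' * b' / c'\<bar> \<le> D / \<delta> * \<bar>a - a'\<bar> + A / \<delta> * \<bar>b - b'\<bar> + A * D / \<delta>\<^sup>2 * \<bar>c - c'\<bar>"
proof -
  have c: "0 < c" "0 < c'" using \<delta> by auto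
  have A: "0 \<le> A" "0 \<le> D" using assms by auto
  have last: "a' * b' / (c * c') * (c' - c) = a' * b' / c - a' * b' / c'"
    using c by (simp add: field_simps)
  have "a * b / c - a' * b' / c' = b / c * (a - a') + a' / c * (b - b') + a' * b' / (c * c') * (c' - c)"
    unfolding last by (simp add: diff_divide_distrib algebra_simps)
  also have "\<bar>\<dots>\<bar> \<le> \<bar>b / c * (a - a')\<bar> + \<bar>a' / c * (b - b')\<bar> + \<bar>a' * b' / (c * c') * (c' - c)\<bar>"
    by (rule order_trans[OF abs_triangle_ineq add_right_mono[OF abs_triangle_ineq]])
  also have "\<dots> = \<bar>b\<bar> / c * \<bar>a - a'\<bar> + \<bar>a'\<bar> / c * \<bar>b - b'\<bar> + \<bar>a'\<bar> * \<bar>b'\<bar> / (c * c') * \<bar>c - c'\<bar>"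
    using c by (simp add: abs_mult abs_minus_commute)
  also have "\<dots> \<le> D / \<delta> * \<bar>a - a'\<bar> + A / \<delta> * \<bar>b - b'\<bar> + A * D / (\<delta> * \<delta>) * \<bar>c - c'\<bar>"
  proof (intro add_mono mult_right_mono abs_ge_zero)
    show "\<bar>b\<bar> / c \<le> D / \<delta>" "\<bar>a'\<bar> / c \<le> A / \<delta>" using assms A by (auto intro!: frac_le)
    have "\<bar>a'\<bar> * \<bar>b'\<bar> \<le> A * D" "\<delta> * \<delta> \<le> c * c'"
      using assms A c by (auto intro!: mult_mono)
    then show "\<bar>a'\<bar> * \<bar>b'\<bar> / (c * c') \<le> A * D / (\<delta> * \<delta>)"
      using \<delta>(1) A by (intro frac_le) auto
  qed
  finally show ?thesis by (simp add: power2_eq_square)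
qed

section \<open>The variance-ratio functional\<close>

text \<open>The constant $Z$ dominates the limit $\zeta$ and, in the applications, every prelimit value $N / h_N$, so
  that the kernel is evaluated on $[-Z, Z]$ only.\<close>

locale variance_ratio_functional =
  fixes K :: "real \<Rightarrow> real" and L Z \<zeta> \<kappa> :: real
  assumes K_nonneg: "0 \<le> K x"
    and K_lipschitz: "\<bar>K x - K y\<bar> \<le> L * \<bar>x - y\<bar>"
    and L_nonneg: "0 \<le> L"
    and \<zeta>: "0 < \<zeta>" "\<zeta> \<le> Z"
    and \<kappa>: "0 < \<kappa>" "\<kappa> < 1"
begin

text \<open>A bound for the kernel on $[-Z, Z]$.\<close>

definition K_bound :: real where
  "K_bound = K 0 + L * Z"

definition numerator :: "(real \<Rightarrow> real) \<Rightarrow> real \<Rightarrow> real" where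
  "numerator x s = integral {0..s} (\<lambda>r. K (\<zeta> * (r - s)) * (primitive x r)\<^sup>2)"

definition ratio :: "(real \<Rightarrow> real) \<Rightarrow> real \<Rightarrow> real" where
  "ratio x s = \<zeta> / s * numerator x s / energy x s"

text \<open>Scaling a path does not change \<open>ratio\<close>, so small paths need not have small ratios and the
  ratio is in general discontinuous at paths that vanish up to time $\kappa$. A denominator of at least $\delta$
  restores continuity.\<close>

definition truncated_ratio :: "real \<Rightarrow> (real \<Rightarrow> real) \<Rightarrow> real \<Rightarrow> real" where
  "truncated_ratio \<delta> x s = \<zeta> / s * numerator x s / max \<delta> (energy x s)"

lemma K_le_K_bound: "\<bar>x\<bar> \<le> Z \<Longrightarrow> K x \<le> K_bound"
  using K_lipschitz[of x 0] mult_left_mono[OF _ L_nonneg, of "\<bar>x\<bar>" Z] unfolding K_bound_def by simp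

lemma K_bound_nonneg: "0 \<le> K_bound"
  using K_le_K_bound[of 0] K_nonneg[of 0] \<zeta> by linarith

lemma abs_scaled_time_le:
  assumes "0 \<le> c" "c \<le> Z" "r \<in> {0..1}" "s \<in> {0..1}"
  shows "\<bar>c * (r - s)\<bar> \<le> Z"
proof -
  have "c * \<bar>r - s\<bar> \<le> c" using assms by (intro mult_left_le) auto
  then show ?thesis using assms by (simp add: abs_mult)
qed

lemma kernel_bounded_path:
  assumes s: "s \<in> {0..1}"
  shows "bounded_path K_bound (\<lambda>r. K (\<zeta> * (r - s)))"
proof (rule bounded_path_continuous)
  have "\<bar>K (\<zeta> * (v - s)) - K (\<zeta> * (u - s))\<bar> \<le> L * \<zeta> * (v - u)" if "u \<le> v" for u v
    using K_lipschitz[of "\<zeta> * (v - s)" "\<zeta> * (u - s)"] that \<zeta>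
    by (simp add: abs_mult mult.assoc flip: right_diff_distrib)
  then show "continuous_on {0..1} (\<lambda>r. K (\<zeta> * (r - s)))"
    using L_nonneg \<zeta> by (intro lipschitz_imp_continuous_on_real[where c="L * \<zeta>"]) auto
  show "\<bar>K (\<zeta> * (t - s))\<bar> \<le> K_bound" if "t \<in> {0..1}" for t
    using K_le_K_bound[OF abs_scaled_time_le[OF _ \<zeta>(2) that s]] \<zeta> K_nonneg by simp
qed

lemma integrand_bounded_path:
  assumes "s \<in> {0..1}" "bounded_path R x"
  shows "bounded_path (K_bound * R\<^sup>2) (\<lambda>r. K (\<zeta> * (r - s)) * (primitive x r)\<^sup>2)"
  by (intro bounded_path_mult kernel_bounded_path bounded_path_power2 primitive_bounded_path assms)

lemma numerator_nonneg:
  assumes "bounded_path R x" "s \<in> {0..1}"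
  shows "0 \<le> numerator x s"
  unfolding numerator_def using assms
  by (intro integral_nonneg bounded_path_integrable(1)[OF integrand_bounded_path]) (auto simp: K_nonneg)

lemma numerator_bound:
  assumes "bounded_path R x" "s \<in> {0..1}"
  shows "\<bar>numerator x s\<bar> \<le> K_bound * R\<^sup>2"
  using primitive_bound[OF integrand_bounded_path[OF assms(2,1)], of s] assms(2)
  by (simp add: numerator_def primitive_def)

lemma numerator_diff:
  assumes x: "bounded_path R x" and y: "bounded_path R y" and s: "s \<in> {0..1}"
  shows "\<bar>numerator x s - numerator y s\<bar> \<le> K_bound * (2 * R) * L1_dist x y"
proof -
  let ?k = "\<lambda>r. K (\<zeta> * (r - s))"
  note b = integrand_bounded_path[OF s x] integrand_bounded_path[OF s y]
  define c where "c = K_bound * (2 * R * L1_dist x y)"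
  have "\<bar>?k r * (primitive x r)\<^sup>2 - ?k r * (primitive y r)\<^sup>2\<bar> \<le> c" if r: "r \<in> {0..s}" for r
  proof -
    have r1: "0 \<le> r" "r \<le> 1" using r s by auto
    have "\<bar>(primitive x r)\<^sup>2 - (primitive y r)\<^sup>2\<bar> \<le> 2 * R * \<bar>primitive x r - primitive y r\<bar>"
      by (intro abs_diff_power2_le primitive_bound[OF x] primitive_bound[OF y] r1)
    also have "\<dots> \<le> 2 * R * L1_dist x y"
      using primitive_diff[OF x y r1] bounded_path_nonneg[OF x] by (intro mult_left_mono) auto
    finally have "?k r * \<bar>(primitive x r)\<^sup>2 - (primitive y r)\<^sup>2\<bar> \<le> c" unfolding c_def
      using bounded_pathD[OF kernel_bounded_path[OF s], of r] r1 K_nonneg K_bound_nonneg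
      by (intro mult_mono) auto
    then show ?thesis by (simp add: abs_mult K_nonneg flip: right_diff_distrib)
  qed
  then have "\<bar>integral {0..s} (\<lambda>r. ?k r * (primitive x r)\<^sup>2 - ?k r * (primitive y r)\<^sup>2)\<bar> \<le> c * (s - 0)"
    using s by (intro bounded_path_integral_bound[OF bounded_path_diff[OF b]]) auto
  moreover have "integral {0..s} (\<lambda>r. ?k r * (primitive x r)\<^sup>2 - ?k r * (primitive y r)\<^sup>2) = numerator x s - numerator y s"
    unfolding numerator_def using s by (intro bounded_path_integral_diff[OF b]) auto
  moreover have "c * s \<le> c" unfolding c_def
    using s K_bound_nonneg bounded_path_nonneg[OF x] L1_dist_nonneg[OF x y] by (intro mult_left_le) auto
  ultimately have "\<bar>numerator x s - numerator y s\<bar> \<le> c" by simp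
  then show ?thesis by (simp add: c_def mult.assoc)
qed

lemma numerator_lipschitz:
  assumes x: "bounded_path R x" and uv: "0 \<le> u" "u \<le> v" "v \<le> 1"
  shows "\<bar>numerator x v - numerator x u\<bar> \<le> (L * \<zeta> + K_bound) * R\<^sup>2 * (v - u)"
proof -
  let ?f = "\<lambda>s r. K (\<zeta> * (r - s)) * (primitive x r)\<^sup>2"
  have uv': "u \<in> {0..1}" "v \<in> {0..1}" using uv by auto
  note b = integrand_bounded_path[OF uv'(2) x] integrand_bounded_path[OF uv'(1) x]
  have "\<bar>?f v r - ?f u r\<bar> \<le> L * \<zeta> * (v - u) * R\<^sup>2" if r: "r \<in> {0..u}" for r
  proof -
    have r1: "r \<in> {0..1}" using r uv by auto
    have "\<bar>K (\<zeta> * (r - v)) - K (\<zeta> * (r - u))\<bar> \<le> L * \<zeta> * (v - u)"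
      using K_lipschitz[of "\<zeta> * (r - v)" "\<zeta> * (r - u)"] uv \<zeta>
      by (simp add: abs_mult mult.assoc flip: right_diff_distrib)
    moreover have "(primitive x r)\<^sup>2 \<le> R\<^sup>2"
      using bounded_pathD[OF bounded_path_power2[OF primitive_bounded_path[OF x]] r1] by simp
    ultimately have "\<bar>K (\<zeta> * (r - v)) - K (\<zeta> * (r - u))\<bar> * (primitive x r)\<^sup>2 \<le> L * \<zeta> * (v - u) * R\<^sup>2"
      using L_nonneg \<zeta> uv by (intro mult_mono) auto
    then show ?thesis by (simp add: abs_mult flip: left_diff_distrib)
  qed
  then have "\<bar>integral {0..u} (\<lambda>r. ?f v r - ?f u r)\<bar> \<le> L * \<zeta> * (v - u) * R\<^sup>2 * (u - 0)"
    using uv by (intro bounded_path_integral_bound[OF bounded_path_diff[OF b]]) auto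
  also have "\<dots> \<le> L * \<zeta> * (v - u) * R\<^sup>2"
    using uv L_nonneg \<zeta> by (simp add: mult_left_le)
  finally have 1: "\<bar>integral {0..u} (\<lambda>r. ?f v r - ?f u r)\<bar> \<le> L * \<zeta> * (v - u) * R\<^sup>2" .
  have 2: "\<bar>integral {u..v} (?f v)\<bar> \<le> K_bound * R\<^sup>2 * (v - u)"
    using uv by (intro bounded_path_integral_bound[OF b(1)] bounded_pathD[OF b(1)]) auto
  have "numerator x v - numerator x u = integral {0..u} (\<lambda>r. ?f v r - ?f u r) + integral {u..v} (?f v)"
    unfolding numerator_def bounded_path_integral_split[OF b(1) uv]
    using bounded_path_integral_diff[OF b, of 0 u] uv by simp
  then show ?thesis using 1 2 by (simp add: algebra_simps)
qed

lemma numerator_continuous: "bounded_path R x \<Longrightarrow> continuous_on {0..1} (numerator x)"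
  by (rule lipschitz_imp_continuous_on_real[OF numerator_lipschitz])
    (use L_nonneg \<zeta> K_bound_nonneg in auto)

lemma scaled_numerator_continuous:
  assumes "bounded_path R x"
  shows "continuous_on {\<kappa>..1} (\<lambda>s. \<zeta> / s * numerator x s)"
proof -
  have "continuous_on {\<kappa>..1} (numerator x)"
    by (rule continuous_on_subset[OF numerator_continuous[OF assms]]) (use \<kappa> in auto)
  then show ?thesis using \<kappa> by (intro continuous_intros) auto
qed

lemma energy_continuous_after_start: "bounded_path R x \<Longrightarrow> continuous_on {\<kappa>..1} (energy x)"
  by (rule continuous_on_subset[OF energy_continuous]) (use \<kappa> in auto)

lemma truncated_ratio_continuous:
  assumes "bounded_path R x" "0 < \<delta>"
  shows "continuous_on {\<kappa>..1} (truncated_ratio \<delta> x)"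
  unfolding truncated_ratio_def
  by (intro continuous_on_divide continuous_on_max continuous_on_const scaled_numerator_continuous[OF assms(1)]
      energy_continuous_after_start[OF assms(1)]) (use assms(2) in auto)

lemma truncated_ratio_diff:
  assumes x: "bounded_path R x" and y: "bounded_path R y" and \<delta>: "0 < \<delta>" and s: "s \<in> {\<kappa>..1}"
  shows "\<bar>truncated_ratio \<delta> x s - truncated_ratio \<delta> y s\<bar>
    \<le> (\<zeta> / \<kappa> / \<delta> * (K_bound * (2 * R)) + \<zeta> / \<kappa> * (K_bound * R\<^sup>2) / \<delta>\<^sup>2 * (2 * R)) * L1_dist x y"
proof -
  have s1: "s \<in> {0..1}" "0 < s" using s \<kappa> by auto
  have "\<bar>\<zeta> / s\<bar> \<le> \<zeta> / \<kappa>" using \<zeta> \<kappa> s by (simp add: frac_le)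
  then have "\<bar>truncated_ratio \<delta> x s - truncated_ratio \<delta> y s\<bar>
    \<le> K_bound * R\<^sup>2 / \<delta> * \<bar>\<zeta> / s - \<zeta> / s\<bar> + \<zeta> / \<kappa> / \<delta> * \<bar>numerator x s - numerator y s\<bar>
      + \<zeta> / \<kappa> * (K_bound * R\<^sup>2) / \<delta>\<^sup>2 * \<bar>max \<delta> (energy x s) - max \<delta> (energy y s)\<bar>"
    unfolding truncated_ratio_def
    by (intro ratio_diff_le numerator_bound[OF x] numerator_bound[OF y] \<delta> s1) auto
  also have "\<dots> \<le> 0 + \<zeta> / \<kappa> / \<delta> * (K_bound * (2 * R) * L1_dist x y)
      + \<zeta> / \<kappa> * (K_bound * R\<^sup>2) / \<delta>\<^sup>2 * (2 * R * L1_dist x y)"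
  proof (intro add_mono mult_left_mono numerator_diff[OF x y s1(1)])
    have "\<bar>max \<delta> (energy x s) - max \<delta> (energy y s)\<bar> \<le> \<bar>energy x s - energy y s\<bar>" by linarith
    also have "\<dots> \<le> 2 * R * L1_dist x y" using s1 by (intro energy_diff[OF x y]) auto
    finally show "\<bar>max \<delta> (energy x s) - max \<delta> (energy y s)\<bar> \<le> 2 * R * L1_dist x y" .
  qed (use \<delta> \<zeta> \<kappa> K_bound_nonneg in auto)
  finally show ?thesis by (simp add: algebra_simps)
qed

text \<open>The primitive vanishes up to time $s$; after that its square is at most $u - s$ times the energy, by
  the Cauchy-Schwarz inequality.\<close>

lemma numerator_le_energy:
  assumes x: "bounded_path R x" and s: "0 \<le> s" "s \<le> u" "u \<le> 1" and zero: "energy x s = 0"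
  shows "numerator x u \<le> K_bound * (u - s) * energy x u"
proof -
  have u: "u \<in> {0..1}" using s by auto
  note b = integrand_bounded_path[OF u x]
  have p: "(primitive x r)\<^sup>2 \<le> (u - s) * energy x u" if r: "0 \<le> r" "r \<le> u" for r
  proof -
    have init: "(primitive x q)\<^sup>2 \<le> 0" if "0 \<le> q" "q \<le> s" for q
    proof -
      have "energy x q \<le> 0" using energy_mono[OF x, of q s] that s zero by simp
      then have "energy x q = 0" using energy_nonneg[of x q] by simp
      then show ?thesis
        using primitive_increment_power2_le[OF x, of 0 q] that s by (simp add: primitive_zero energy_def)
    qed
    show ?thesis
    proof (cases "r \<le> s")
      case True
      have "0 \<le> (u - s) * energy x u" using s energy_nonneg by simp
      then show ?thesis using init[OF r(1) True] by linarith
    next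
      case False
      have "primitive x s = 0" using init[of s] s by simp
      then have "(primitive x r)\<^sup>2 \<le> (r - s) * energy x r"
        using primitive_increment_power2_le[OF x, of s r] False r s zero by simp
      also have "\<dots> \<le> (u - s) * energy x u"
        using energy_mono[OF x, of r u] energy_nonneg False r s by (intro mult_mono) auto
      finally show ?thesis .
    qed
  qed
  have "\<bar>K (\<zeta> * (r - u)) * (primitive x r)\<^sup>2\<bar> \<le> K_bound * ((u - s) * energy x u)" if r: "r \<in> {0..u}" for r
  proof -
    have "K (\<zeta> * (r - u)) \<le> K_bound"
      using bounded_pathD[OF kernel_bounded_path[OF u], of r] r s by auto
    moreover have "(primitive x r)\<^sup>2 \<le> (u - s) * energy x u" using p[of r] r by simp
    ultimately have "K (\<zeta> * (r - u)) * (primitive x r)\<^sup>2 \<le> K_bound * ((u - s) * energy x u)"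
      using K_bound_nonneg by (intro mult_mono) simp_all
    moreover have "0 \<le> K (\<zeta> * (r - u)) * (primitive x r)\<^sup>2" using K_nonneg by simp
    ultimately show ?thesis by linarith
  qed
  then have "\<bar>numerator x u\<bar> \<le> K_bound * ((u - s) * energy x u) * (u - 0)" unfolding numerator_def
    using s by (intro bounded_path_integral_bound[OF b]) auto
  also have "\<dots> \<le> K_bound * ((u - s) * energy x u)"
  proof (intro mult_left_le mult_nonneg_nonneg)
    show "0 \<le> u - s" "u - 0 \<le> 1" using s by simp_all
  qed (rule K_bound_nonneg energy_nonneg)+
  finally show ?thesis by (simp add: mult.assoc)
qed

text \<open>At a time $s$ of zero energy the quotient has the value 0 because division by zero gives 0. To the
  left of $s$ the energy vanishes as well, and to the right \<open>numerator_le_energy\<close> bounds the quotient by a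
  multiple of the distance from $s$.\<close>

lemma ratio_continuous:
  assumes x: "bounded_path R x"
  shows "continuous_on {\<kappa>..1} (ratio x)"
  unfolding continuous_on_eq_continuous_within
proof
  fix s assume s: "s \<in> {\<kappa>..1}"
  have num: "continuous (at s within {\<kappa>..1}) (\<lambda>s. \<zeta> / s * numerator x s)"
    using scaled_numerator_continuous[OF x] s by (simp add: continuous_on_eq_continuous_within)
  have en: "continuous (at s within {\<kappa>..1}) (energy x)"
    using energy_continuous_after_start[OF x] s by (simp add: continuous_on_eq_continuous_within)
  show "continuous (at s within {\<kappa>..1}) (ratio x)"
  proof (cases "energy x s = 0")
    case False
    then have "continuous (at s within {\<kappa>..1}) (\<lambda>s. \<zeta> / s * numerator x s / energy x s)"
      by (intro continuous_at_within_divide num en)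
    then show ?thesis by (simp add: ratio_def[abs_def])
  next
    case True
    have bound: "norm (ratio x u) \<le> \<zeta> / \<kappa> * K_bound * \<bar>u - s\<bar>" if u: "u \<in> {\<kappa>..1}" for u
    proof (cases "energy x u = 0")
      case True
      then show ?thesis using \<zeta> \<kappa> K_bound_nonneg by (simp add: ratio_def)
    next
      case False
      then have e: "0 < energy x u" using energy_nonneg[of x u] by simp
      have su: "s \<le> u"
      proof (rule ccontr)
        assume "\<not> s \<le> u"
        then have "energy x u \<le> energy x s" using u s \<kappa> by (intro energy_mono[OF x]) auto
        then show False using e True by simp
      qed
      have "numerator x u \<le> K_bound * (u - s) * energy x u"
        using u s \<kappa> su True by (intro numerator_le_energy[OF x]) auto
      then have "numerator x u / energy x u \<le> K_bound * (u - s)" using e by (simp add: field_simps)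
      moreover have "0 \<le> numerator x u / energy x u"
        using numerator_nonneg[OF x, of u] u \<kappa> e by simp
      moreover have "\<zeta> / u \<le> \<zeta> / \<kappa>" using u \<zeta> \<kappa> by (simp add: frac_le)
      ultimately have "\<zeta> / u * (numerator x u / energy x u) \<le> \<zeta> / \<kappa> * (K_bound * (u - s))"
        using \<zeta> \<kappa> by (intro mult_mono) auto
      moreover have "0 \<le> \<zeta> / u * (numerator x u / energy x u)"
        using \<open>0 \<le> numerator x u / energy x u\<close> \<zeta> \<kappa> u by (intro mult_nonneg_nonneg) auto
      ultimately show ?thesis using su by (simp add: ratio_def mult.assoc)
    qed
    have "((\<lambda>u. \<zeta> / \<kappa> * K_bound * \<bar>u - s\<bar>) \<longlongrightarrow> \<zeta> / \<kappa> * K_bound * \<bar>s - s\<bar>) (at s within {\<kappa>..1})"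
      by (intro tendsto_intros)
    then have lim: "((\<lambda>u. \<zeta> / \<kappa> * K_bound * \<bar>u - s\<bar>) \<longlongrightarrow> 0) (at s within {\<kappa>..1})" by simp
    have "eventually (\<lambda>u. norm (ratio x u) \<le> \<zeta> / \<kappa> * K_bound * \<bar>u - s\<bar>) (at s within {\<kappa>..1})"
      unfolding eventually_at_filter by (intro always_eventually) (use bound in blast)
    then have "(ratio x \<longlongrightarrow> 0) (at s within {\<kappa>..1})" using lim by (rule Lim_null_comparison)
    then show ?thesis using True by (simp add: continuous_within ratio_def)
  qed
qed

definition truncated_path :: "real \<Rightarrow> (real \<Rightarrow> real) \<Rightarrow> real \<Rightarrow> real" where
  "truncated_path \<delta> x = (\<lambda>s\<in>{\<kappa>..1}. truncated_ratio \<delta> x s)"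

definition ratio_path :: "(real \<Rightarrow> real) \<Rightarrow> real \<Rightarrow> real" where
  "ratio_path x = (\<lambda>s\<in>{\<kappa>..1}. ratio x s)"

lemma truncated_path_cadlag:
  assumes "x \<in> cadlag_space 0 1" "0 < \<delta>"
  shows "truncated_path \<delta> x \<in> cadlag_space \<kappa> 1"
  unfolding truncated_path_def using cadlag_imp_bounded_path[OF assms(1)]
  by (metis continuous_restrict_cadlag truncated_ratio_continuous[OF _ assms(2)])

lemma ratio_path_cadlag:
  assumes "x \<in> cadlag_space 0 1"
  shows "ratio_path x \<in> cadlag_space \<kappa> 1"
  unfolding ratio_path_def using cadlag_imp_bounded_path[OF assms]
  by (metis continuous_restrict_cadlag ratio_continuous)

lemma L1_dist_tendsto:
  assumes x: "x \<in> cadlag_space 0 1" and X: "\<And>n. X n \<in> cadlag_space 0 1"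
    and lim: "(\<lambda>n. skorohod_dist 0 1 x (X n)) \<longlonglongrightarrow> 0"
  shows "(\<lambda>n. L1_dist x (X n)) \<longlonglongrightarrow> 0"
  using skorohod_convergence_imp_L1[OF assms] unfolding L1_dist_def by (simp add: abs_minus_commute)

lemma truncated_path_tendsto:
  assumes x: "x \<in> cadlag_space 0 1" and X: "\<And>n. X n \<in> cadlag_space 0 1"
    and lim: "(\<lambda>n. skorohod_dist 0 1 x (X n)) \<longlonglongrightarrow> 0" and \<delta>: "0 < \<delta>"
  shows "(\<lambda>n. skorohod_dist \<kappa> 1 (truncated_path \<delta> x) (truncated_path \<delta> (X n))) \<longlonglongrightarrow> 0"
proof -
  interpret k: Metric_space "cadlag_space \<kappa> 1" "skorohod_dist \<kappa> 1" by (rule Metric_space_skorohod)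
  obtain R where bp: "bounded_path R x" "\<And>n. bounded_path R (X n)"
    using skorohod_convergent_imp_bounded_path[OF x X lim] by blast
  define C where "C = \<zeta> / \<kappa> / \<delta> * (K_bound * (2 * R)) + \<zeta> / \<kappa> * (K_bound * R\<^sup>2) / \<delta>\<^sup>2 * (2 * R)"
  have "0 \<le> C" using \<zeta> \<kappa> \<delta> K_bound_nonneg bounded_path_nonneg[OF bp(1)] by (simp add: C_def)
  have "skorohod_dist \<kappa> 1 (truncated_path \<delta> x) (truncated_path \<delta> (X n)) \<le> C * L1_dist x (X n)" for n
  proof (rule skorohod_dist_le)
    show "0 \<le> C * L1_dist x (X n)" using \<open>0 \<le> C\<close> L1_dist_nonneg[OF bp(1) bp(2)] by simp
    show "\<bar>truncated_path \<delta> x t - truncated_path \<delta> (X n) t\<bar> \<le> C * L1_dist x (X n)" if "t \<in> {\<kappa>..1}" for t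
      using truncated_ratio_diff[OF bp(1) bp(2) \<delta> that] that by (simp add: truncated_path_def C_def)
  qed (intro truncated_path_cadlag x X \<delta>)+
  moreover have "0 \<le> skorohod_dist \<kappa> 1 (truncated_path \<delta> x) (truncated_path \<delta> (X n))" for n
    by (rule k.nonneg)
  ultimately show ?thesis
    by (intro Lim_null_comparison[OF always_eventually[OF allI]
          tendsto_mult_right_zero[OF L1_dist_tendsto[OF x X lim], of C]]) simp
qed

lemma truncated_path_continuous_functional:
  assumes F: "continuous_map (skorohod_topology \<kappa> 1) euclideanreal F" and \<delta>: "0 < \<delta>"
  shows "continuous_map (skorohod_topology 0 1) euclideanreal (\<lambda>x. F (truncated_path \<delta> x))"
  unfolding skorohod_topology_def
proof (rule Metric_space.continuous_map_real_seqI[OF Metric_space_skorohod])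
  fix x X assume x: "x \<in> cadlag_space 0 1" and X: "\<And>n. X n \<in> cadlag_space 0 1"
    and lim: "(\<lambda>n. skorohod_dist 0 1 x (X n)) \<longlonglongrightarrow> 0"
  show "(\<lambda>n. F (truncated_path \<delta> (X n))) \<longlonglongrightarrow> F (truncated_path \<delta> x)"
    by (rule Metric_space.continuous_map_real_seqD[OF Metric_space_skorohod F[unfolded skorohod_topology_def]])
      (intro truncated_path_cadlag truncated_path_tendsto x X lim \<delta>)+
qed

lemma energy_continuous_functional:
  assumes s: "s \<in> {0..1}"
  shows "continuous_map (skorohod_topology 0 1) euclideanreal (\<lambda>x. energy x s)"
  unfolding skorohod_topology_def
proof (rule Metric_space.continuous_map_real_seqI[OF Metric_space_skorohod])
  fix x X assume x: "x \<in> cadlag_space 0 1" and X: "\<And>n. X n \<in> cadlag_space 0 1"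
    and lim: "(\<lambda>n. skorohod_dist 0 1 x (X n)) \<longlonglongrightarrow> 0"
  obtain R where bp: "bounded_path R x" "\<And>n. bounded_path R (X n)"
    using skorohod_convergent_imp_bounded_path[OF x X lim] by blast
  have "\<bar>energy (X n) s - energy x s\<bar> \<le> 2 * R * L1_dist x (X n)" for n
    using energy_diff[OF bp(1) bp(2)] s by (simp add: abs_minus_commute)
  then have "(\<lambda>n. energy (X n) s - energy x s) \<longlonglongrightarrow> 0"
    by (intro Lim_null_comparison[OF always_eventually[OF allI]
          tendsto_mult_right_zero[OF L1_dist_tendsto[OF x X lim], of "2 * R"]]) simp
  then show "(\<lambda>n. energy (X n) s) \<longlonglongrightarrow> energy x s" by (simp add: LIM_zero_iff)
qed

lemma numerator_continuous_functional:
  assumes s: "s \<in> {0..1}"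
  shows "continuous_map (skorohod_topology 0 1) euclideanreal (\<lambda>x. numerator x s)"
  unfolding skorohod_topology_def
proof (rule Metric_space.continuous_map_real_seqI[OF Metric_space_skorohod])
  fix x X assume x: "x \<in> cadlag_space 0 1" and X: "\<And>n. X n \<in> cadlag_space 0 1"
    and lim: "(\<lambda>n. skorohod_dist 0 1 x (X n)) \<longlonglongrightarrow> 0"
  obtain R where bp: "bounded_path R x" "\<And>n. bounded_path R (X n)"
    using skorohod_convergent_imp_bounded_path[OF x X lim] by blast
  have "\<bar>numerator (X n) s - numerator x s\<bar> \<le> K_bound * (2 * R) * L1_dist x (X n)" for n
    using numerator_diff[OF bp(1) bp(2) s] by (simp add: abs_minus_commute)
  then have "(\<lambda>n. numerator (X n) s - numerator x s) \<longlonglongrightarrow> 0"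
    by (intro Lim_null_comparison[OF always_eventually[OF allI]
          tendsto_mult_right_zero[OF L1_dist_tendsto[OF x X lim], of "K_bound * (2 * R)"]]) simp
  then show "(\<lambda>n. numerator (X n) s) \<longlonglongrightarrow> numerator x s" by (simp add: LIM_zero_iff)
qed

text \<open>A continuous substitute for the indicator of the bad event that the path exceeds $m + 1$ or has energy
  below $1/m$ at time $\kappa$. The distance to the zero path serves as the supremum norm.\<close>

definition degeneracy :: "nat \<Rightarrow> (real \<Rightarrow> real) \<Rightarrow> real" where
  "degeneracy m x = min 1 (max 0 (skorohod_dist 0 1 x (\<lambda>t\<in>{0..1}. 0) - real m))
     + min 1 (max 0 (2 - real m * energy x \<kappa>))"

lemma degeneracy_bounds: "0 \<le> degeneracy m x" "degeneracy m x \<le> 2"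
  unfolding degeneracy_def by linarith+

text \<open>Both summands of the degeneracy are then below 1. For the first one this bounds the distance to the
  zero path, which dominates the path.\<close>

lemma degeneracy_less_1:
  assumes x: "x \<in> cadlag_space 0 1" and less: "degeneracy m x < 1"
  shows "bounded_path (real m + 1) x" "1 < real m * energy x \<kappa>"
proof -
  have d: "skorohod_dist 0 1 x (\<lambda>t\<in>{0..1}. 0) \<le> real m + 1" "1 < real m * energy x \<kappa>"
    using less unfolding degeneracy_def by linarith+
  show "bounded_path (real m + 1) x"
    by (rule cadlag_bounded_path[OF x order_trans[OF abs_le_skorohod_dist_zero[OF x] d(1)]])
  show "1 < real m * energy x \<kappa>" by (rule d(2))
qed

lemma degeneracy_continuous: "continuous_map (skorohod_topology 0 1) euclideanreal (degeneracy m)"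
proof -
  interpret Metric_space "cadlag_space 0 1" "skorohod_dist 0 1" by (rule Metric_space_skorohod)
  have "continuous_map mtopology euclideanreal (\<lambda>x. skorohod_dist 0 1 x (\<lambda>t\<in>{0..1}. 0))"
  proof (rule continuous_map_real_lipschitz[where k=1])
    fix x y assume xy: "x \<in> cadlag_space 0 1" "y \<in> cadlag_space 0 1"
    show "\<bar>skorohod_dist 0 1 x (\<lambda>t\<in>{0..1}. 0) - skorohod_dist 0 1 y (\<lambda>t\<in>{0..1}. 0)\<bar> \<le> 1 * skorohod_dist 0 1 x y"
      using triangle[OF xy restrict_const_cadlag, of 0] triangle[OF xy(2,1) restrict_const_cadlag, of 0]
      by (simp add: commute abs_le_iff)
  qed
  moreover have "continuous_map mtopology euclideanreal (\<lambda>x. energy x \<kappa>)"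
    using energy_continuous_functional[of \<kappa>] \<kappa> by (simp add: skorohod_topology_def)
  ultimately show ?thesis unfolding skorohod_topology_def degeneracy_def[abs_def]
    by (intro continuous_map_add continuous_map_real_min continuous_map_real_max continuous_map_diff
        continuous_map_real_mult continuous_map_canonical_const)
qed

lemma degeneracy_tendsto_0:
  assumes x: "x \<in> cadlag_space 0 1" and pos: "0 < energy x \<kappa>"
  shows "(\<lambda>m. degeneracy m x) \<longlonglongrightarrow> 0"
proof (rule tendsto_eventually)
  have "eventually (\<lambda>m. skorohod_dist 0 1 x (\<lambda>t\<in>{0..1}. 0) \<le> real m) sequentially"
    using filterlim_real_sequentially unfolding filterlim_at_top by blast
  moreover have "eventually (\<lambda>m. 2 / energy x \<kappa> \<le> real m) sequentially"
    using filterlim_real_sequentially unfolding filterlim_at_top by blast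
  ultimately show "eventually (\<lambda>m. degeneracy m x = 0) sequentially"
    by eventually_elim (use pos in \<open>simp add: degeneracy_def field_simps\<close>)
qed

lemma truncated_path_eq_ratio_path:
  assumes x: "bounded_path R x" and \<delta>: "\<delta> \<le> energy x \<kappa>"
  shows "truncated_path \<delta> x = ratio_path x"
proof
  fix s
  show "truncated_path \<delta> x s = ratio_path x s"
  proof (cases "s \<in> {\<kappa>..1}")
    case True
    then have "\<delta> \<le> energy x s" using \<delta> energy_mono[OF x, of \<kappa> s] \<kappa> by auto
    then show ?thesis using True
      by (simp add: truncated_path_def ratio_path_def truncated_ratio_def ratio_def max_def)
  qed (auto simp: truncated_path_def ratio_path_def)
qed

end

section \<open>Riemann sums\<close>

lemma nat_floor_grid:
  assumes N: "1 \<le> N" and r: "0 \<le> r"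
  shows "real (nat \<lfloor>real N * r\<rfloor>) / real N \<le> r" "r < (real (nat \<lfloor>real N * r\<rfloor>) + 1) / real N"
proof -
  have k: "0 < real N" using N by simp
  have "0 \<le> real N * r" using r by simp
  then have "real (nat \<lfloor>real N * r\<rfloor>) \<le> real N * r" "real N * r < real (nat \<lfloor>real N * r\<rfloor>) + 1"
    by linarith+
  then show "real (nat \<lfloor>real N * r\<rfloor>) / real N \<le> r" "r < (real (nat \<lfloor>real N * r\<rfloor>) + 1) / real N"
    unfolding pos_divide_le_eq[OF k] pos_less_divide_eq[OF k] by (simp_all add: mult.commute)
qed

lemma nat_floor_le:
  assumes "s \<le> 1"
  shows "nat \<lfloor>real N * s\<rfloor> \<le> N"
proof -
  have "real N * s \<le> real N" using assms by (simp add: mult_left_le)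
  then show ?thesis by linarith
qed

lemma step_function_integral:
  fixes c :: "nat \<Rightarrow> real"
  assumes N: "1 \<le> N" and s: "0 \<le> s"
  defines "n \<equiv> nat \<lfloor>real N * s\<rfloor>"
  shows "((\<lambda>r. c (nat \<lfloor>real N * r\<rfloor>)) has_integral
    (\<Sum>i<n. c i) / real N + (s - real n / real N) * c n) {0..s}"
proof -
  let ?g = "\<lambda>r. c (nat \<lfloor>real N * r\<rfloor>) :: real"
  have k: "0 < real N" using N by simp
  have piece: "(?g has_integral (b - real i / real N) * c i) {real i / real N..b}"
    if b: "real i / real N \<le> b" "b \<le> (real i + 1) / real N" for i b
    \<comment> \<open>At the right endpoint of a cell the step function has already jumped.\<close>
  proof (rule has_integral_spike_finite[where S="{b}" and f="\<lambda>_. c i"])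
    show "?g r = c i" if r: "r \<in> {real i / real N..b} - {b}" for r
    proof -
      have "real i / real N \<le> r" "r < (real i + 1) / real N" using r b by auto
      then have "real i \<le> real N * r" "real N * r < real i + 1"
        unfolding pos_divide_le_eq[OF k] pos_less_divide_eq[OF k] by (simp_all add: mult.commute)
      then have "\<lfloor>real N * r\<rfloor> = int i" by (intro floor_unique) simp_all
      then show ?thesis by simp
    qed
    show "((\<lambda>_. c i) has_integral (b - real i / real N) * c i) {real i / real N..b}"
      using has_integral_const_real[of "c i" "real i / real N" b] b by simp
  qed simp
  have "(?g has_integral (\<Sum>i<m. c i) / real N) {0..real m / real N}" for m
  proof (induction m)
    case (Suc m)
    have "(?g has_integral ((real m + 1) / real N - real m / real N) * c m) {real m / real N..(real m + 1) / real N}"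
      by (rule piece) (simp_all add: divide_right_mono)
    then have "(?g has_integral c m / real N) {real m / real N..real (Suc m) / real N}"
      by (simp add: add_divide_distrib add.commute)
    from has_integral_combine[OF _ _ Suc this] show ?case
      by (simp add: divide_right_mono add_divide_distrib add.commute)
  qed (simp add: has_integral_refl)
  moreover have "(?g has_integral (s - real n / real N) * c n) {real n / real N..s}"
    using nat_floor_grid[OF N s] unfolding n_def by (intro piece) simp_all
  ultimately show ?thesis
    using nat_floor_grid(1)[OF N s] unfolding n_def by (intro has_integral_combine[of 0 _ s]) simp_all
qed

lemma step_function_bounded_path:
  fixes c :: "nat \<Rightarrow> real"
  assumes "\<And>i. i \<le> N \<Longrightarrow> \<bar>c i\<bar> \<le> C"
  shows "bounded_path C (\<lambda>r. c (nat \<lfloor>real N * r\<rfloor>))"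
proof -
  have "(\<lambda>k :: int. c (nat k)) \<circ> (\<lambda>r. \<lfloor>real N * r\<rfloor>) \<in> borel_measurable borel"
    by (rule measurable_comp[of _ _ "count_space UNIV"]) auto
  then have "(\<lambda>r. c (nat \<lfloor>real N * r\<rfloor>)) \<in> borel_measurable borel" by (simp add: comp_def)
  then have "set_borel_measurable borel {0..1} (\<lambda>r. c (nat \<lfloor>real N * r\<rfloor>))"
    unfolding set_borel_measurable_def by measurable
  then show ?thesis unfolding bounded_path_def using assms nat_floor_le by simp
qed

text \<open>The sum runs over $1, \dots, n$, whereas the integral of the step function collects the entries
  $0, \dots, n-1$ and a part of entry $n$. Entry $0$, entry $n$ and this part account for $3C/N$.\<close>

lemma riemann_sum_error:
  fixes c :: "nat \<Rightarrow> real"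
  assumes f: "bounded_path C f" and N: "1 \<le> N" and s: "s \<in> {0..1}"
    and c: "\<And>i. i \<le> N \<Longrightarrow> \<bar>c i\<bar> \<le> C"
    and close: "\<And>r. r \<in> {0..1} \<Longrightarrow> \<bar>f r - c (nat \<lfloor>real N * r\<rfloor>)\<bar> \<le> \<eta>"
  defines "n \<equiv> nat \<lfloor>real N * s\<rfloor>"
  shows "\<bar>integral {0..s} f - (\<Sum>i=1..n. c i) / real N\<bar> \<le> \<eta> + 3 * C / real N"
proof -
  let ?g = "\<lambda>r. c (nat \<lfloor>real N * r\<rfloor>)"
  have g: "bounded_path C ?g" by (rule step_function_bounded_path[OF c])
  have s': "0 \<le> s" "s \<le> 1" using s by auto
  have nN: "n \<le> N" unfolding n_def by (rule nat_floor_le[OF s'(2)])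
  have "0 \<le> \<eta>" using close[of 0] by force
  have "\<bar>integral {0..s} f - integral {0..s} ?g\<bar> = \<bar>integral {0..s} (\<lambda>r. f r - ?g r)\<bar>"
    using bounded_path_integral_diff[OF f g, of 0 s] s' by simp
  also have "\<dots> \<le> \<eta> * (s - 0)"
    using s' by (intro bounded_path_integral_bound[OF bounded_path_diff[OF f g]] close) simp_all
  also have "\<dots> \<le> \<eta>" using s' \<open>0 \<le> \<eta>\<close> by (simp add: mult_left_le)
  finally have 1: "\<bar>integral {0..s} f - integral {0..s} ?g\<bar> \<le> \<eta>" .
  have "(\<Sum>i<k. c i) + c k = c 0 + (\<Sum>i=1..k. c i)" for k :: nat
    by (induction k) simp_all
  from this[of n] have sums: "(\<Sum>i<n. c i) = c 0 + (\<Sum>i=1..n. c i) - c n" by simp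
  have "integral {0..s} ?g = (\<Sum>i<n. c i) / real N + (s - real n / real N) * c n"
    unfolding n_def by (rule integral_unique[OF step_function_integral[OF N s'(1)]])
  then have "integral {0..s} ?g - (\<Sum>i=1..n. c i) / real N
      = c 0 / real N - c n / real N + (s - real n / real N) * c n"
    unfolding sums by (simp add: add_divide_distrib diff_divide_distrib)
  also have "\<bar>\<dots>\<bar> \<le> C / real N + C / real N + 1 / real N * C"
  proof -
    have "\<bar>c 0 / real N\<bar> \<le> C / real N" "\<bar>c n / real N\<bar> \<le> C / real N"
      using c[of 0] c[OF nN] by (simp_all add: divide_right_mono)
    moreover have "\<bar>(s - real n / real N) * c n\<bar> \<le> 1 / real N * C"
      unfolding abs_mult
    proof (rule mult_mono)
      show "\<bar>s - real n / real N\<bar> \<le> 1 / real N"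
        using nat_floor_grid[OF N s'(1)] by (simp add: n_def add_divide_distrib)
    qed (use c[OF nN] in auto)
    ultimately show ?thesis by linarith
  qed
  finally show ?thesis using 1 by simp
qed

context variance_ratio_functional
begin

text \<open>The variance ratio of $n$ observations, rewritten in terms of the normalised observations
  $c_j = Y_j / \sqrt N$; here $q$ stands for $N / h$.\<close>

definition discrete_ratio :: "nat \<Rightarrow> real \<Rightarrow> (nat \<Rightarrow> real) \<Rightarrow> nat \<Rightarrow> real" where
  "discrete_ratio N q c n = real N / real n * q *
     ((\<Sum>i=1..n. K (q * (real i - real n) / real N) * ((\<Sum>j=1..i. c j) / real N)\<^sup>2) / real N)
     / ((\<Sum>j=1..n. (c j)\<^sup>2) / real N)"

text \<open>The three summands are the contributions of the prefactor $(N/n) q$, of the numerator and of the energy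
  to the bound \<open>ratio_diff_le\<close>.\<close>

definition discretization_error :: "real \<Rightarrow> real \<Rightarrow> nat \<Rightarrow> real \<Rightarrow> real" where
  "discretization_error R \<delta> N q =
     K_bound * R\<^sup>2 / \<delta> * (2 / \<kappa>\<^sup>2 * (\<bar>q - \<zeta>\<bar> + \<zeta> / real N))
   + \<zeta> / \<kappa> / \<delta> * (K_bound * (2 * R * (3 * R / real N)) + R\<^sup>2 * (L * (\<bar>q - \<zeta>\<bar> + Z / real N)) + 3 * (K_bound * R\<^sup>2) / real N)
   + \<zeta> / \<kappa> * (K_bound * R\<^sup>2) / \<delta>\<^sup>2 * (3 * R\<^sup>2 / real N)"

lemma discretization_error_tendsto_0:
  assumes "q \<longlonglongrightarrow> \<zeta>"
  shows "(\<lambda>N. discretization_error R \<delta> N (q N)) \<longlonglongrightarrow> 0"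
proof -
  have q: "(\<lambda>N. \<bar>q N - \<zeta>\<bar>) \<longlonglongrightarrow> 0" using assms by (simp add: LIM_zero_iff tendsto_rabs_zero_iff)
  have N: "(\<lambda>N. a / real N) \<longlonglongrightarrow> 0" for a by (rule lim_const_over_n)
  have "(\<lambda>N. discretization_error R \<delta> N (q N)) \<longlonglongrightarrow>
     K_bound * R\<^sup>2 / \<delta> * (2 / \<kappa>\<^sup>2 * (0 + 0))
   + \<zeta> / \<kappa> / \<delta> * (K_bound * (2 * R * 0) + R\<^sup>2 * (L * (0 + 0)) + 0)
   + \<zeta> / \<kappa> * (K_bound * R\<^sup>2) / \<delta>\<^sup>2 * 0"
    unfolding discretization_error_def by (intro tendsto_add tendsto_mult tendsto_const q N)
  then show ?thesis by simp
qed

lemma primitive_prefix_sum: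
  fixes c :: "nat \<Rightarrow> real"
  assumes x: "bounded_path R x" and N: "1 \<le> N" and r: "r \<in> {0..1}"
    and grid: "\<And>t. t \<in> {0..1} \<Longrightarrow> x t = c (nat \<lfloor>real N * t\<rfloor>)" and c: "\<And>i. i \<le> N \<Longrightarrow> \<bar>c i\<bar> \<le> R"
  shows "\<bar>primitive x r - (\<Sum>j=1..nat \<lfloor>real N * r\<rfloor>. c j) / real N\<bar> \<le> 3 * R / real N"
  using riemann_sum_error[where c=c and \<eta>=0, OF x N r c] grid by (simp add: primitive_def)

lemma prefix_sum_bound:
  fixes c :: "nat \<Rightarrow> real"
  assumes c: "\<And>i. i \<le> N \<Longrightarrow> \<bar>c i\<bar> \<le> R" and "0 \<le> R" "n \<le> N"
  shows "\<bar>(\<Sum>j=1..n. c j) / real N\<bar> \<le> R"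
proof (cases "N = 0")
  case False
  have "\<bar>\<Sum>j=1..n. c j\<bar> \<le> (\<Sum>j=1..n. R)"
    by (rule order_trans[OF sum_abs sum_mono]) (use c assms(3) in auto)
  also have "\<dots> \<le> real N * R" using assms(2,3) by (simp add: mult_right_mono)
  finally show ?thesis using False by (simp add: field_simps)
qed (use assms in simp)

text \<open>Three errors add up: the primitive is replaced by a prefix sum, the argument $\zeta(r - s)$ of the kernel
  by $q(i - n)/N$, and the integral by a Riemann sum.\<close>

lemma numerator_riemann_sum:
  fixes c :: "nat \<Rightarrow> real"
  assumes x: "bounded_path R x" and N: "1 \<le> N" and s: "s \<in> {0..1}" and q: "0 \<le> q" "q \<le> Z"
    and grid: "\<And>t. t \<in> {0..1} \<Longrightarrow> x t = c (nat \<lfloor>real N * t\<rfloor>)" and c: "\<And>i. i \<le> N \<Longrightarrow> \<bar>c i\<bar> \<le> R"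
  defines "n \<equiv> nat \<lfloor>real N * s\<rfloor>"
  defines "b \<equiv> \<lambda>i. K (q * (real i - real n) / real N) * ((\<Sum>j=1..i. c j) / real N)\<^sup>2"
  shows "\<bar>numerator x s - (\<Sum>i=1..n. b i) / real N\<bar>
     \<le> K_bound * (2 * R * (3 * R / real N)) + R\<^sup>2 * (L * (\<bar>q - \<zeta>\<bar> + Z / real N)) + 3 * (K_bound * R\<^sup>2) / real N"
    and "\<bar>(\<Sum>i=1..n. b i) / real N\<bar> \<le> K_bound * R\<^sup>2"
proof -
  have s': "0 \<le> s" "s \<le> 1" using s by auto
  have R: "0 \<le> R" by (rule bounded_path_nonneg[OF x])
  have nN: "n \<le> N" unfolding n_def by (rule nat_floor_le[OF s'(2)])
  let ?A = "\<lambda>i. (\<Sum>j=1..i. c j) / real N"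
  have A: "\<bar>?A i\<bar> \<le> R" if "i \<le> N" for i by (rule prefix_sum_bound[OF c R that])
  have arg: "\<bar>q * (real i - real n) / real N\<bar> \<le> Z" if i: "i \<le> N" for i
  proof -
    have "\<bar>q * (real i / real N - real n / real N)\<bar> \<le> Z"
      using q i nN N by (intro abs_scaled_time_le) auto
    then show ?thesis by (simp add: diff_divide_distrib right_diff_distrib)
  qed
  have bb: "\<bar>b i\<bar> \<le> K_bound * R\<^sup>2" if i: "i \<le> N" for i
  proof -
    have "(?A i)\<^sup>2 \<le> R\<^sup>2" using A[OF i] R by (simp add: abs_le_square_iff[symmetric])
    then have "b i \<le> K_bound * R\<^sup>2"
      unfolding b_def using K_le_K_bound[OF arg[OF i]] K_bound_nonneg by (intro mult_mono) auto
    moreover have "0 \<le> b i" unfolding b_def using K_nonneg by simp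
    ultimately show ?thesis by simp
  qed
  have KR: "0 \<le> K_bound * R\<^sup>2" using K_bound_nonneg by simp
  show "\<bar>(\<Sum>i=1..n. b i) / real N\<bar> \<le> K_bound * R\<^sup>2"
    by (rule prefix_sum_bound[OF bb KR nN])
  show "\<bar>numerator x s - (\<Sum>i=1..n. b i) / real N\<bar>
     \<le> K_bound * (2 * R * (3 * R / real N)) + R\<^sup>2 * (L * (\<bar>q - \<zeta>\<bar> + Z / real N)) + 3 * (K_bound * R\<^sup>2) / real N"
    unfolding numerator_def n_def
  proof (rule riemann_sum_error[OF integrand_bounded_path[OF s x] N s bb])
    fix r :: real assume r: "r \<in> {0..1}"
    define i where "i = nat \<lfloor>real N * r\<rfloor>"
    have iN: "i \<le> N" unfolding i_def using r by (intro nat_floor_le) simp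
    have P: "\<bar>primitive x r\<bar> \<le> R" using primitive_bound[OF x] r by simp
    have AP: "\<bar>primitive x r - ?A i\<bar> \<le> 3 * R / real N"
      unfolding i_def by (rule primitive_prefix_sum[OF x N r grid c])
    have "\<bar>(primitive x r)\<^sup>2 - (?A i)\<^sup>2\<bar> \<le> 2 * R * (3 * R / real N)"
      using abs_diff_power2_le[OF P A[OF iN]] mult_left_mono[OF AP, of "2 * R"] R by linarith
    then have 1: "K (q * (real i - real n) / real N) * \<bar>(primitive x r)\<^sup>2 - (?A i)\<^sup>2\<bar> \<le> K_bound * (2 * R * (3 * R / real N))"
      using K_le_K_bound[OF arg[OF iN]] K_bound_nonneg by (intro mult_mono) auto
    have "\<bar>\<zeta> * (r - s) - q * (real i - real n) / real N\<bar> \<le> \<bar>q - \<zeta>\<bar> + Z / real N"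
    proof -
      define u v where "u = r - real i / real N" and "v = s - real n / real N"
      have uv: "0 \<le> u" "u \<le> 1 / real N" "0 \<le> v" "v \<le> 1 / real N"
        using nat_floor_grid[OF N, of r] nat_floor_grid[OF N, of s] r s
        by (simp_all add: u_def v_def i_def n_def add_divide_distrib)
      have "\<zeta> * (r - s) - q * (real i - real n) / real N = (\<zeta> - q) * (r - s) + q * (u - v)"
        by (simp add: u_def v_def algebra_simps diff_divide_distrib)
      also have "\<bar>\<dots>\<bar> \<le> \<bar>(\<zeta> - q) * (r - s)\<bar> + \<bar>q * (u - v)\<bar>" by (rule abs_triangle_ineq)
      also have "\<dots> \<le> \<bar>q - \<zeta>\<bar> + Z * (1 / real N)"
      proof (rule add_mono)
        have "\<bar>r - s\<bar> \<le> 1" using r s by auto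
        then show "\<bar>(\<zeta> - q) * (r - s)\<bar> \<le> \<bar>q - \<zeta>\<bar>" by (simp add: abs_mult abs_minus_commute mult_left_le)
        have "\<bar>u - v\<bar> \<le> 1 / real N" using uv by linarith
        then show "\<bar>q * (u - v)\<bar> \<le> Z * (1 / real N)" unfolding abs_mult using q by (intro mult_mono) auto
      qed
      finally show ?thesis by simp
    qed
    from mult_left_mono[OF this L_nonneg] K_lipschitz[of "\<zeta> * (r - s)" "q * (real i - real n) / real N"]
    have "\<bar>K (\<zeta> * (r - s)) - K (q * (real i - real n) / real N)\<bar> \<le> L * (\<bar>q - \<zeta>\<bar> + Z / real N)" by linarith
    moreover have "(primitive x r)\<^sup>2 \<le> R\<^sup>2" using P R by (simp add: abs_le_square_iff[symmetric])
    ultimately have 2: "(primitive x r)\<^sup>2 * \<bar>K (\<zeta> * (r - s)) - K (q * (real i - real n) / real N)\<bar>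
        \<le> R\<^sup>2 * (L * (\<bar>q - \<zeta>\<bar> + Z / real N))"
      by (intro mult_mono) auto
    have "K (\<zeta> * (r - s)) * (primitive x r)\<^sup>2 - b i
        = K (q * (real i - real n) / real N) * ((primitive x r)\<^sup>2 - (?A i)\<^sup>2)
          + (primitive x r)\<^sup>2 * (K (\<zeta> * (r - s)) - K (q * (real i - real n) / real N))"
      unfolding b_def by (simp add: algebra_simps)
    also have "\<bar>\<dots>\<bar> \<le> K (q * (real i - real n) / real N) * \<bar>(primitive x r)\<^sup>2 - (?A i)\<^sup>2\<bar>
        + (primitive x r)\<^sup>2 * \<bar>K (\<zeta> * (r - s)) - K (q * (real i - real n) / real N)\<bar>"
      by (rule order_trans[OF abs_triangle_ineq]) (simp add: abs_mult K_nonneg)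
    finally show "\<bar>K (\<zeta> * (r - s)) * (primitive x r)\<^sup>2 - b (nat \<lfloor>real N * r\<rfloor>)\<bar>
       \<le> K_bound * (2 * R * (3 * R / real N)) + R\<^sup>2 * (L * (\<bar>q - \<zeta>\<bar> + Z / real N))"
      using 1 2 unfolding i_def[symmetric] by linarith
  qed
qed

lemma energy_riemann_sum:
  fixes c :: "nat \<Rightarrow> real"
  assumes x: "bounded_path R x" and N: "1 \<le> N" and s: "s \<in> {0..1}"
    and grid: "\<And>t. t \<in> {0..1} \<Longrightarrow> x t = c (nat \<lfloor>real N * t\<rfloor>)" and c: "\<And>i. i \<le> N \<Longrightarrow> \<bar>c i\<bar> \<le> R"
  shows "\<bar>energy x s - (\<Sum>j=1..nat \<lfloor>real N * s\<rfloor>. (c j)\<^sup>2) / real N\<bar> \<le> 3 * R\<^sup>2 / real N"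
proof -
  have "(c i)\<^sup>2 \<le> R\<^sup>2" if "i \<le> N" for i
    using c[OF that] bounded_path_nonneg[OF x] by (simp add: abs_le_square_iff[symmetric])
  then show ?thesis
    using riemann_sum_error[where c="\<lambda>i. (c i)\<^sup>2" and \<eta>=0, OF bounded_path_power2[OF x] N s] grid
    by (simp add: energy_def)
qed

text \<open>Half of the lower bound $2\delta$ on the energy of $x$ is left for the discretized energy, so both
  denominators are at least $\delta$ and the truncation is inactive.\<close>

lemma discrete_ratio_close:
  fixes c :: "nat \<Rightarrow> real"
  assumes x: "bounded_path R x" and N: "2 / \<kappa> \<le> real N" and s: "s \<in> {\<kappa>..1}" and q: "0 \<le> q" "q \<le> Z"
    and grid: "\<And>t. t \<in> {0..1} \<Longrightarrow> x t = c (nat \<lfloor>real N * t\<rfloor>)" and c: "\<And>i. i \<le> N \<Longrightarrow> \<bar>c i\<bar> \<le> R"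
    and \<delta>: "0 < \<delta>" "2 * \<delta> \<le> energy x \<kappa>" "3 * R\<^sup>2 / real N \<le> \<delta>"
  shows "\<bar>discrete_ratio N q c (nat \<lfloor>real N * s\<rfloor>) - truncated_ratio \<delta> x s\<bar> \<le> discretization_error R \<delta> N q"
proof -
  have "1 \<le> 2 / \<kappa>" using \<kappa> by simp
  then have N1: "1 \<le> N" using N by linarith
  then have Npos: "0 < real N" by simp
  have s1: "s \<in> {0..1}" "0 \<le> s" "0 < s" "\<kappa> \<le> s" "s \<le> 1" using s \<kappa> by auto
  define n where "n = nat \<lfloor>real N * s\<rfloor>"
  define \<nu> where "\<nu> = real n / real N"
  have \<nu>: "\<nu> \<le> s" "s - 1 / real N \<le> \<nu>"
    using nat_floor_grid[OF N1 s1(2)] by (simp_all add: \<nu>_def n_def add_divide_distrib)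
  have "1 / real N \<le> \<kappa> / 2" using N \<kappa> Npos by (simp add: field_simps)
  then have \<nu>_ge: "\<kappa> / 2 \<le> \<nu>" using \<nu> s1 by linarith
  have \<nu>_pos: "0 < \<nu>" using \<nu>_ge \<kappa> by linarith
  note num = numerator_riemann_sum[OF x N1 s1(1) q grid c, folded n_def]
  note en = energy_riemann_sum[OF x N1 s1(1) grid c, folded n_def]
  have \<delta>s: "2 * \<delta> \<le> energy x s" using \<delta>(2) energy_mono[OF x, of \<kappa> s] \<kappa> s1 by linarith
  have \<delta>c: "\<delta> \<le> (\<Sum>j=1..n. (c j)\<^sup>2) / real N" using en \<delta>s \<delta>(3) by linarith
  have \<zeta>s: "\<bar>\<zeta> / s\<bar> \<le> \<zeta> / \<kappa>" using \<zeta> \<kappa> s1 by (simp add: frac_le)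
  have pre: "\<bar>real N / real n * q - \<zeta> / s\<bar> \<le> 2 / \<kappa>\<^sup>2 * (\<bar>q - \<zeta>\<bar> + \<zeta> / real N)"
  proof -
    have "real N / real n * q - \<zeta> / s = (q * s - \<zeta> * \<nu>) / (\<nu> * s)"
      using \<nu>_pos s1 Npos unfolding \<nu>_def by (simp add: field_simps)
    moreover have "\<bar>q * s - \<zeta> * \<nu>\<bar> \<le> \<bar>q - \<zeta>\<bar> + \<zeta> / real N"
    proof -
      have "q * s - \<zeta> * \<nu> = (q - \<zeta>) * s + \<zeta> * (s - \<nu>)" by (simp add: algebra_simps)
      also have "\<bar>\<dots>\<bar> \<le> \<bar>q - \<zeta>\<bar> * s + \<zeta> * (s - \<nu>)"
        using abs_triangle_ineq[of "(q - \<zeta>) * s" "\<zeta> * (s - \<nu>)"] s1 \<zeta> \<nu> by (simp add: abs_mult)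
      also have "\<dots> \<le> \<bar>q - \<zeta>\<bar> + \<zeta> * (1 / real N)"
        using s1 \<zeta> \<nu> by (intro add_mono mult_left_mono mult_left_le) auto
      finally show ?thesis by simp
    qed
    moreover have "\<kappa>\<^sup>2 / 2 \<le> \<nu> * s"
      using mult_mono[OF \<nu>_ge s1(4)] \<nu>_pos \<kappa> by (simp add: power2_eq_square)
    ultimately have "\<bar>real N / real n * q - \<zeta> / s\<bar> \<le> (\<bar>q - \<zeta>\<bar> + \<zeta> / real N) / (\<kappa>\<^sup>2 / 2)"
      using \<nu>_pos s1 \<kappa> \<zeta> by (simp only: abs_divide) (intro frac_le, auto)
    then show ?thesis by (simp add: mult.commute)
  qed
  have "\<bar>discrete_ratio N q c n - truncated_ratio \<delta> x s\<bar>
    \<le> K_bound * R\<^sup>2 / \<delta> * \<bar>real N / real n * q - \<zeta> / s\<bar>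
      + \<zeta> / \<kappa> / \<delta> * \<bar>(\<Sum>i=1..n. K (q * (real i - real n) / real N) * ((\<Sum>j=1..i. c j) / real N)\<^sup>2) / real N - numerator x s\<bar>
      + \<zeta> / \<kappa> * (K_bound * R\<^sup>2) / \<delta>\<^sup>2 * \<bar>(\<Sum>j=1..n. (c j)\<^sup>2) / real N - max \<delta> (energy x s)\<bar>"
    unfolding discrete_ratio_def truncated_ratio_def
    by (intro ratio_diff_le \<delta>(1) \<delta>c \<zeta>s num(2) numerator_bound[OF x s1(1)]) simp
  also have "\<dots> \<le> discretization_error R \<delta> N q"
    unfolding discretization_error_def
  proof (intro add_mono mult_left_mono pre)
    have "max \<delta> (energy x s) = energy x s" using \<delta>s \<delta>(1) by simp
    then show "\<bar>(\<Sum>j=1..n. (c j)\<^sup>2) / real N - max \<delta> (energy x s)\<bar> \<le> 3 * R\<^sup>2 / real N"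
      using en by (simp add: abs_minus_commute)
  qed (use num(1) \<delta> \<zeta> \<kappa> K_bound_nonneg in \<open>simp_all add: abs_minus_commute\<close>)
  finally show ?thesis by (simp add: n_def)
qed

end

section \<open>Convergence of expectations\<close>

context variance_ratio_functional
begin

lemma ratio_path_measurable:
  assumes X: "X \<in> measurable Q (skorohod_borel 0 1)"
  shows "(\<lambda>\<omega>. ratio_path (X \<omega>)) \<in> measurable Q (skorohod_borel \<kappa> 1)"
proof -
  have "sample_path \<kappa> 1 (\<lambda>s \<omega>. ratio (X \<omega>) s) \<in> measurable Q (skorohod_borel \<kappa> 1)"
  proof (rule continuous_process_measurable)
    fix t assume t: "t \<in> {\<kappa>..1}"
    then have t1: "t \<in> {0..1}" using \<kappa> by auto
    show "(\<lambda>\<omega>. ratio (X \<omega>) t) \<in> borel_measurable Q"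
      unfolding ratio_def
      by (intro borel_measurable_divide borel_measurable_times borel_measurable_const
          skorohod_measurable_functional[OF X] numerator_continuous_functional[OF t1] energy_continuous_functional[OF t1])
  next
    fix \<omega> assume "\<omega> \<in> space Q"
    then obtain R where "bounded_path R (X \<omega>)"
      using cadlag_imp_bounded_path[OF skorohod_measurable_cadlag[OF X]] by blast
    then show "continuous_on {\<kappa>..1} (\<lambda>s. ratio (X \<omega>) s)" by (rule ratio_continuous)
  qed (use \<kappa> in auto)
  then show ?thesis by (simp add: sample_path_def[abs_def] ratio_path_def[abs_def])
qed

text \<open>The crude bound $2C$ on the left-hand side is paid for by the degeneracy whenever the good estimate
  is not available.\<close>

lemma functional_diff_le_degeneracy:
  assumes F: "\<And>x. x \<in> cadlag_space \<kappa> 1 \<Longrightarrow> \<bar>F x\<bar> \<le> C" and "u \<in> cadlag_space \<kappa> 1" "v \<in> cadlag_space \<kappa> 1"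
    and good: "degeneracy m x < 1 \<Longrightarrow> \<bar>F u - F v\<bar> \<le> e" and "0 \<le> e"
  shows "\<bar>F u - F v\<bar> \<le> e + 2 * C * degeneracy m x"
proof (cases "degeneracy m x < 1")
  case True
  have "0 \<le> C" using F[OF assms(2)] by linarith
  then have "0 \<le> 2 * C * degeneracy m x" using degeneracy_bounds(1) by simp
  then show ?thesis using good[OF True] by linarith
next
  case False
  have "\<bar>F u\<bar> \<le> C" "\<bar>F v\<bar> \<le> C" using F assms(2,3) by auto
  moreover from this have "2 * C * 1 \<le> 2 * C * degeneracy m x" using False by (intro mult_left_mono) auto
  ultimately show ?thesis using \<open>0 \<le> e\<close> by linarith
qed

text \<open>A continuous-mapping argument with an approximation on both sides. Put $T = $ \<open>truncated_path\<close> with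
  $\delta = 1/(2m)$. Then $F(U_N)$ is replaced by $F(T(X_N))$, which converges in expectation because $F \circ T$
  is continuous, and $F(T(V))$ is replaced by $F$ of the untruncated ratio. Both replacements cost a
  multiple of the expected degeneracy, which is continuous in the law of the path and tends to 0
  under $V$ as $m$ grows.\<close>

lemma lipschitz_expectations_converge:
  assumes Q: "prob_space Q" and P: "prob_space P"
    and X: "\<And>N. X N \<in> measurable Q (skorohod_borel 0 1)" and Z: "V \<in> measurable P (skorohod_borel 0 1)"
    and weak: "\<And>f. continuous_map (skorohod_topology 0 1) euclideanreal f \<Longrightarrow> bounded (f ` cadlag_space 0 1)
      \<Longrightarrow> (\<lambda>N. \<integral>\<omega>. f (X N \<omega>) \<partial>Q) \<longlonglongrightarrow> (\<integral>\<omega>. f (V \<omega>) \<partial>P)"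
    and U: "\<And>N. U N \<in> measurable Q (skorohod_borel \<kappa> 1)"
    and close: "\<And>m e. 0 < m \<Longrightarrow> 0 < e \<Longrightarrow> eventually (\<lambda>N. \<forall>\<omega>\<in>space Q. degeneracy m (X N \<omega>) < 1 \<longrightarrow>
       (\<forall>s\<in>{\<kappa>..1}. \<bar>U N \<omega> s - truncated_ratio (1 / (2 * real m)) (X N \<omega>) s\<bar> \<le> e)) sequentially"
    and pos: "AE \<omega> in P. 0 < energy (V \<omega>) \<kappa>"
    and k: "0 \<le> k" and lip: "\<And>x y. x \<in> cadlag_space \<kappa> 1 \<Longrightarrow> y \<in> cadlag_space \<kappa> 1 \<Longrightarrow> \<bar>F x - F y\<bar> \<le> k * skorohod_dist \<kappa> 1 x y"
    and C: "\<And>x. x \<in> cadlag_space \<kappa> 1 \<Longrightarrow> \<bar>F x\<bar> \<le> C"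
  shows "(\<lambda>N. \<integral>\<omega>. F (U N \<omega>) \<partial>Q) \<longlonglongrightarrow> (\<integral>\<omega>. F (ratio_path (V \<omega>)) \<partial>P)"
proof (rule tendstoI)
  fix e :: real assume e: "0 < e"
  interpret Q: prob_space Q by fact
  interpret P: prob_space P by fact
  note Xc = skorohod_measurable_cadlag[OF X] and Zc = skorohod_measurable_cadlag[OF Z]
    and Uc = skorohod_measurable_cadlag[OF U]
  have C0: "0 \<le> C" using C[OF restrict_const_cadlag[where c=0]] by linarith
  have F: "continuous_map (skorohod_topology \<kappa> 1) euclideanreal F"
    unfolding skorohod_topology_def
    by (rule Metric_space.continuous_map_real_lipschitz[OF Metric_space_skorohod lip])
  have deg_b: "\<bar>degeneracy m x\<bar> \<le> 2" for m x using degeneracy_bounds[of m x] by simp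
  have degX: "integrable Q (\<lambda>\<omega>. degeneracy m (X N \<omega>))" for m N
    using skorohod_measurable_functional[OF X degeneracy_continuous]
    by (intro Q.integrable_const_bound[of _ 2]) (simp_all add: deg_b)
  have degZ: "integrable P (\<lambda>\<omega>. degeneracy m (V \<omega>))" for m
    using skorohod_measurable_functional[OF Z degeneracy_continuous]
    by (intro P.integrable_const_bound[of _ 2]) (simp_all add: deg_b)
  have "(\<lambda>m. \<integral>\<omega>. degeneracy m (V \<omega>) \<partial>P) \<longlonglongrightarrow> (\<integral>\<omega>. 0 \<partial>P)"
  proof (rule integral_dominated_convergence[where w="\<lambda>_. 2"])
    show "AE \<omega> in P. (\<lambda>m. degeneracy m (V \<omega>)) \<longlonglongrightarrow> 0"
      using pos by (rule AE_mp) (auto intro!: AE_I2 degeneracy_tendsto_0 Zc)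
    show "\<And>m. (\<lambda>\<omega>. degeneracy m (V \<omega>)) \<in> borel_measurable P"
      by (rule skorohod_measurable_functional[OF Z degeneracy_continuous])
  qed (auto simp: deg_b)
  then have "(\<lambda>m. \<integral>\<omega>. degeneracy m (V \<omega>) \<partial>P) \<longlonglongrightarrow> 0" by simp
  then have "(\<lambda>m. 4 * C * (\<integral>\<omega>. degeneracy m (V \<omega>) \<partial>P)) \<longlonglongrightarrow> 0"
    by (rule tendsto_mult_right_zero)
  then have "eventually (\<lambda>m. 4 * C * (\<integral>\<omega>. degeneracy m (V \<omega>) \<partial>P) < e / 2 \<and> 0 < m) sequentially"
    using e by (intro eventually_conj order_tendstoD(2) eventually_gt_at_top) auto
  then obtain m where m: "4 * C * (\<integral>\<omega>. degeneracy m (V \<omega>) \<partial>P) < e / 2" "0 < m"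
    unfolding eventually_sequentially by blast
  define \<delta> where "\<delta> = 1 / (2 * real m)"
  have \<delta>: "0 < \<delta>" using m(2) by (simp add: \<delta>_def)
  define T where "T = truncated_path \<delta>"
  have Tc: "T x \<in> cadlag_space \<kappa> 1" if "x \<in> cadlag_space 0 1" for x
    unfolding T_def by (rule truncated_path_cadlag[OF that \<delta>])
  have FT: "continuous_map (skorohod_topology 0 1) euclideanreal (\<lambda>x. F (T x))"
    unfolding T_def by (rule truncated_path_continuous_functional[OF F \<delta>])
  have FTb: "bounded ((\<lambda>x. F (T x)) ` cadlag_space 0 1)" using C Tc by (auto simp: bounded_iff)
  have FTX: "integrable Q (\<lambda>\<omega>. F (T (X N \<omega>)))" for N
    using skorohod_measurable_functional[OF X FT] by (intro Q.integrable_const_bound[of _ C]) (auto simp: C Tc Xc)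
  have FTZ: "integrable P (\<lambda>\<omega>. F (T (V \<omega>)))"
    using skorohod_measurable_functional[OF Z FT] by (intro P.integrable_const_bound[of _ C]) (auto simp: C Tc Zc)
  have FU: "integrable Q (\<lambda>\<omega>. F (U N \<omega>))" for N
    using skorohod_measurable_functional[OF U F] by (intro Q.integrable_const_bound[of _ C]) (auto simp: C Uc)
  have FR: "integrable P (\<lambda>\<omega>. F (ratio_path (V \<omega>)))"
    using skorohod_measurable_functional[OF ratio_path_measurable[OF Z] F]
    by (intro P.integrable_const_bound[of _ C]) (auto simp: C ratio_path_cadlag Zc)
  have limit_part: "\<bar>(\<integral>\<omega>. F (T (V \<omega>)) \<partial>P) - (\<integral>\<omega>. F (ratio_path (V \<omega>)) \<partial>P)\<bar> \<le> 2 * C * (\<integral>\<omega>. degeneracy m (V \<omega>) \<partial>P)"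
  proof -
    have "\<bar>F (T (V \<omega>)) - F (ratio_path (V \<omega>))\<bar> \<le> 0 + 2 * C * degeneracy m (V \<omega>)" if w: "\<omega> \<in> space P" for \<omega>
    proof (rule functional_diff_le_degeneracy[OF C Tc[OF Zc[OF w]] ratio_path_cadlag[OF Zc[OF w]]])
      assume less: "degeneracy m (V \<omega>) < 1"
      note good = degeneracy_less_1[OF Zc[OF w] less]
      have "\<delta> \<le> energy (V \<omega>) \<kappa>" using good(2) m(2) by (simp add: \<delta>_def field_simps)
      then show "\<bar>F (T (V \<omega>)) - F (ratio_path (V \<omega>))\<bar> \<le> 0"
        using truncated_path_eq_ratio_path[OF good(1)] by (simp add: T_def)
    qed simp_all
    then have "(\<integral>\<omega>. \<bar>F (T (V \<omega>)) - F (ratio_path (V \<omega>))\<bar> \<partial>P) \<le> (\<integral>\<omega>. 2 * C * degeneracy m (V \<omega>) \<partial>P)"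
      using FTZ FR degZ by (intro integral_mono) auto
    moreover have "\<bar>\<integral>\<omega>. F (T (V \<omega>)) - F (ratio_path (V \<omega>)) \<partial>P\<bar> \<le> (\<integral>\<omega>. \<bar>F (T (V \<omega>)) - F (ratio_path (V \<omega>))\<bar> \<partial>P)"
      using integral_norm_bound[of P "\<lambda>\<omega>. F (T (V \<omega>)) - F (ratio_path (V \<omega>))"] by simp
    ultimately show ?thesis using FTZ FR by simp
  qed
  \<comment> \<open>The summand 1 keeps the tolerance finite for a constant test function, where \<open>k = 0\<close>.\<close>
  define \<eta> where "\<eta> = e / (4 * (k + 1))"
  have \<eta>: "0 < \<eta>" using e k by (simp add: \<eta>_def)
  have "k * \<eta> \<le> (k + 1) * \<eta>" using \<eta> by (intro mult_right_mono) auto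
  also have "\<dots> = e / 4" using k by (simp add: \<eta>_def field_simps)
  finally have k\<eta>: "k * \<eta> \<le> e / 4" .
  have "(\<lambda>N. 2 * C * (\<integral>\<omega>. degeneracy m (X N \<omega>) \<partial>Q)
        + \<bar>(\<integral>\<omega>. F (T (X N \<omega>)) \<partial>Q) - (\<integral>\<omega>. F (T (V \<omega>)) \<partial>P)\<bar>)
      \<longlonglongrightarrow> 2 * C * (\<integral>\<omega>. degeneracy m (V \<omega>) \<partial>P) + \<bar>(\<integral>\<omega>. F (T (V \<omega>)) \<partial>P) - (\<integral>\<omega>. F (T (V \<omega>)) \<partial>P)\<bar>"
  proof (intro tendsto_intros weak degeneracy_continuous FT FTb)
    show "bounded (degeneracy m ` cadlag_space 0 1)" unfolding bounded_iff using deg_b by force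
  qed
  then have "eventually (\<lambda>N. 2 * C * (\<integral>\<omega>. degeneracy m (X N \<omega>) \<partial>Q)
        + \<bar>(\<integral>\<omega>. F (T (X N \<omega>)) \<partial>Q) - (\<integral>\<omega>. F (T (V \<omega>)) \<partial>P)\<bar>
        < 2 * C * (\<integral>\<omega>. degeneracy m (V \<omega>) \<partial>P) + e / 4) sequentially"
    by (rule order_tendstoD(2)) (use e in simp)
  moreover note close[OF m(2) \<eta>]
  ultimately show "eventually (\<lambda>N. dist (\<integral>\<omega>. F (U N \<omega>) \<partial>Q) (\<integral>\<omega>. F (ratio_path (V \<omega>)) \<partial>P) < e) sequentially"
  proof eventually_elim
    case (elim N)
    have "\<bar>F (U N \<omega>) - F (T (X N \<omega>))\<bar> \<le> k * \<eta> + 2 * C * degeneracy m (X N \<omega>)" if w: "\<omega> \<in> space Q" for \<omega>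
    proof (rule functional_diff_le_degeneracy[OF C Uc[OF w] Tc[OF Xc[OF w]]])
      assume less: "degeneracy m (X N \<omega>) < 1"
      have "skorohod_dist \<kappa> 1 (U N \<omega>) (T (X N \<omega>)) \<le> \<eta>"
      proof (rule skorohod_dist_le[OF Uc[OF w] Tc[OF Xc[OF w]]])
        fix t assume t: "t \<in> {\<kappa>..1}"
        then show "\<bar>U N \<omega> t - T (X N \<omega>) t\<bar> \<le> \<eta>"
          using elim(2) w less by (simp add: T_def truncated_path_def \<delta>_def)
      qed (use \<eta> in simp)
      then show "\<bar>F (U N \<omega>) - F (T (X N \<omega>))\<bar> \<le> k * \<eta>"
        by (rule order_trans[OF lip[OF Uc[OF w] Tc[OF Xc[OF w]]] mult_left_mono[OF _ k]])
    qed (use k \<eta> in simp_all)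
    then have "(\<integral>\<omega>. \<bar>F (U N \<omega>) - F (T (X N \<omega>))\<bar> \<partial>Q) \<le> (\<integral>\<omega>. k * \<eta> + 2 * C * degeneracy m (X N \<omega>) \<partial>Q)"
      using FU FTX degX by (intro integral_mono) auto
    moreover have "\<bar>\<integral>\<omega>. F (U N \<omega>) - F (T (X N \<omega>)) \<partial>Q\<bar> \<le> (\<integral>\<omega>. \<bar>F (U N \<omega>) - F (T (X N \<omega>))\<bar> \<partial>Q)"
      using integral_norm_bound[of Q "\<lambda>\<omega>. F (U N \<omega>) - F (T (X N \<omega>))"] by simp
    ultimately have "\<bar>(\<integral>\<omega>. F (U N \<omega>) \<partial>Q) - (\<integral>\<omega>. F (T (X N \<omega>)) \<partial>Q)\<bar> \<le> k * \<eta> + 2 * C * (\<integral>\<omega>. degeneracy m (X N \<omega>) \<partial>Q)"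
      using FU FTX degX by (simp add: Q.prob_space)
    then show ?case unfolding dist_real_def using elim(1) limit_part m(1) k\<eta> by linarith
  qed
qed

end

section \<open>The variance-ratio process of an integrated time series\<close>

text \<open>By right-continuity a nonzero value persists on an interval, and this interval contributes to the
  energy.\<close>

lemma cadlag_energy_zero_imp_zero:
  assumes x: "x \<in> cadlag_space 0 1" and b: "b \<le> 1" and zero: "energy x b = 0" and t: "0 \<le> t" "t < b"
  shows "x t = 0"
proof (rule ccontr)
  assume nz: "x t \<noteq> 0"
  obtain R where R: "bounded_path R x"
    using cadlag_imp_bounded_path[OF x] by blast
  have "t \<in> {0..<1}" using t b by simp
  then have "(x \<longlongrightarrow> x t) (at_right t)" using x unfolding cadlag_space_def by blast
  then have "((\<lambda>u. \<bar>x u\<bar>) \<longlongrightarrow> \<bar>x t\<bar>) (at_right t)" by (rule tendsto_rabs)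
  then have "eventually (\<lambda>u. \<bar>x t\<bar> / 2 < \<bar>x u\<bar>) (at_right t)"
    by (rule order_tendstoD(1)) (use nz in simp)
  then obtain c where c: "c > t" "\<And>u. t < u \<Longrightarrow> u < c \<Longrightarrow> \<bar>x t\<bar> / 2 < \<bar>x u\<bar>"
    unfolding eventually_at_right_field by blast
  have "t < min b c" using c(1) t(2) by simp
  then obtain v where "t < v" "v < min b c" using dense by blast
  then have v: "t < v" "v < b" "v < c" by simp_all
  have v1: "v \<le> 1" using v b by linarith
  have ge: "(\<bar>x t\<bar> / 2)\<^sup>2 \<le> (x u)\<^sup>2" if u: "u \<in> {t..v}" for u
  proof (cases "u = t")
    case False
    then have "\<bar>x t\<bar> / 2 < \<bar>x u\<bar>" using u v by (intro c(2)) auto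
    then show ?thesis using abs_le_square_iff[of "\<bar>x t\<bar> / 2" "x u"] by simp
  next
    case True
    then show ?thesis using abs_le_square_iff[of "\<bar>x t\<bar> / 2" "x u"] by simp
  qed
  have "integral {t..v} (\<lambda>_. (\<bar>x t\<bar> / 2)\<^sup>2) \<le> integral {t..v} (\<lambda>u. (x u)\<^sup>2)"
    using bounded_path_integrable(1)[OF bounded_path_power2[OF R], of t v] t v1
    by (intro integral_le ge) (auto simp: integrable_const_ivl)
  also have "\<dots> = energy x v - energy x t"
    using bounded_path_integral_split[OF bounded_path_power2[OF R], of t v] t v v1 by (simp add: energy_def)
  also have "\<dots> \<le> energy x b - 0"
    using energy_mono[OF R, of v b] energy_nonneg[of x t] t v b by (intro diff_mono) auto
  finally have "(v - t) * (\<bar>x t\<bar> / 2)\<^sup>2 \<le> 0" using v zero by simp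
  moreover have "0 < (v - t) * (\<bar>x t\<bar> / 2)\<^sup>2" using v nz by simp
  ultimately show False by linarith
qed

text \<open>The increment from time 0 to time $t$ has a density, so it is almost surely nonzero.\<close>

lemma brownian_nonzero_at:
  assumes B: "standard_brownian_motion P B" and t: "0 < t" "t \<le> 1"
  shows "AE \<omega> in P. B t \<omega> \<noteq> 0"
proof -
  have d: "distributed P lborel (\<lambda>\<omega>. B t \<omega> - B 0 \<omega>) (normal_density 0 (sqrt (t - 0)))"
    and B0: "AE \<omega> in P. B 0 \<omega> = 0"
    using B t unfolding standard_brownian_motion_def by (fast intro: order_refl)+
  have "emeasure P ((\<lambda>\<omega>. B t \<omega> - B 0 \<omega>) -` {0} \<inter> space P)
      = (\<integral>\<^sup>+ x. ennreal (normal_density 0 (sqrt (t - 0)) x) * indicator {0} x \<partial>lborel)"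
    by (rule distributed_emeasure[OF d]) simp
  also have "\<dots> = 0" by (rule nn_integral_null_set) (simp add: null_sets_def)
  finally have "(\<lambda>\<omega>. B t \<omega> - B 0 \<omega>) -` {0} \<inter> space P \<in> null_sets P"
    using measurable_sets[OF distributed_measurable[OF d], of "{0}"] by (simp add: null_sets_def)
  from AE_not_in[OF this] B0 AE_space show ?thesis by eventually_elim auto
qed

context variance_ratio_functional
begin

lemma brownian_energy_pos:
  assumes B: "standard_brownian_motion P B" and \<sigma>: "0 < \<sigma>"
    and path: "sample_path 0 1 (\<lambda>s \<omega>. \<sigma> * B s \<omega>) \<in> measurable P (skorohod_borel 0 1)"
  shows "AE \<omega> in P. 0 < energy (sample_path 0 1 (\<lambda>s \<omega>. \<sigma> * B s \<omega>) \<omega>) \<kappa>"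
proof -
  have "AE \<omega> in P. B (\<kappa> / 2) \<omega> \<noteq> 0" using \<kappa> by (intro brownian_nonzero_at[OF B]) auto
  then show ?thesis
  proof (rule AE_mp, intro AE_I2 impI)
    fix \<omega> assume w: "\<omega> \<in> space P" and nz: "B (\<kappa> / 2) \<omega> \<noteq> 0"
    let ?x = "sample_path 0 1 (\<lambda>s \<omega>. \<sigma> * B s \<omega>) \<omega>"
    have "?x (\<kappa> / 2) \<noteq> 0" using nz \<sigma> \<kappa> by (simp add: sample_path_def)
    then have "energy ?x \<kappa> \<noteq> 0"
      using cadlag_energy_zero_imp_zero[OF skorohod_measurable_cadlag[OF path w], of \<kappa> "\<kappa> / 2"] \<kappa> by auto
    then show "0 < energy ?x \<kappa>" using energy_nonneg[of ?x \<kappa>] by simp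
  qed
qed

text \<open>Numerator and denominator are both quadratic in the path, so $\sigma$ cancels.\<close>

lemma vr_limit_eq_ratio:
  assumes x: "bounded_path R (sample_path 0 1 (\<lambda>s \<omega>. \<sigma> * B s \<omega>) \<omega>)" and \<sigma>: "0 < \<sigma>" and s: "s \<in> {\<kappa>..1}"
  shows "vr_limit K \<zeta> B s \<omega> = ratio (sample_path 0 1 (\<lambda>s \<omega>. \<sigma> * B s \<omega>) \<omega>) s"
proof -
  define x where "x = sample_path 0 1 (\<lambda>s \<omega>. \<sigma> * B s \<omega>) \<omega>"
  have R: "bounded_path R x" using x by (simp add: x_def)
  have s1: "s \<in> {0..1}" "0 \<le> s" "s \<le> 1" using s \<kappa> by auto
  have xB: "B t \<omega> = x t / \<sigma>" if "t \<in> {0..1}" for t using that \<sigma> by (simp add: x_def sample_path_def)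
  have prim: "(LINT t:{0..r}|lborel. B t \<omega>) = primitive x r / \<sigma>" if r: "r \<in> {0..1}" for r
  proof -
    have "(LINT t:{0..r}|lborel. B t \<omega>) = (LINT t:{0..r}|lborel. x t / \<sigma>)"
      using r by (intro set_lebesgue_integral_cong) (auto intro!: xB)
    also have "\<dots> = (LINT t:{0..r}|lborel. x t) / \<sigma>" by simp
    finally show ?thesis using bounded_path_integrable(2)[OF R, of 0 r] r by (simp add: primitive_def)
  qed
  have "(LINT r:{0..s}|lborel. K (\<zeta> * (r - s)) * (LINT t:{0..r}|lborel. B t \<omega>)\<^sup>2)
      = (LINT r:{0..s}|lborel. K (\<zeta> * (r - s)) * (primitive x r)\<^sup>2 / \<sigma>\<^sup>2)"
    using s1 by (intro set_lebesgue_integral_cong) (auto simp: prim power_divide)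
  also have "\<dots> = (LINT r:{0..s}|lborel. K (\<zeta> * (r - s)) * (primitive x r)\<^sup>2) / \<sigma>\<^sup>2" by simp
  also have "\<dots> = numerator x s / \<sigma>\<^sup>2"
    using bounded_path_integrable(2)[OF integrand_bounded_path[OF s1(1) R], of 0 s] s1 by (simp add: numerator_def)
  finally have num: "(LINT r:{0..s}|lborel. K (\<zeta> * (r - s)) * (LINT t:{0..r}|lborel. B t \<omega>)\<^sup>2) = numerator x s / \<sigma>\<^sup>2" .
  have "(LINT r:{0..s}|lborel. (B r \<omega>)\<^sup>2) = (LINT r:{0..s}|lborel. (x r)\<^sup>2 / \<sigma>\<^sup>2)"
    using s1 by (intro set_lebesgue_integral_cong) (auto simp: xB power_divide)
  also have "\<dots> = (LINT r:{0..s}|lborel. (x r)\<^sup>2) / \<sigma>\<^sup>2" by simp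
  also have "\<dots> = energy x s / \<sigma>\<^sup>2"
    using bounded_path_integrable(2)[OF bounded_path_power2[OF R], of 0 s] s1 by (simp add: energy_def)
  finally have en: "(LINT r:{0..s}|lborel. (B r \<omega>)\<^sup>2) = energy x s / \<sigma>\<^sup>2" .
  show ?thesis unfolding vr_limit_def num en x_def[symmetric] ratio_def using \<sigma> by simp
qed

text \<open>After cancellation both sides are $\sum_i (\sum_{j \leq i} Y_j)^2 K((i-n)/h) / (h n \sum_j Y_j^2)$; this
  includes the case of a vanishing denominator, where both quotients are 0.\<close>

lemma vr_process_eq_discrete_ratio:
  assumes N: "1 \<le> N" and h: "0 < h N" and s: "1 / real N \<le> s"
  shows "vr_process K h Y N s \<omega>
    = discrete_ratio N (real N / h N) (\<lambda>j. Y j \<omega> / sqrt (real N)) (nat \<lfloor>real N * s\<rfloor>)"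
proof -
  define n where "n = nat \<lfloor>real N * s\<rfloor>"
  have Npos: "0 < real N" using N by simp
  have "1 \<le> real N * s" using s Npos by (simp add: field_simps)
  then have n: "0 < real n" unfolding n_def by simp
  define S where "S = (\<Sum>i=1..n. (\<Sum>j=1..i. Y j \<omega>)\<^sup>2 * K ((real i - real n) / h N))"
  define T where "T = (\<Sum>j=1..n. (Y j \<omega>)\<^sup>2)"
  have "vr_process K h Y N s \<omega> = (1 / real n ^ 3 * (S / h N)) / (1 / real n ^ 2 * T)"
    unfolding vr_process_def S_def T_def scaled_kernel_def using s
    by (simp add: n_def[symmetric] Let_def sum_divide_distrib)
  also have "\<dots> = S / (h N * real n * T)"
    using n by (simp add: field_simps power2_eq_square power3_eq_cube)
  finally have vr: "vr_process K h Y N s \<omega> = S / (h N * real n * T)" .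
  have sq: "(sqrt (real N))\<^sup>2 = real N" by simp
  have "(\<Sum>j=1..i. Y j \<omega> / sqrt (real N)) / real N = (\<Sum>j=1..i. Y j \<omega>) / (sqrt (real N) * real N)" for i
    by (simp add: sum_divide_distrib)
  then have "((\<Sum>j=1..i. Y j \<omega> / sqrt (real N)) / real N)\<^sup>2 = (\<Sum>j=1..i. Y j \<omega>)\<^sup>2 / real N ^ 3" for i
    by (simp add: power_divide power_mult_distrib power2_eq_square power3_eq_cube)
  moreover have "real N / h N * (real i - real n) / real N = (real i - real n) / h N" for i
    using Npos by simp
  ultimately have "(\<Sum>i=1..n. K (real N / h N * (real i - real n) / real N) * ((\<Sum>j=1..i. Y j \<omega> / sqrt (real N)) / real N)\<^sup>2)
      = S / real N ^ 3"
    unfolding S_def by (simp add: sum_divide_distrib mult.commute)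
  moreover have "(\<Sum>j=1..n. (Y j \<omega> / sqrt (real N))\<^sup>2) = T / real N"
    unfolding T_def by (simp add: sum_divide_distrib power_divide)
  ultimately have "discrete_ratio N (real N / h N) (\<lambda>j. Y j \<omega> / sqrt (real N)) n
      = real N / real n * (real N / h N) * (S / real N ^ 3 / real N) / (T / real N / real N)"
    unfolding discrete_ratio_def by (simp only:)
  also have "\<dots> = S / (h N * real n * T)"
    using n Npos h by (simp add: field_simps power2_eq_square power3_eq_cube)
  finally show ?thesis unfolding vr n_def[symmetric] by simp
qed

text \<open>The process depends on $s$ only through $\lfloor Ns \rfloor$, so its paths are grid paths.\<close>

lemma vr_process_measurable:
  assumes Y: "\<And>n. Y n \<in> borel_measurable Q"
  shows "sample_path \<kappa> 1 (vr_process K h Y N) \<in> measurable Q (skorohod_borel \<kappa> 1)"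
proof -
  define v where "v n \<omega> = (1 / real n ^ 3 * (\<Sum>i=1..n. (\<Sum>j=1..i. Y j \<omega>)\<^sup>2 * scaled_kernel K (h N) (real i - real n)))
        / (1 / real n ^ 2 * (\<Sum>j=1..n. (Y j \<omega>)\<^sup>2))" for n \<omega>
  have v: "v n \<in> borel_measurable Q" for n
    unfolding v_def using Y by measurable
  show ?thesis
  proof (cases "N = 0")
    case True
    \<comment> \<open>There \<open>1 / real N\<close> is 0, so the second branch of the definition applies, with empty sums.\<close>
    have "sample_path \<kappa> 1 (vr_process K h Y N) = (\<lambda>\<omega>. grid_path \<kappa> 1 1 (\<lambda>_. 0))"
      using \<kappa> True by (auto simp: sample_path_def grid_path_def vr_process_def fun_eq_iff restrict_def)
    then show ?thesis using grid_path_measurable[of 1 "\<lambda>_ _. 0" Q \<kappa> 1] by simp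
  next
    case False
    then have k: "0 < real N" by simp
    have "vr_process K h Y N s \<omega> = v (nat \<lfloor>real N * s\<rfloor>) \<omega>" if "0 \<le> s" for s \<omega>
    proof (cases "s < 1 / real N")
      case True
      then have "real N * s < 1" "0 \<le> real N * s" using k that by (simp_all add: field_simps)
      then have "nat \<lfloor>real N * s\<rfloor> = 0" by linarith
      then show ?thesis using True by (simp add: vr_process_def v_def)
    qed (simp add: vr_process_def v_def Let_def)
    then have "sample_path \<kappa> 1 (vr_process K h Y N) = (\<lambda>\<omega>. grid_path \<kappa> 1 (real N) (\<lambda>i. v i \<omega>))"
      using \<kappa> by (auto simp: sample_path_def grid_path_def fun_eq_iff restrict_def)
    then show ?thesis using grid_path_measurable[OF k v] by simp
  qed
qed

lemma vr_process_close:
  assumes h: "\<And>N. 1 \<le> N \<Longrightarrow> 0 < h N" and q: "(\<lambda>N. real N / h N) \<longlonglongrightarrow> \<zeta>" and qZ: "\<And>N. real N / h N \<le> Z"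
    and m: "0 < m" and e: "0 < e"
    and cadlag: "\<And>N \<omega>. \<omega> \<in> space Q \<Longrightarrow> sample_path 0 1 (\<lambda>s \<omega>. Y (nat \<lfloor>real N * s\<rfloor>) \<omega> / sqrt (real N)) \<omega> \<in> cadlag_space 0 1"
  shows "eventually (\<lambda>N. \<forall>\<omega>\<in>space Q.
       degeneracy m (sample_path 0 1 (\<lambda>s \<omega>. Y (nat \<lfloor>real N * s\<rfloor>) \<omega> / sqrt (real N)) \<omega>) < 1 \<longrightarrow>
       (\<forall>s\<in>{\<kappa>..1}. \<bar>sample_path \<kappa> 1 (vr_process K h Y N) \<omega> s
          - truncated_ratio (1 / (2 * real m)) (sample_path 0 1 (\<lambda>s \<omega>. Y (nat \<lfloor>real N * s\<rfloor>) \<omega> / sqrt (real N)) \<omega>) s\<bar> \<le> e)) sequentially"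
proof -
  define \<delta> where "\<delta> = 1 / (2 * real m)"
  define R where "R = real m + 1"
  have \<delta>: "0 < \<delta>" using m by (simp add: \<delta>_def)
  have "eventually (\<lambda>N. discretization_error R \<delta> N (real N / h N) < e) sequentially"
    using discretization_error_tendsto_0[OF q, of R \<delta>] e by (rule order_tendstoD(2))
  moreover have "eventually (\<lambda>N. 3 * R\<^sup>2 / real N < \<delta>) sequentially"
    by (rule order_tendstoD(2)[OF lim_const_over_n \<delta>])
  moreover have "eventually (\<lambda>N. 2 / \<kappa> \<le> real N) sequentially"
    using filterlim_real_sequentially unfolding filterlim_at_top by blast
  ultimately show ?thesis
  proof eventually_elim
    case (elim N)
    have "1 \<le> 2 / \<kappa>" using \<kappa> by simp
    then have N1: "1 \<le> N" using elim(3) by linarith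
    have q0: "0 \<le> real N / h N" using h[OF N1] by simp
    have "1 / real N \<le> \<kappa> / 2" using elim(3) N1 \<kappa> by (simp add: field_simps)
    then have N\<kappa>: "1 / real N \<le> \<kappa>" using \<kappa> by linarith
    show ?case
    proof (intro ballI impI)
      fix \<omega> s assume w: "\<omega> \<in> space Q" and s: "s \<in> {\<kappa>..1}"
      define x where "x = sample_path 0 1 (\<lambda>s \<omega>. Y (nat \<lfloor>real N * s\<rfloor>) \<omega> / sqrt (real N)) \<omega>"
      define c where "c j = Y j \<omega> / sqrt (real N)" for j
      assume "degeneracy m (sample_path 0 1 (\<lambda>s \<omega>. Y (nat \<lfloor>real N * s\<rfloor>) \<omega> / sqrt (real N)) \<omega>) < 1"
      then have "degeneracy m x < 1" by (simp add: x_def)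
      moreover have "x \<in> cadlag_space 0 1" using cadlag[OF w] by (simp add: x_def)
      ultimately have x: "bounded_path R x" "1 < real m * energy x \<kappa>"
        using degeneracy_less_1 unfolding R_def by blast+
      have grid: "x t = c (nat \<lfloor>real N * t\<rfloor>)" if "t \<in> {0..1}" for t
        using that by (simp add: x_def c_def sample_path_def)
      \<comment> \<open>Every normalised observation, the last one included, is a value of the path.\<close>
      have c: "\<bar>c i\<bar> \<le> R" if i: "i \<le> N" for i
      proof -
        have "x (real i / real N) = c i" using grid[of "real i / real N"] i N1 by simp
        then show ?thesis using bounded_pathD[OF x(1), of "real i / real N"] i N1 by simp
      qed
      have "2 * \<delta> \<le> energy x \<kappa>" using x(2) m by (simp add: \<delta>_def field_simps)
      then have "\<bar>discrete_ratio N (real N / h N) c (nat \<lfloor>real N * s\<rfloor>) - truncated_ratio \<delta> x s\<bar>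
          \<le> discretization_error R \<delta> N (real N / h N)"
        using elim by (intro discrete_ratio_close[OF x(1) _ s q0 qZ grid c \<delta>]) simp_all
      moreover have "sample_path \<kappa> 1 (vr_process K h Y N) \<omega> s
          = discrete_ratio N (real N / h N) c (nat \<lfloor>real N * s\<rfloor>)"
        using vr_process_eq_discrete_ratio[where h=h and s=s and Y=Y and \<omega>=\<omega>, OF N1 h[OF N1]] N\<kappa> s
        by (simp add: sample_path_def c_def[abs_def])
      ultimately show "\<bar>sample_path \<kappa> 1 (vr_process K h Y N) \<omega> s
          - truncated_ratio (1 / (2 * real m)) (sample_path 0 1 (\<lambda>s \<omega>. Y (nat \<lfloor>real N * s\<rfloor>) \<omega> / sqrt (real N)) \<omega>) s\<bar> \<le> e"
        using elim(1) unfolding \<delta>_def x_def by simp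
    qed
  qed
qed

end

theorem theorem2p1:
  fixes M :: "'w measure" and P :: "'v measure"
    and Y :: "nat \<Rightarrow> 'w \<Rightarrow> real" and B :: "real \<Rightarrow> 'v \<Rightarrow> real"
    and K :: "real \<Rightarrow> real" and h :: "nat \<Rightarrow> real"
    and \<sigma> \<zeta> \<kappa> :: real
  assumes "prob_space M"
    and "\<And>n. Y n \<in> borel_measurable M"
    and "standard_brownian_motion P B"
    and "vr_kernel K"
    and "\<And>N. 1 \<le> N \<Longrightarrow> 0 < h N"
    and "(\<lambda>N. real N / h N) \<longlonglongrightarrow> \<zeta>" and "1 \<le> \<zeta>"
    and "0 < \<sigma>"
    and "weak_conv_cadlag 0 1 M (\<lambda>N s \<omega>. Y (nat \<lfloor>real N * s\<rfloor>) \<omega> / sqrt (real N))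
           P (\<lambda>s \<omega>. \<sigma> * B s \<omega>)"
    and "0 < \<kappa>" and "\<kappa> < 1"
  shows "weak_conv_cadlag \<kappa> 1 M (vr_process K h Y) P (vr_limit K \<zeta> B)
    \<and> (AE \<omega> in P. continuous_on {\<kappa>..1} (\<lambda>s. vr_limit K \<zeta> B s \<omega>))"
proof -
  have P: "prob_space P" using assms(3) by (simp add: standard_brownian_motion_def)
  obtain L where L: "L-lipschitz_on UNIV K" and K0: "\<And>x. 0 \<le> K x"
    using assms(4) unfolding vr_kernel_def by blast
  obtain Z where "\<And>N. \<bar>real N / h N\<bar> \<le> Z"
    using convergent_imp_bounded[OF assms(6)] unfolding bounded_iff by auto
  then have Z: "real N / h N \<le> Z" for N by (meson abs_le_D1)
  have ZZ: "\<zeta> \<le> Z" by (rule LIMSEQ_le_const2[OF assms(6)]) (use Z in blast)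
  interpret variance_ratio_functional K L Z \<zeta> \<kappa>
  proof
    show "\<bar>K x - K y\<bar> \<le> L * \<bar>x - y\<bar>" for x y
      using lipschitz_onD[OF L, of x y] by (simp add: dist_real_def)
    show "0 \<le> L" using lipschitz_on_nonneg[OF L] .
  qed (use assms K0 ZZ in auto)
  define X where "X N = sample_path 0 1 (\<lambda>s \<omega>. Y (nat \<lfloor>real N * s\<rfloor>) \<omega> / sqrt (real N))" for N
  define V where "V = sample_path 0 1 (\<lambda>s \<omega>. \<sigma> * B s \<omega>)"
  have X: "X N \<in> measurable M (skorohod_borel 0 1)" for N
    using assms(9) unfolding weak_conv_cadlag_def X_def by blast
  have V: "V \<in> measurable P (skorohod_borel 0 1)"
    using assms(9) unfolding weak_conv_cadlag_def V_def by blast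
  have weak: "(\<lambda>N. \<integral>\<omega>. f (X N \<omega>) \<partial>M) \<longlonglongrightarrow> (\<integral>\<omega>. f (V \<omega>) \<partial>P)"
    if "continuous_map (skorohod_topology 0 1) euclideanreal f" "bounded (f ` cadlag_space 0 1)" for f
    using assms(9) that unfolding weak_conv_cadlag_def X_def V_def by blast
  have pos: "AE \<omega> in P. 0 < energy (V \<omega>) \<kappa>"
    using brownian_energy_pos[OF assms(3,8)] V unfolding V_def by blast
  define U where "U N = sample_path \<kappa> 1 (vr_process K h Y N)" for N
  have U: "U N \<in> measurable M (skorohod_borel \<kappa> 1)" for N
    unfolding U_def by (rule vr_process_measurable[OF assms(2)])
  have bounded: "\<exists>R. bounded_path R (V \<omega>)" if "\<omega> \<in> space P" for \<omega>
    using cadlag_imp_bounded_path[OF skorohod_measurable_cadlag[OF V that]] by blast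
  have limit_eq: "vr_limit K \<zeta> B s \<omega> = ratio (V \<omega>) s" if w: "\<omega> \<in> space P" and s: "s \<in> {\<kappa>..1}" for s \<omega>
  proof -
    obtain R where "bounded_path R (V \<omega>)" using bounded[OF w] ..
    then show ?thesis unfolding V_def by (rule vr_limit_eq_ratio[OF _ assms(8) s])
  qed
  have path_eq: "sample_path \<kappa> 1 (vr_limit K \<zeta> B) \<omega> = ratio_path (V \<omega>)" if "\<omega> \<in> space P" for \<omega>
    unfolding sample_path_def ratio_path_def by (rule restrict_ext) (rule limit_eq[OF that])
  have ratio_V: "(\<lambda>\<omega>. ratio_path (V \<omega>)) \<in> measurable P (skorohod_borel \<kappa> 1)"
    by (rule ratio_path_measurable[OF V])
  have "(\<lambda>N. \<integral>\<omega>. f (U N \<omega>) \<partial>M) \<longlonglongrightarrow> (\<integral>\<omega>. f (ratio_path (V \<omega>)) \<partial>P)"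
    if f: "continuous_map (skorohod_topology \<kappa> 1) euclideanreal f" "bounded (f ` cadlag_space \<kappa> 1)" for f
  proof (rule Metric_space.weak_convergence_of_lipschitz[where M="cadlag_space \<kappa> 1" and d="skorohod_dist \<kappa> 1"
        and f=f and X=U and Z="\<lambda>\<omega>. ratio_path (V \<omega>)", OF Metric_space_skorohod assms(1) P])
    show "U N \<in> measurable M (sigma (cadlag_space \<kappa> 1) {U. openin (Metric_space.mtopology (cadlag_space \<kappa> 1) (skorohod_dist \<kappa> 1)) U})" for N
      using U[of N] unfolding skorohod_borel_def skorohod_topology_def .
    show "(\<lambda>\<omega>. ratio_path (V \<omega>)) \<in> measurable P (sigma (cadlag_space \<kappa> 1) {U. openin (Metric_space.mtopology (cadlag_space \<kappa> 1) (skorohod_dist \<kappa> 1)) U})"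
      using ratio_V unfolding skorohod_borel_def skorohod_topology_def .
    show "continuous_map (Metric_space.mtopology (cadlag_space \<kappa> 1) (skorohod_dist \<kappa> 1)) euclideanreal f"
      using f(1) unfolding skorohod_topology_def .
    fix F k C
    assume F: "0 \<le> k" "\<And>x y. x \<in> cadlag_space \<kappa> 1 \<Longrightarrow> y \<in> cadlag_space \<kappa> 1 \<Longrightarrow> \<bar>F x - F y\<bar> \<le> k * skorohod_dist \<kappa> 1 x y"
      "\<And>x. x \<in> cadlag_space \<kappa> 1 \<Longrightarrow> \<bar>F x\<bar> \<le> C"
    show "(\<lambda>N. \<integral>\<omega>. F (U N \<omega>) \<partial>M) \<longlonglongrightarrow> (\<integral>\<omega>. F (ratio_path (V \<omega>)) \<partial>P)"
    proof (rule lipschitz_expectations_converge[where X=X and V=V and U=U and F=F and k=k and C=C,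
          OF assms(1) P X V weak U _ pos F])
      fix m :: nat and e :: real assume me: "0 < m" "0 < e"
      show "eventually (\<lambda>N. \<forall>\<omega>\<in>space M. degeneracy m (X N \<omega>) < 1 \<longrightarrow>
         (\<forall>s\<in>{\<kappa>..1}. \<bar>U N \<omega> s - truncated_ratio (1 / (2 * real m)) (X N \<omega>) s\<bar> \<le> e)) sequentially"
        unfolding U_def X_def
        by (rule vr_process_close[OF assms(5,6) Z me]) (use skorohod_measurable_cadlag[OF X] in \<open>simp_all add: X_def\<close>)
    qed
  qed (rule f(2))
  moreover have "(\<integral>\<omega>. f (sample_path \<kappa> 1 (vr_limit K \<zeta> B) \<omega>) \<partial>P) = (\<integral>\<omega>. f (ratio_path (V \<omega>)) \<partial>P)"
    for f :: "(real \<Rightarrow> real) \<Rightarrow> real"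
    by (rule Bochner_Integration.integral_cong) (simp_all add: path_eq)
  moreover have "sample_path \<kappa> 1 (vr_limit K \<zeta> B) \<in> measurable P (skorohod_borel \<kappa> 1)"
    using ratio_V by (subst measurable_cong[OF path_eq])
  ultimately have "weak_conv_cadlag \<kappa> 1 M (vr_process K h Y) P (vr_limit K \<zeta> B)"
    using U unfolding weak_conv_cadlag_def U_def by auto
  moreover have "AE \<omega> in P. continuous_on {\<kappa>..1} (\<lambda>s. vr_limit K \<zeta> B s \<omega>)"
  proof (rule AE_I2)
    fix \<omega> assume w: "\<omega> \<in> space P"
    then have "continuous_on {\<kappa>..1} (ratio (V \<omega>))" using bounded ratio_continuous by blast
    then show "continuous_on {\<kappa>..1} (\<lambda>s. vr_limit K \<zeta> B s \<omega>)"
      by (rule continuous_on_eq) (simp add: limit_eq[OF w])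
  qed
  ultimately show ?thesis ..
qed

end
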